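(* Let $n\ge2$, $1<p\le n$, let $\Omega\subset\mathbb{R}^n$ be a bounded open set, $\Gamma$ a closed subset of $\partial\Omega$, $\mathcal{A}$ satisfying the structure conditions described in the context, $\nu=\nu_+-\nu_-$ with $\nu_\pm$ nonnegative Radon measures on $\Omega$, and $0<\beta\le1$. Let $u,v\in W^{1,p}_{\complement\Gamma}(\Omega)\cap L^\infty_{\Gamma,\beta}(\Omega)$ be, respectively, a weak subsolution and a weak supersolution of $-\operatorname{div}\mathcal{A}(x,\nabla w)=\nu$ in $\Omega$, and assume that $u$ and $v$ are $p$-quasicontinuous on $\Omega$. Then $u\le v$ $p$-quasieverywhere on $\Omega$. In particular, if $u$ and $v$ are both weak solutions, then $u=v$ $p$-quasieverywhere on $\Omega$.
   Context: Structure conditions: $\mathcal{A}:\Omega\times\mathbb{R}^n\to\mathbb{R}^n$ is such that $\mathcal{A}(\cdot,z)$ is measurable for each $z$, $\mathcal{A}(x,\cdot)$ is continuous for each $x$, and for some $1\le L<\infty$ and all $x\in\Omega$, $z,z_1,z_2$ with $z_1\ne z_2$: $\mathcal{A}(x,z)\cdot z\ge|z|^p$, $|\mathcal{A}(x,z)|\le L|z|^{p-1}$, $(\mathcal{A}(x,z_1)-\mathcal{A}(x,z_2))\cdot(z_1-z_2)>0$. $\delta_\Gamma(x)=\mathrm{dist}(x,\Gamma)$. $W^{1,p}_0(\Omega)$ is the closure of $C_c^\infty(\Omega)$ in $\|\nabla\cdot\|_{L^p}$. $C^\infty_\Gamma(\Omega)$: smooth functions vanishing on a neighborhood of $\Gamma$.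 $W^{1,p}_{\complement\Gamma}(\Omega)=\{u\in W^{1,p}_{\mathrm{loc}}(\Omega): u\varphi\in W^{1,p}_0(\Omega)\ \forall\varphi\in C^\infty_\Gamma(\Omega)\}$. $L^\infty_{\Gamma,\beta}(\Omega)=\{u\in L^\infty(\Omega):\|u/\delta_\Gamma^\beta\|_{L^\infty(\Omega)}<\infty\}$. Weak subsolution (supersolution) $w\in W^{1,p}_{\mathrm{loc}}(\Omega)$: $\int_\Omega\mathcal{A}(x,\nabla w)\cdot\nabla\varphi\,dx\le\int_\Omega\varphi\,d\nu$ (resp. $\ge$) for all nonnegative $\varphi\in C_c^\infty(\Omega)$; weak solution: both. Capacity: for compact $K\subset\Omega$, $\mathrm{cap}_p(K,\Omega)=\inf\{\int|\nabla w|^p: w\in C_c^\infty(\Omega), w\ge1 \text{ on }K\}$; for $E\subset\Omega$, $\mathrm{cap}_p(E,\Omega)=\inf_{U\supset E\text{ open}}\sup_{K\subset U\text{ compact}}\mathrm{cap}_p(K,\Omega)$. "Quasieverywhere" means except on a set of zero $p$-capacity; a function is $p$-quasicontinuous if for every $\epsilon>0$ there is an open $G$ of $p$-capacity $<\epsilon$ such that its restriction to $\Omega\setminus G$ is continuous. *)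

theory Defs
  imports "HOL-Analysis.Analysis"
begin

definition partial :: "'a::euclidean_space \<Rightarrow> ('a \<Rightarrow> real) \<Rightarrow> 'a \<Rightarrow> real" where
  "partial b f x = frechet_derivative f (at x) b"

fun iter_partial :: "'a::euclidean_space list \<Rightarrow> ('a \<Rightarrow> real) \<Rightarrow> 'a \<Rightarrow> real" where
  "iter_partial [] f = f"
| "iter_partial (b # bs) f = partial b (iter_partial bs f)"

definition smooth :: "('a::euclidean_space \<Rightarrow> real) \<Rightarrow> bool" where
  "smooth f \<longleftrightarrow> (\<forall>bs. set bs \<subseteq> Basis \<longrightarrow> (\<forall>x. iter_partial bs f differentiable (at x)))"

definition grad :: "('a::euclidean_space \<Rightarrow> real) \<Rightarrow> 'a \<Rightarrow> 'a" where
  "grad f x = (\<Sum>i\<in>Basis. partial i f x *\<^sub>R i)"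

definition tsupport :: "('a::euclidean_space \<Rightarrow> real) \<Rightarrow> 'a set" where
  "tsupport f = closure {x. f x \<noteq> 0}"

definition test_fun :: "'a::euclidean_space set \<Rightarrow> ('a \<Rightarrow> real) \<Rightarrow> bool" where
  "test_fun \<Omega> \<phi> \<longleftrightarrow> smooth \<phi> \<and> compact (tsupport \<phi>) \<and> tsupport \<phi> \<subseteq> \<Omega>"

definition smooth_Gamma :: "'a::euclidean_space set \<Rightarrow> ('a \<Rightarrow> real) \<Rightarrow> bool" where
  "smooth_Gamma \<Gamma> \<phi> \<longleftrightarrow> smooth \<phi> \<and> (\<exists>U. open U \<and> \<Gamma> \<subseteq> U \<and> (\<forall>x\<in>U. \<phi> x = 0))"

definition Lp_loc :: "'a::euclidean_space set \<Rightarrow> real \<Rightarrow> ('a \<Rightarrow> real) \<Rightarrow> bool" where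
  "Lp_loc \<Omega> p f \<longleftrightarrow> f \<in> borel_measurable (restrict_space lebesgue \<Omega>) \<and>
     (\<forall>K. compact K \<and> K \<subseteq> \<Omega> \<longrightarrow> (\<integral>\<^sup>+ x\<in>K. ennreal (\<bar>f x\<bar> powr p) \<partial>lebesgue) < \<infinity>)"

definition Lp :: "'a::euclidean_space set \<Rightarrow> real \<Rightarrow> ('a \<Rightarrow> real) \<Rightarrow> bool" where
  "Lp \<Omega> p f \<longleftrightarrow> f \<in> borel_measurable (restrict_space lebesgue \<Omega>) \<and>
     (\<integral>\<^sup>+ x\<in>\<Omega>. ennreal (\<bar>f x\<bar> powr p) \<partial>lebesgue) < \<infinity>"

definition weak_grad :: "'a::euclidean_space set \<Rightarrow> ('a \<Rightarrow> real) \<Rightarrow> ('a \<Rightarrow> 'a) \<Rightarrow> bool" where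
  "weak_grad \<Omega> u g \<longleftrightarrow> Lp_loc \<Omega> 1 u \<and> (\<forall>i\<in>Basis. Lp_loc \<Omega> 1 (\<lambda>x. g x \<bullet> i)) \<and>
     (\<forall>\<phi> i. test_fun \<Omega> \<phi> \<and> i \<in> Basis \<longrightarrow>
        (LINT x:\<Omega>|lebesgue. u x * partial i \<phi> x) = - (LINT x:\<Omega>|lebesgue. (g x \<bullet> i) * \<phi> x))"

definition W1p_loc :: "'a::euclidean_space set \<Rightarrow> real \<Rightarrow> ('a \<Rightarrow> real) \<Rightarrow> bool" where
  "W1p_loc \<Omega> p u \<longleftrightarrow> Lp_loc \<Omega> p u \<and> (\<exists>g. weak_grad \<Omega> u g \<and> Lp_loc \<Omega> p (\<lambda>x. norm (g x)))"

text \<open>W^{1,p}_0(Omega): closure of C_c^infinity(Omega) (Omega bounded, so the gradient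
  norm is equivalent to the full Sobolev norm; we approximate both u and its gradient).\<close>
definition W1p0 :: "'a::euclidean_space set \<Rightarrow> real \<Rightarrow> ('a \<Rightarrow> real) \<Rightarrow> bool" where
  "W1p0 \<Omega> p u \<longleftrightarrow> Lp \<Omega> p u \<and> (\<exists>g. weak_grad \<Omega> u g \<and> Lp \<Omega> p (\<lambda>x. norm (g x)) \<and>
     (\<exists>\<phi>::nat \<Rightarrow> 'a \<Rightarrow> real. (\<forall>k. test_fun \<Omega> (\<phi> k)) \<and>
        ((\<lambda>k. \<integral>\<^sup>+ x\<in>\<Omega>. ennreal (\<bar>\<phi> k x - u x\<bar> powr p) \<partial>lebesgue) \<longlonglongrightarrow> 0) \<and>
        ((\<lambda>k. \<integral>\<^sup>+ x\<in>\<Omega>. ennreal (norm (grad (\<phi> k) x - g x) powr p) \<partial>lebesgue) \<longlonglongrightarrow> 0)))"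

definition W1p_cGamma :: "'a::euclidean_space set \<Rightarrow> 'a set \<Rightarrow> real \<Rightarrow> ('a \<Rightarrow> real) \<Rightarrow> bool" where
  "W1p_cGamma \<Omega> \<Gamma> p u \<longleftrightarrow> W1p_loc \<Omega> p u \<and>
     (\<forall>\<phi>. smooth_Gamma \<Gamma> \<phi> \<longrightarrow> W1p0 \<Omega> p (\<lambda>x. u x * \<phi> x))"

text \<open>L^infinity_{Gamma,beta}(Omega), with delta_Gamma = dist(.,Gamma); for Gamma empty
  delta_Gamma = infinity and the weighted condition is vacuous.\<close>
definition Linf_Gamma_beta :: "'a::euclidean_space set \<Rightarrow> 'a set \<Rightarrow> real \<Rightarrow> ('a \<Rightarrow> real) \<Rightarrow> bool" where
  "Linf_Gamma_beta \<Omega> \<Gamma> \<beta> u \<longleftrightarrow> u \<in> borel_measurable (restrict_space lebesgue \<Omega>) \<and>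
     (\<exists>C. AE x in lebesgue. x \<in> \<Omega> \<longrightarrow> \<bar>u x\<bar> \<le> C) \<and>
     (\<Gamma> \<noteq> {} \<longrightarrow> (\<exists>C. AE x in lebesgue. x \<in> \<Omega> \<longrightarrow> \<bar>u x\<bar> \<le> C * infdist x \<Gamma> powr \<beta>))"

definition structure_cond :: "'a::euclidean_space set \<Rightarrow> real \<Rightarrow> real \<Rightarrow> ('a \<Rightarrow> 'a \<Rightarrow> 'a) \<Rightarrow> bool" where
  "structure_cond \<Omega> p L \<A> \<longleftrightarrow>
     (\<forall>z. (\<lambda>x. \<A> x z) \<in> borel_measurable (restrict_space lebesgue \<Omega>)) \<and>
     (\<forall>x\<in>\<Omega>. continuous_on UNIV (\<A> x)) \<and>
     (\<forall>x\<in>\<Omega>. \<forall>z. \<A> x z \<bullet> z \<ge> norm z powr p) \<and>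
     (\<forall>x\<in>\<Omega>. \<forall>z. norm (\<A> x z) \<le> L * norm z powr (p - 1)) \<and>
     (\<forall>x\<in>\<Omega>. \<forall>z1 z2. z1 \<noteq> z2 \<longrightarrow> (\<A> x z1 - \<A> x z2) \<bullet> (z1 - z2) > 0)"

text \<open>Nonnegative Radon measure on Omega: a Borel measure carried by Omega that is finite
  on compact subsets of Omega (in R^n such measures are automatically regular).\<close>
definition radon_on :: "'a::euclidean_space set \<Rightarrow> 'a measure \<Rightarrow> bool" where
  "radon_on \<Omega> \<mu> \<longleftrightarrow> sets \<mu> = sets borel \<and> emeasure \<mu> (UNIV - \<Omega>) = 0 \<and>
     (\<forall>K. compact K \<and> K \<subseteq> \<Omega> \<longrightarrow> emeasure \<mu> K < \<infinity>)"

definition int_signed :: "'a::euclidean_space measure \<Rightarrow> 'a measure \<Rightarrow> ('a \<Rightarrow> real) \<Rightarrow> real" where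
  "int_signed \<nu>p \<nu>m \<phi> = (\<integral>x. \<phi> x \<partial>\<nu>p) - (\<integral>x. \<phi> x \<partial>\<nu>m)"

definition weak_subsol ::
  "'a::euclidean_space set \<Rightarrow> real \<Rightarrow> ('a \<Rightarrow> 'a \<Rightarrow> 'a) \<Rightarrow> 'a measure \<Rightarrow> 'a measure \<Rightarrow> ('a \<Rightarrow> real) \<Rightarrow> bool" where
  "weak_subsol \<Omega> p \<A> \<nu>p \<nu>m w \<longleftrightarrow> W1p_loc \<Omega> p w \<and> (\<exists>g. weak_grad \<Omega> w g \<and>
     (\<forall>\<phi>. test_fun \<Omega> \<phi> \<and> (\<forall>x. \<phi> x \<ge> 0) \<longrightarrow>
        (LINT x:\<Omega>|lebesgue. \<A> x (g x) \<bullet> grad \<phi> x) \<le> int_signed \<nu>p \<nu>m \<phi>))"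

definition weak_supersol ::
  "'a::euclidean_space set \<Rightarrow> real \<Rightarrow> ('a \<Rightarrow> 'a \<Rightarrow> 'a) \<Rightarrow> 'a measure \<Rightarrow> 'a measure \<Rightarrow> ('a \<Rightarrow> real) \<Rightarrow> bool" where
  "weak_supersol \<Omega> p \<A> \<nu>p \<nu>m w \<longleftrightarrow> W1p_loc \<Omega> p w \<and> (\<exists>g. weak_grad \<Omega> w g \<and>
     (\<forall>\<phi>. test_fun \<Omega> \<phi> \<and> (\<forall>x. \<phi> x \<ge> 0) \<longrightarrow>
        (LINT x:\<Omega>|lebesgue. \<A> x (g x) \<bullet> grad \<phi> x) \<ge> int_signed \<nu>p \<nu>m \<phi>))"

definition weak_sol ::
  "'a::euclidean_space set \<Rightarrow> real \<Rightarrow> ('a \<Rightarrow> 'a \<Rightarrow> 'a) \<Rightarrow> 'a measure \<Rightarrow> 'a measure \<Rightarrow> ('a \<Rightarrow> real) \<Rightarrow> bool" where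
  "weak_sol \<Omega> p \<A> \<nu>p \<nu>m w \<longleftrightarrow> weak_subsol \<Omega> p \<A> \<nu>p \<nu>m w \<and> weak_supersol \<Omega> p \<A> \<nu>p \<nu>m w"

definition cap_compact :: "real \<Rightarrow> 'a::euclidean_space set \<Rightarrow> 'a set \<Rightarrow> ennreal" where
  "cap_compact p K \<Omega> = (INF w \<in> {w. test_fun \<Omega> w \<and> (\<forall>x\<in>K. w x \<ge> 1)}.
      \<integral>\<^sup>+ x. ennreal (norm (grad w x) powr p) \<partial>lebesgue)"

definition cap :: "real \<Rightarrow> 'a::euclidean_space set \<Rightarrow> 'a set \<Rightarrow> ennreal" where
  "cap p E \<Omega> = (INF U \<in> {U. open U \<and> E \<subseteq> U \<and> U \<subseteq> \<Omega>}.
      SUP K \<in> {K. compact K \<and> K \<subseteq> U}. cap_compact p K \<Omega>)"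

definition quasicont :: "real \<Rightarrow> 'a::euclidean_space set \<Rightarrow> ('a \<Rightarrow> real) \<Rightarrow> bool" where
  "quasicont p \<Omega> u \<longleftrightarrow> (\<forall>\<epsilon>>0. \<exists>G. open G \<and> G \<subseteq> \<Omega> \<and> cap p G \<Omega> < ennreal \<epsilon> \<and>
      continuous_on (\<Omega> - G) u)"

definition qe :: "real \<Rightarrow> 'a::euclidean_space set \<Rightarrow> ('a \<Rightarrow> bool) \<Rightarrow> bool" where
  "qe p \<Omega> P \<longleftrightarrow> (\<exists>E. E \<subseteq> \<Omega> \<and> cap p E \<Omega> = 0 \<and> (\<forall>x\<in>\<Omega> - E. P x))"

end

theory Submission
  imports Defs
begin

text \<open>Let \<open>w = u - v\<close>. Subtracting the two inequalities removes the measure \<open>\<nu>\<close>. Since \<open>w\<close> is bounded by a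
  multiple of \<open>\<delta>\<^sub>\<Gamma>\<^sup>\<beta>\<close>, it is at most \<open>\<epsilon>\<close> near \<open>\<Gamma>\<close>, so for a smooth nondecreasing \<open>F\<close> with \<open>F > 0\<close>
  exactly on \<open>(\<epsilon>, \<infinity>)\<close> the function \<open>F(w)\<close> vanishes near \<open>\<Gamma>\<close> and is a limit of admissible test functions.
  Strict monotonicity of \<open>\<A>\<close> then gives \<open>F'(w) \<nabla>w = 0\<close>, hence \<open>F(w) = 0\<close> by an \<open>L\<^sup>1\<close> Poincare
  inequality, and \<open>u \<le> v\<close> almost everywhere as \<open>\<epsilon> \<rightarrow> 0\<close>.

  To pass to quasieverywhere, let \<open>G\<close> be an open set of small capacity off which \<open>u\<close> and \<open>v\<close> are
  continuous. Then \<open>U = {u > v} \<union> G\<close> is open and \<open>U - G\<close> is a null set. A function that is at least 1 on a large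
  compact part of \<open>G\<close> has box averages at least 1/2 on any given compact subset of \<open>U\<close>, provided the boxes
  are small, and averaging does not increase the energy; so the capacity of \<open>U\<close> is bounded
  by a constant times that of \<open>G\<close>.\<close>

section \<open>Smooth functions\<close>

text \<open>The gradients of \<open>u\<close> and \<open>v\<close> need not be p-integrable up to
  \<Gamma>, and the inequalities are assumed only for smooth compactly supported tests. Hence all
  nonlinear operations are carried out on smooth approximants of \<open>u * \<phi>\<close> and
  \<open>v * \<phi>\<close>, where the cutoff \<phi> vanishes near \<Gamma>, and limits are taken
  under one p-integrable majorant of all approximating gradients. This is why a bounded smooth F
  with bounded derivative stands in for the positive part of \<open>w - \<epsilon>\<close>: it maps
  test functions to test functions. A second cutoff \<eta> confines the tests to the region where
  \<phi> is 1; its gradient lives where \<open>w\<close> is at most \<epsilon>, so its contribution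
  disappears in the limit.

  The obstacle in the second half is that a null set can have positive capacity. An average depends
  only on values up to null sets, so the exceptional set \<open>U - G\<close> cannot lower it. Boxes
  serve as averaging sets because integrals over a fixed box can be differentiated under the
  integral sign.\<close>

lemma partial_eqI:
  assumes "(f has_derivative f') (at x)"
  shows "partial b f x = f' b"
  using frechet_derivative_at[OF assms] by (simp add: partial_def)

lemma has_derivative_frechet:
  "f differentiable (at x) \<Longrightarrow> (f has_derivative frechet_derivative f (at x)) (at x)"
  by (simp add: frechet_derivative_works)

lemma partial_add:
  assumes "f differentiable (at x)" "g differentiable (at x)"
  shows "partial b (\<lambda>x. f x + g x) x = partial b f x + partial b g x"
  using partial_eqI[OF has_derivative_add[OF assms[THEN has_derivative_frechet]], of b]
  by (simp add: partial_def)

lemma partial_mult: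
  assumes "f differentiable (at x)" "g differentiable (at x)"
  shows "partial b (\<lambda>x. f x * g x) x = partial b f x * g x + f x * partial b g x"
  using partial_eqI[OF has_derivative_mult[OF assms[THEN has_derivative_frechet]], of b]
  by (simp add: partial_def algebra_simps)

inductive_set smooth_alg :: "('a::euclidean_space \<Rightarrow> real) set \<Rightarrow> ('a \<Rightarrow> real) set"
  for S where
  gen: "f \<in> S \<Longrightarrow> f \<in> smooth_alg S"
| smooth: "smooth f \<Longrightarrow> f \<in> smooth_alg S"
| add: "f \<in> smooth_alg S \<Longrightarrow> g \<in> smooth_alg S \<Longrightarrow> (\<lambda>x. f x + g x) \<in> smooth_alg S"
| mult: "f \<in> smooth_alg S \<Longrightarrow> g \<in> smooth_alg S \<Longrightarrow> (\<lambda>x. f x * g x) \<in> smooth_alg S"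

lemma iter_partial_snoc: "iter_partial (bs @ [b]) f = iter_partial bs (partial b f)"
  by (induction bs) auto

lemma smooth_differentiable: "smooth f \<Longrightarrow> f differentiable (at x)"
  unfolding smooth_def by (drule spec[of _ "[]"]) simp

lemma smooth_partial:
  assumes "smooth f" "b \<in> Basis"
  shows "smooth (partial b f)"
  unfolding smooth_def
proof (intro allI impI)
  fix bs x assume "set bs \<subseteq> (Basis :: 'a set)"
  then have "set (bs @ [b]) \<subseteq> Basis" using assms by simp
  then show "iter_partial bs (partial b f) differentiable at x"
    using assms(1) unfolding smooth_def iter_partial_snoc[symmetric] by blast
qed

text \<open>Coinduction up to the algebra generated by the smooth functions: a set \<open>S\<close> consists of smooth
  functions as soon as the partial derivatives of its members are polynomial expressions in members
  of \<open>S\<close> and smooth functions.\<close>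

lemma smooth_algI:
  assumes S: "\<And>f x. f \<in> S \<Longrightarrow> f differentiable (at x)"
    "\<And>f b. f \<in> S \<Longrightarrow> b \<in> Basis \<Longrightarrow> partial b f \<in> smooth_alg S"
    and f: "f \<in> smooth_alg S"
  shows "smooth f"
proof -
  \<comment> \<open>The sum and product rules keep partial derivatives inside the algebra, so one
    derivative can be followed by another to any order.\<close>
  have *: "(\<forall>x. g differentiable (at x)) \<and> (\<forall>b\<in>Basis. partial b g \<in> smooth_alg S)"
    if "g \<in> smooth_alg S" for g
    using that
  proof induction
    case (gen f)
    then show ?case using S by auto
  next
    case (smooth f)
    then show ?case by (auto intro: smooth_differentiable smooth_partial smooth_alg.smooth)
  next
    case (add f g)
    then have "partial b (\<lambda>x. f x + g x) = (\<lambda>x. partial b f x + partial b g x)" for b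
      by (auto intro!: ext partial_add)
    with add show ?case by (auto intro!: smooth_alg.add)
  next
    case (mult f g)
    then have "partial b (\<lambda>x. f x * g x) = (\<lambda>x. partial b f x * g x + f x * partial b g x)" for b
      by (auto intro!: ext partial_mult)
    with mult show ?case by (auto intro!: smooth_alg.add smooth_alg.mult)
  qed
  have "set bs \<subseteq> Basis \<Longrightarrow> iter_partial bs f \<in> smooth_alg S" for bs
    by (induction bs) (use f * in auto)
  with * show ?thesis unfolding smooth_def by blast
qed

lemma smooth_add: "smooth f \<Longrightarrow> smooth g \<Longrightarrow> smooth (\<lambda>x. f x + g x)"
  by (rule smooth_algI[of "{}"]) (auto intro: smooth_alg.intros)

lemma smooth_mult: "smooth f \<Longrightarrow> smooth g \<Longrightarrow> smooth (\<lambda>x. f x * g x)"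
  by (rule smooth_algI[of "{}"]) (auto intro: smooth_alg.intros)

lemma smooth_const: "smooth (\<lambda>x. c)"
proof (rule smooth_algI[of "range (\<lambda>c x. c)"])
  fix f :: "'a \<Rightarrow> real" and b :: 'a assume f: "f \<in> range (\<lambda>c x. c)"
  then obtain c where [simp]: "f = (\<lambda>x. c)" by auto
  show "f differentiable (at x)" for x by simp
  have "partial b f = (\<lambda>x. 0)"
    by (rule ext) (simp add: partial_eqI[OF has_derivative_const])
  then show "partial b f \<in> smooth_alg (range (\<lambda>c x. c))"
    by (auto intro: smooth_alg.gen)
qed (auto intro: smooth_alg.gen)

lemma smooth_linear:
  assumes "bounded_linear f"
  shows "smooth f"
proof (rule smooth_algI[of "{f}"])
  have D: "(f has_derivative f) (at x)" for x
    by (rule bounded_linear_imp_has_derivative[OF assms])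
  fix g x assume "g \<in> {f}" then show "g differentiable (at x)" using D by (auto simp: differentiable_def)
next
  have D: "(f has_derivative f) (at x)" for x
    by (rule bounded_linear_imp_has_derivative[OF assms])
  fix g b assume "g \<in> {f}"
  moreover have "partial b f = (\<lambda>x. f b)" by (rule ext) (simp add: partial_eqI[OF D])
  ultimately show "partial b g \<in> smooth_alg {f}" using smooth_const smooth_alg.smooth by auto
qed (auto intro: smooth_alg.gen)

lemma smooth_cmult: "smooth f \<Longrightarrow> smooth (\<lambda>x. c * f x)"
  by (intro smooth_mult smooth_const)

lemma smooth_minus: "smooth f \<Longrightarrow> smooth g \<Longrightarrow> smooth (\<lambda>x. f x - g x)"
  using smooth_add[OF _ smooth_cmult[of g "-1"]] by simp

lemma smooth_sum: "(\<And>i. i \<in> I \<Longrightarrow> smooth (f i)) \<Longrightarrow> smooth (\<lambda>x. \<Sum>i\<in>I. f i x)"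
  by (induction I rule: infinite_finite_induct) (auto intro: smooth_const smooth_add)

text \<open>Since 1 is the only basis vector of the reals, \<open>partial 1 h\<close> is the
  ordinary derivative of \<open>h\<close>, and the chain rule takes its one-variable form.\<close>

lemma has_derivative_compose_real:
  fixes h :: "real \<Rightarrow> real"
  assumes "h differentiable (at (f x))" "f differentiable (at x)"
  shows "((\<lambda>x. h (f x)) has_derivative (\<lambda>v. partial 1 h (f x) * frechet_derivative f (at x) v)) (at x)"
proof -
  have h: "(h has_derivative frechet_derivative h (at (f x))) (at (f x))"
    using assms(1) by (rule has_derivative_frechet)
  have "frechet_derivative h (at (f x)) t = partial 1 h (f x) * t" for t
    using linear_scale[OF has_derivative_linear[OF h], of t 1] by (simp add: partial_def)
  then have "(h has_derivative (\<lambda>t. partial 1 h (f x) * t)) (at (f x))"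
    by (metis (no_types, lifting) ext h)
  from has_derivative_compose[OF has_derivative_frechet[OF assms(2)] this] show ?thesis .
qed

lemma partial_compose:
  assumes "h differentiable (at (f x))" "f differentiable (at x)"
  shows "partial b (\<lambda>x. h (f x)) x = partial 1 h (f x) * partial b f x"
  using partial_eqI[OF has_derivative_compose_real[of h f x, OF assms], of b] unfolding partial_def[of b f] .

text \<open>With \<open>f\<close> fixed and \<open>h\<close> ranging over all smooth functions, the
  compositions form a generating set: a partial derivative is again such a composition, with the
  derivative of \<open>h\<close>, times a smooth function.\<close>

lemma smooth_compose:
  assumes "smooth h" "smooth f"
  shows "smooth (\<lambda>x. h (f x))"
proof (rule smooth_algI[of "{\<lambda>x. h (f x) | h. smooth h}"])
  fix g b x assume "g \<in> {\<lambda>x. h (f x) | h. smooth h}"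
  then obtain h where h: "smooth h" and g: "g = (\<lambda>x. h (f x))" by auto
  show "g differentiable (at x)"
    unfolding g differentiable_def
    using has_derivative_compose_real[OF smooth_differentiable[OF h] smooth_differentiable[OF assms(2)]]
    by blast
  assume b: "b \<in> (Basis::'a set)"
  have "partial b g = (\<lambda>x. partial 1 h (f x) * partial b f x)"
    unfolding g by (intro ext partial_compose smooth_differentiable h assms(2))
  moreover have "smooth (partial 1 h)" by (rule smooth_partial[OF h]) simp
  ultimately show "partial b g \<in> smooth_alg {\<lambda>x. h (f x) | h. smooth h}"
    using smooth_partial[OF assms(2) b]
    by (auto intro!: smooth_alg.mult[OF smooth_alg.gen smooth_alg.smooth])
qed (use assms in \<open>auto intro: smooth_alg.gen\<close>)

text \<open>The reciprocal alone generates a suitable algebra, because its partial derivatives are a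
  smooth function times its own square.\<close>

lemma smooth_inverse:
  assumes f: "smooth f" and nz: "\<And>x. f x \<noteq> 0"
  shows "smooth (\<lambda>x. inverse (f x))"
proof (rule smooth_algI[of "{\<lambda>x. inverse (f x)}"])
  have D: "((\<lambda>x. inverse (f x)) has_derivative
      (\<lambda>h. - (inverse (f x) * frechet_derivative f (at x) h * inverse (f x)))) (at x)" for x
    by (rule Deriv.has_derivative_inverse) (use has_derivative_frechet[OF smooth_differentiable[OF f]] nz in auto)
  fix g b x assume g: "g \<in> {\<lambda>x. inverse (f x)}"
  show "g differentiable (at x)" using g D by (auto simp: differentiable_def)
  assume b: "b \<in> (Basis::'a set)"
  have "partial b g = (\<lambda>x. ((-1) * partial b f x) * (inverse (f x) * inverse (f x)))"
    using g by (intro ext) (simp add: partial_eqI[OF D] partial_def)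
  moreover have "\<dots> \<in> smooth_alg {\<lambda>x. inverse (f x)}"
    by (rule smooth_alg.mult[OF smooth_alg.mult[OF smooth_alg.smooth[OF smooth_const]
          smooth_alg.smooth[OF smooth_partial[OF f b]]] smooth_alg.mult[OF smooth_alg.gen smooth_alg.gen]]) auto
  ultimately show "partial b g \<in> smooth_alg {\<lambda>x. inverse (f x)}" by simp
qed (auto intro: smooth_alg.gen)

subsection \<open>The flat function\<close>

text \<open>For \<open>k = 0\<close> this is the classical smooth function exp(-1/t), extended by 0.
  The extra powers of 1/t make the family closed under differentiation up to linear combinations; in
  particular the derivative of \<open>flat 0\<close> is \<open>flat 2\<close>.\<close>

definition flat :: "nat \<Rightarrow> real \<Rightarrow> real" where
  "flat k t = (if t \<le> 0 then 0 else (1 / t) ^ k * exp (- (1 / t)))"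

lemma flat_tendsto_0: "(flat k \<longlongrightarrow> 0) (at_right 0)"
proof -
  have "((\<lambda>y. y ^ k / exp y) \<longlongrightarrow> (0::real)) at_top"
    by (rule tendsto_power_div_exp_0)
  from filterlim_compose[OF this filterlim_inverse_at_top_right]
  have "((\<lambda>t. (1/t) ^ k * exp (- (1/t))) \<longlongrightarrow> (0::real)) (at_right 0)"
    by (simp add: field_simps exp_minus)
  then show ?thesis
    by (rule Lim_transform_eventually) (auto simp: flat_def eventually_at_right_less intro!: eventually_at_rightI[of 0 1])
qed

lemma flat_has_derivative:
  "(flat k has_field_derivative (flat (k+2) t - real k * flat (k+1) t)) (at t)"
proof -
  consider "t < 0" | "t > 0" | "t = 0" by linarith
  then show ?thesis
  proof cases
    case 1
    have "((\<lambda>t. 0) has_field_derivative 0) (at t)" by simp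
    then have "(flat k has_field_derivative 0) (at t)"
      by (rule has_field_derivative_transform_within_open[where S="{..<0}"]) (use 1 in \<open>auto simp: flat_def\<close>)
    then show ?thesis using 1 by (simp add: flat_def)
  next
    case 2
    have "((\<lambda>t. (1/t) ^ k) has_field_derivative real k * (1/t) ^ (k - 1) * (- ((1/t) * (1/t)))) (at t)"
      using 2 by (intro DERIV_power[THEN DERIV_cong] derivative_eq_intros refl) auto
    moreover have "((\<lambda>t. exp (- (1/t))) has_field_derivative exp (- (1/t)) * ((1/t) * (1/t))) (at t)"
      using 2 by (auto intro!: derivative_eq_intros)
    moreover have "real k * r ^ (k - 1) * (- (r * r)) * e + e * (r * r) * r ^ k
        = r ^ (k+2) * e - real k * (r ^ (k+1) * e)" for r e :: real
      by (cases k) (auto simp: algebra_simps)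
    moreover have "flat j t = (1/t) ^ j * exp (- (1/t))" for j
      using 2 by (simp add: flat_def)
    ultimately have "((\<lambda>t. (1/t) ^ k * exp (- (1/t))) has_field_derivative
        (flat (k+2) t - real k * flat (k+1) t)) (at t)"
      by (simp only: DERIV_mult[THEN DERIV_cong])
    then show ?thesis
      by (rule has_field_derivative_transform_within_open[where S="{0<..}"]) (use 2 in \<open>auto simp: flat_def\<close>)
  next
    case 3
    \<comment> \<open>For positive \<open>h\<close> the difference quotient at 0 is exactly
      \<open>flat (Suc k) h\<close>.\<close>
    have "((\<lambda>h. flat k h / h) \<longlongrightarrow> 0) (at_right 0)"
      by (rule Lim_transform_eventually[OF flat_tendsto_0[of "Suc k"]])
        (auto simp: flat_def intro!: eventually_at_rightI[of 0 1])
    moreover have "((\<lambda>h. flat k h / h) \<longlongrightarrow> 0) (at_left 0)"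
      by (rule Lim_transform_eventually[OF tendsto_const])
        (auto simp: flat_def intro!: eventually_at_leftI[of "-1"])
    ultimately have "((\<lambda>h. flat k h / h) \<longlongrightarrow> 0) (at 0)"
      by (simp add: filterlim_at_split)
    then show ?thesis using 3 by (simp add: DERIV_def flat_def)
  qed
qed

lemma partial_flat: "partial 1 (flat k) t = flat (k+2) t - real k * flat (k+1) t"
  using partial_eqI[OF flat_has_derivative[unfolded has_field_derivative_def]] by simp

lemma smooth_flat: "smooth (flat k)"
proof (rule smooth_algI[of "range flat"])
  fix g b x assume "g \<in> range flat"
  then obtain k where g: "g = flat k" by auto
  show "g differentiable (at x)"
    using flat_has_derivative unfolding g by (auto simp: has_field_derivative_def differentiable_def)
  assume "b \<in> (Basis :: real set)"
  then have "partial b g = (\<lambda>t. flat (k+2) t + (- real k) * flat (k+1) t)"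
    by (intro ext) (simp add: g partial_flat)
  moreover have "\<dots> \<in> smooth_alg (range flat)"
    by (rule smooth_alg.add[OF smooth_alg.gen smooth_alg.mult[OF smooth_alg.smooth[OF smooth_const] smooth_alg.gen]]) auto
  ultimately show "partial b g \<in> smooth_alg (range flat)" by simp
qed (auto intro: smooth_alg.gen)

lemma flat_0_pos_iff [simp]: "0 < flat k t \<longleftrightarrow> 0 < t"
  by (auto simp: flat_def)

lemma flat_nonneg [simp]: "0 \<le> flat k t"
  by (simp add: flat_def)

lemma flat_nonpos [simp]: "t \<le> 0 \<Longrightarrow> flat k t = 0"
  by (simp add: flat_def)

lemma flat_0_le_1: "flat 0 t \<le> 1"
  by (simp add: flat_def)

lemma flat_0_mono: "s \<le> t \<Longrightarrow> flat 0 s \<le> flat 0 t"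
  by (auto simp: flat_def divide_simps)

text \<open>With s = 1/t the claim reads s^2 / 2 \<le> exp s, a consequence of the Taylor expansion.
  It bounds the derivative of \<open>flat 0\<close>, and is the source of the factor 2 in the later
  gradient estimates.\<close>

lemma flat_2_le_2: "flat 2 t \<le> 2"
proof (cases "t > 0")
  case True
  have "(1/t)\<^sup>2 / 2 \<le> exp (1/t)"
    using exp_lower_Taylor_quadratic[of "1/t"] True by (smt (verit) divide_nonneg_nonneg)
  then show ?thesis using True by (simp add: flat_def exp_minus divide_simps mult.commute)
qed auto

subsection \<open>Gradients\<close>

lemma has_derivative_grad:
  assumes "f differentiable (at x)"
  shows "(f has_derivative (\<lambda>h. grad f x \<bullet> h)) (at x)"
proof -
  have D: "(f has_derivative frechet_derivative f (at x)) (at x)"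
    using assms by (rule has_derivative_frechet)
  have "frechet_derivative f (at x) h = grad f x \<bullet> h" for h
  proof -
    have "frechet_derivative f (at x) h = frechet_derivative f (at x) (\<Sum>i\<in>Basis. (h \<bullet> i) *\<^sub>R i)"
      by (simp add: euclidean_representation)
    also have "\<dots> = (\<Sum>i\<in>Basis. (h \<bullet> i) * frechet_derivative f (at x) i)"
      using has_derivative_linear[OF D] by (simp add: linear_sum linear_scale)
    also have "\<dots> = grad f x \<bullet> h"
      by (simp add: grad_def partial_def inner_sum_left inner_commute[of h] mult.commute)
    finally show ?thesis .
  qed
  with D show ?thesis by (metis (no_types, lifting) ext)
qed

lemma grad_eqI:
  assumes "(f has_derivative (\<lambda>h. v \<bullet> h)) (at x)"
  shows "grad f x = v"
  by (simp add: grad_def partial_eqI[OF assms] euclidean_representation)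

lemma grad_inner_Basis: "i \<in> Basis \<Longrightarrow> grad f x \<bullet> i = partial i f x"
  by (simp add: grad_def inner_sum_left inner_Basis if_distrib cong: if_cong)

lemma smooth_has_derivative:
  "smooth f \<Longrightarrow> (f has_derivative (\<lambda>h. grad f x \<bullet> h)) (at x)"
  by (intro has_derivative_grad smooth_differentiable)

lemma grad_add:
  assumes "smooth f" "smooth g"
  shows "grad (\<lambda>x. f x + g x) x = grad f x + grad g x"
  by (rule grad_eqI)
    (use has_derivative_add[OF assms[THEN smooth_has_derivative]] in \<open>simp add: inner_add_left\<close>)

lemma grad_minus:
  assumes "smooth f" "smooth g"
  shows "grad (\<lambda>x. f x - g x) x = grad f x - grad g x"
  by (rule grad_eqI)
    (use has_derivative_diff[OF assms[THEN smooth_has_derivative]] in \<open>simp add: inner_diff_left\<close>)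

lemma grad_mult:
  assumes "smooth f" "smooth g"
  shows "grad (\<lambda>x. f x * g x) x = g x *\<^sub>R grad f x + f x *\<^sub>R grad g x"
  by (rule grad_eqI)
    (use has_derivative_mult[OF assms[THEN smooth_has_derivative]] in \<open>simp add: inner_add_left algebra_simps\<close>)

lemma grad_const [simp]: "grad (\<lambda>x. c) x = 0"
  by (rule grad_eqI) simp

lemma grad_cmult: "smooth f \<Longrightarrow> grad (\<lambda>x. c * f x) x = c *\<^sub>R grad f x"
  using grad_mult[OF smooth_const, of f] by simp

lemma grad_compose:
  assumes "smooth h" "smooth f"
  shows "grad (\<lambda>x. h (f x)) x = partial 1 h (f x) *\<^sub>R grad f x"
  unfolding grad_def scaleR_sum_right
  by (simp add: partial_compose[OF assms[THEN smooth_differentiable]])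

lemma grad_cong:
  assumes "open S" "x \<in> S" "\<And>y. y \<in> S \<Longrightarrow> f y = g y" "f differentiable (at x)"
  shows "grad g x = grad f x"
  by (intro grad_eqI has_derivative_transform_within_open[OF has_derivative_grad[OF assms(4)] assms(1,2)] assms(3))

lemma smooth_continuous: "smooth f \<Longrightarrow> continuous_on S f"
  by (meson continuous_at_imp_continuous_on differentiable_imp_continuous_within smooth_differentiable)

lemma smooth_continuous_grad: "smooth f \<Longrightarrow> continuous_on S (grad f)"
  unfolding grad_def by (intro continuous_intros smooth_continuous smooth_partial)

lemma borel_measurable_smooth: "smooth f \<Longrightarrow> f \<in> borel_measurable borel"
  by (intro borel_measurable_continuous_onI smooth_continuous)

lemma borel_measurable_grad: "smooth f \<Longrightarrow> grad f \<in> borel_measurable borel"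
  by (intro borel_measurable_continuous_onI smooth_continuous_grad)

lemma grad_lipschitz:
  assumes f: "smooth f" and C: "\<And>z. norm (grad f z) \<le> C"
  shows "\<bar>f x - f y\<bar> \<le> C * norm (x - y)"
proof -
  have "norm (f x - f y) \<le> C * norm (x - y)"
  proof (rule differentiable_bound[where S=UNIV])
    fix z
    show "onorm (\<lambda>h. grad f z \<bullet> h) \<le> C"
      by (rule onorm_bound)
        (meson C norm_ge_zero order_trans, metis C Cauchy_Schwarz_ineq2 mult_right_mono norm_ge_zero order_trans real_norm_def)
  qed (use smooth_has_derivative[OF f] in auto)
  then show ?thesis by simp
qed

subsection \<open>Test functions\<close>

lemma test_fun_smooth: "test_fun S f \<Longrightarrow> smooth f"
  by (simp add: test_fun_def)

lemma notin_tsupport: "x \<notin> tsupport f \<Longrightarrow> f x = 0"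
  using closure_subset[of "{x. f x \<noteq> 0}"] by (auto simp: tsupport_def)

lemma grad_notin_tsupport:
  assumes "x \<notin> tsupport f"
  shows "grad f x = 0"
proof -
  have "grad f x = grad (\<lambda>x. 0) x"
    by (rule grad_cong[of "- tsupport f"]) (use assms notin_tsupport in \<open>auto simp: tsupport_def\<close>)
  then show ?thesis by simp
qed

lemma partial_notin_tsupport: "x \<notin> tsupport f \<Longrightarrow> i \<in> Basis \<Longrightarrow> partial i f x = 0"
  using grad_notin_tsupport[of x f] grad_inner_Basis[of i f x] by simp

lemma test_funI:
  assumes "smooth f" "compact K" "K \<subseteq> S" "\<And>x. x \<notin> K \<Longrightarrow> f x = 0"
  shows "test_fun S f"
proof -
  have "tsupport f \<subseteq> K"
    unfolding tsupport_def using assms by (intro closure_minimal compact_imp_closed) auto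
  moreover from this assms have "compact (tsupport f)"
    using bounded_subset[of K] by (simp add: compact_eq_bounded_closed tsupport_def)
  ultimately show ?thesis
    using assms by (auto simp: test_fun_def)
qed

lemma test_funD:
  assumes "test_fun S f"
  shows "smooth f" "compact (tsupport f)" "tsupport f \<subseteq> S"
  using assms by (auto simp: test_fun_def)

lemma test_fun_mono: "test_fun S f \<Longrightarrow> S \<subseteq> T \<Longrightarrow> test_fun T f"
  by (auto simp: test_fun_def)

lemma test_fun_mult: "test_fun S f \<Longrightarrow> smooth g \<Longrightarrow> test_fun S (\<lambda>x. f x * g x)"
  by (rule test_funI[of _ "tsupport f"]) (auto dest: test_funD notin_tsupport intro: smooth_mult)

lemma test_fun_compose: "smooth h \<Longrightarrow> h 0 = 0 \<Longrightarrow> test_fun S f \<Longrightarrow> test_fun S (\<lambda>x. h (f x))"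
  by (rule test_funI[of _ "tsupport f"]) (auto dest: test_funD notin_tsupport intro: smooth_compose)

lemma test_fun_add: "test_fun S f \<Longrightarrow> test_fun S g \<Longrightarrow> test_fun S (\<lambda>x. f x + g x)"
  by (rule test_funI[of _ "tsupport f \<union> tsupport g"])
    (auto simp: notin_tsupport dest: test_funD intro: smooth_add)

lemma test_fun_cmult: "test_fun S f \<Longrightarrow> test_fun S (\<lambda>x. c * f x)"
  by (rule test_fun_compose[of "\<lambda>t. c * t"]) (auto intro: smooth_linear bounded_linear_mult_right)

lemma test_fun_minus: "test_fun S f \<Longrightarrow> test_fun S g \<Longrightarrow> test_fun S (\<lambda>x. f x - g x)"
  using test_fun_add[OF _ test_fun_cmult[of S g "-1"]] by simp

lemma compact_support_bounded:
  fixes f :: "'a::metric_space \<Rightarrow> 'b::real_normed_vector"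
  assumes "continuous_on UNIV f" "compact K" "\<And>x. x \<notin> K \<Longrightarrow> f x = 0"
  obtains C where "C > 0" "\<And>x. norm (f x) \<le> C"
proof -
  have "bounded (f ` K)"
    using assms by (intro compact_imp_bounded compact_continuous_image) (auto intro: continuous_on_subset)
  then obtain C where "C > 0" "\<forall>x\<in>K. norm (f x) \<le> C" by (auto simp: bounded_pos)
  then show ?thesis using that[of C] assms(3) by (metis less_imp_le norm_zero)
qed

lemma compact_support_integrable:
  fixes f :: "'a::euclidean_space \<Rightarrow> 'b::{banach, second_countable_topology}"
  assumes "continuous_on UNIV f" "compact K" "\<And>x. x \<notin> K \<Longrightarrow> f x = 0"
  shows "integrable lborel f"
proof -
  have "integrable lborel (\<lambda>x. indicator K x *\<^sub>R f x)"
    using assms by (intro borel_integrable_compact) (auto intro: continuous_on_subset)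
  moreover have "(\<lambda>x. indicator K x *\<^sub>R f x) = f"
    using assms(3) by (auto simp: indicator_def)
  ultimately show ?thesis by simp
qed

lemma test_fun_integrable:
  assumes "test_fun S f"
  shows "integrable lborel f" "integrable lborel (grad f)" "i \<in> Basis \<Longrightarrow> integrable lborel (partial i f)"
  using test_funD[OF assms] notin_tsupport[of _ f] grad_notin_tsupport[of _ f] partial_notin_tsupport[of _ f]
  by (auto intro!: compact_support_integrable[of _ "tsupport f"] smooth_continuous smooth_continuous_grad intro: smooth_partial)

lemma test_fun_bounded:
  assumes "test_fun S f"
  obtains C where "C > 0" "\<And>x. \<bar>f x\<bar> \<le> C" "\<And>x. norm (grad f x) \<le> C"
proof -
  note f = test_funD[OF assms]
  obtain A where A: "A > 0" "\<And>x. norm (f x) \<le> A"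
    using compact_support_bounded[of f "tsupport f"] f notin_tsupport smooth_continuous by metis
  obtain B where B: "B > 0" "\<And>x. norm (grad f x) \<le> B"
    using compact_support_bounded[of "grad f" "tsupport f"] f grad_notin_tsupport smooth_continuous_grad by metis
  show ?thesis
    by (rule that[of "A + B"]) (use A B in \<open>auto intro: order_trans add_increasing add_increasing2 less_imp_le\<close>)
qed

lemma lborel_integral_translate:
  fixes f :: "'a::euclidean_space \<Rightarrow> real"
  assumes "f \<in> borel_measurable borel"
  shows "(\<integral>x. f (a + x) \<partial>lborel) = (\<integral>x. f x \<partial>lborel)"
proof -
  have "(\<integral>x. f x \<partial>lborel) = (\<integral>x. f x \<partial>(distr lborel borel ((+) a)))"
    by (simp add: lborel_distr_plus)
  also have "\<dots> = (\<integral>x. f (a + x) \<partial>lborel)"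
    using assms by (intro integral_distr) auto
  finally show ?thesis ..
qed

text \<open>The integral of a difference quotient vanishes by translation invariance.\<close>

lemma integral_partial_eq_0:
  assumes f: "test_fun S f" and i: "i \<in> Basis"
  shows "(\<integral>x. partial i f x \<partial>lborel) = 0"
proof -
  note f' = test_funD[OF f]
  obtain C where C: "C > 0" "\<And>x. norm (grad f x) \<le> C" using test_fun_bounded[OF f] by metis
  obtain r where r: "tsupport f \<subseteq> cball 0 r"
    using compact_imp_bounded[OF f'(2)] by (metis ball_subset_cball bounded_subset_ballD subset_trans)
  define q where "q n x = real (Suc n) * (f ((1 / real (Suc n)) *\<^sub>R i + x) - f x)" for n x
  have [measurable]: "f \<in> borel_measurable borel" "partial i f \<in> borel_measurable borel"
    using f' i by (auto intro!: borel_measurable_smooth smooth_partial)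
  have int: "integrable lborel (\<lambda>x. f (a + x))" for a
  proof (rule compact_support_integrable[where K="(\<lambda>x. x - a) ` tsupport f"])
    show "continuous_on UNIV (\<lambda>x. f (a + x))"
      by (intro continuous_on_compose2[OF smooth_continuous[OF f'(1), of UNIV]] continuous_intros) auto
    show "compact ((\<lambda>x. x - a) ` tsupport f)"
      by (intro compact_continuous_image f' continuous_intros)
    fix x assume "x \<notin> (\<lambda>x. x - a) ` tsupport f"
    then have "a + x \<notin> tsupport f" by (metis add_diff_cancel_left' image_eqI)
    then show "f (a + x) = 0" by (rule notin_tsupport)
  qed
  have 0: "(\<integral>x. q n x \<partial>lborel) = 0" for n
    unfolding q_def using int[of 0] int
    by (simp add: lborel_integral_translate)
  \<comment> \<open>The Lipschitz constant \<open>C\<close> bounds every difference quotient. The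
    shifts have length at most 1, so all quotients vanish outside the ball of radius
    \<open>r + 1\<close>.\<close>
  have "(\<lambda>n. \<integral>x. q n x \<partial>lborel) \<longlonglongrightarrow> (\<integral>x. partial i f x \<partial>lborel)"
  proof (rule integral_dominated_convergence[where w="\<lambda>x. C * indicator (cball 0 (r + 1)) x"])
    show "integrable lborel (\<lambda>x. C * indicator (cball 0 (r + 1)) x)"
      using emeasure_lborel_cball_finite by (intro integrable_mult_right integrable_real_indicator) (auto simp: less_top)
    show "AE x in lborel. (\<lambda>n. q n x) \<longlonglongrightarrow> partial i f x"
    proof (rule AE_I2)
      fix x
      have "((\<lambda>t. f (x + t *\<^sub>R i)) has_derivative (\<lambda>t. grad f x \<bullet> (t *\<^sub>R i))) (at 0)"
        by (rule has_derivative_compose[where g=f and f="\<lambda>t. x + t *\<^sub>R i"])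
          (auto intro!: derivative_eq_intros smooth_has_derivative[OF f'(1)] simp: smooth_has_derivative[OF f'(1), of x])
      then have "((\<lambda>t. f (x + t *\<^sub>R i)) has_field_derivative partial i f x) (at 0)"
        by (simp add: has_field_derivative_def grad_inner_Basis[OF i] mult.commute[of _ "partial i f x"])
      then have "(\<lambda>h. (f (x + h *\<^sub>R i) - f x) / h) \<midarrow>0\<rightarrow> partial i f x"
        by (simp add: DERIV_def)
      moreover have "filterlim (\<lambda>n. 1 / real (Suc n)) (at 0) sequentially"
        using LIMSEQ_Suc[OF lim_1_over_n[where 'a=real]] by (simp add: filterlim_at del: of_nat_Suc)
      ultimately have "(\<lambda>n. (f (x + (1 / real (Suc n)) *\<^sub>R i) - f x) / (1 / real (Suc n))) \<longlonglongrightarrow> partial i f x"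
        by (rule filterlim_compose)
      then show "(\<lambda>n. q n x) \<longlonglongrightarrow> partial i f x"
        by (simp add: q_def add.commute mult.commute)
    qed
    show "AE x in lborel. norm (q n x) \<le> C * indicator (cball 0 (r + 1)) x" for n
    proof (rule AE_I2)
      fix x
      show "norm (q n x) \<le> C * indicator (cball 0 (r + 1)) x"
      proof (cases "x \<in> cball 0 (r + 1)")
        case True
        have "\<bar>f ((1 / real (Suc n)) *\<^sub>R i + x) - f x\<bar> \<le> C * (1 / real (Suc n))"
          using grad_lipschitz[OF f'(1) C(2), of "(1 / real (Suc n)) *\<^sub>R i + x" x] i by simp
        then have "real (Suc n) * \<bar>f ((1 / real (Suc n)) *\<^sub>R i + x) - f x\<bar> \<le> C"
          by (simp add: pos_le_divide_eq mult.commute del: of_nat_Suc)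
        then show ?thesis using True by (simp add: q_def abs_mult del: of_nat_Suc)
      next
        case False
        have "norm x \<le> norm ((1 / real (Suc n)) *\<^sub>R i + x) + norm ((1 / real (Suc n)) *\<^sub>R i)"
          by (metis add_diff_cancel_left' norm_minus_commute norm_triangle_ineq2 diff_le_eq add.commute)
        moreover have "norm ((1 / real (Suc n)) *\<^sub>R i) \<le> 1" using i by simp
        moreover have "r + 1 < norm x" using False by simp
        ultimately have "x \<notin> cball 0 r" "(1 / real (Suc n)) *\<^sub>R i + x \<notin> cball 0 r"
          unfolding mem_cball_0 by linarith+
        then have "f x = 0" "f ((1 / real (Suc n)) *\<^sub>R i + x) = 0" using r notin_tsupport by blast+
        then show ?thesis by (simp add: q_def C less_imp_le)
      qed
    qed
  qed (simp_all add: q_def)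
  with 0 show ?thesis by (simp add: LIMSEQ_const_iff)
qed

text \<open>Integrate \<open>\<partial>\<^sub>i (x\<^sub>i f)\<close>.\<close>

lemma integral_le_integral_grad:
  assumes f: "test_fun S f" and nn: "\<And>x. 0 \<le> f x" and S: "S \<subseteq> cball 0 R" and "0 \<le> R"
  shows "(\<integral>x. f x \<partial>lborel) \<le> R * (\<integral>x. norm (grad f x) \<partial>lborel)"
proof -
  obtain i :: 'a where i: "i \<in> Basis" using nonempty_Basis by blast
  have sm: "smooth (\<lambda>x. x \<bullet> i)" by (intro smooth_linear bounded_linear_inner_left)
  have t: "test_fun S (\<lambda>x. f x * (x \<bullet> i))" by (rule test_fun_mult[OF f sm])
  have gi: "grad (\<lambda>x. x \<bullet> i) x = i" for x
    by (rule grad_eqI) (auto intro!: derivative_eq_intros simp: inner_commute)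
  have p: "partial i (\<lambda>x. f x * (x \<bullet> i)) = (\<lambda>x. f x + (x \<bullet> i) * partial i f x)"
  proof
    fix x
    have "partial i (\<lambda>x. f x * (x \<bullet> i)) x = grad (\<lambda>x. f x * (x \<bullet> i)) x \<bullet> i"
      by (simp only: grad_inner_Basis[OF i])
    also have "\<dots> = (x \<bullet> i) * (grad f x \<bullet> i) + f x * (i \<bullet> i)"
      by (simp only: grad_mult[OF test_fun_smooth[OF f] sm] gi inner_add_left inner_scaleR_left)
    finally show "partial i (\<lambda>x. f x * (x \<bullet> i)) x = f x + (x \<bullet> i) * partial i f x"
      using i by (simp add: grad_inner_Basis)
  qed
  have "integrable lborel (\<lambda>x. f x + (x \<bullet> i) * partial i f x)"
    using test_fun_integrable(3)[OF t i] unfolding p .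
  then have int: "integrable lborel (\<lambda>x. (x \<bullet> i) * partial i f x)"
    using Bochner_Integration.integrable_diff[OF _ test_fun_integrable(1)[OF f],
        of "\<lambda>x. f x + (x \<bullet> i) * partial i f x"] by simp
  have "0 = (\<integral>x. f x + (x \<bullet> i) * partial i f x \<partial>lborel)"
    using integral_partial_eq_0[OF t i] unfolding p ..
  also have "\<dots> = (\<integral>x. f x \<partial>lborel) + (\<integral>x. (x \<bullet> i) * partial i f x \<partial>lborel)"
    by (rule Bochner_Integration.integral_add[OF test_fun_integrable(1)[OF f] int])
  finally have "(\<integral>x. f x \<partial>lborel) \<le> norm (\<integral>x. (x \<bullet> i) * partial i f x \<partial>lborel)" by simp
  also have "\<dots> \<le> (\<integral>x. norm ((x \<bullet> i) * partial i f x) \<partial>lborel)" by simp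
  also have "\<dots> \<le> (\<integral>x. R * norm (grad f x) \<partial>lborel)"
  proof (rule integral_mono)
    fix x
    show "norm ((x \<bullet> i) * partial i f x) \<le> R * norm (grad f x)"
    proof (cases "x \<in> tsupport f")
      case True
      then have "norm x \<le> R" using test_funD[OF f] S by auto
      then have "\<bar>x \<bullet> i\<bar> \<le> R" "\<bar>partial i f x\<bar> \<le> norm (grad f x)"
        using Basis_le_norm[OF i, of x] Basis_le_norm[OF i, of "grad f x"] grad_inner_Basis[OF i, of f x] by auto
      then show ?thesis unfolding real_norm_def abs_mult using \<open>0 \<le> R\<close> by (intro mult_mono) auto
    qed (use i \<open>0 \<le> R\<close> in \<open>simp add: partial_notin_tsupport\<close>)
  qed (use int test_fun_integrable(2)[OF f] in auto)
  finally show ?thesis by simp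
qed

subsection \<open>Smooth cutoff functions\<close>

text \<open>A smooth transition from 0 on the nonpositive half-line to 1 beyond 1. The denominator
  never vanishes because t and 1 - t are not both nonpositive.\<close>

definition smooth_step :: "real \<Rightarrow> real" where
  "smooth_step t = flat 0 t * inverse (flat 0 t + flat 0 (1 - t))"

lemma smooth_step_denom: "0 < flat 0 t + flat 0 (1 - t)"
  by (cases "0 < t") (auto intro: add_pos_nonneg add_nonneg_pos)

lemma smooth_smooth_step: "smooth smooth_step"
proof -
  have "smooth (\<lambda>t. flat 0 (1 - t))"
    by (intro smooth_compose[OF smooth_flat] smooth_minus smooth_const smooth_linear bounded_linear_ident)
  moreover have "flat 0 t + flat 0 (1 - t) \<noteq> 0" for t
    using smooth_step_denom[of t] by linarith
  ultimately show ?thesis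
    unfolding smooth_step_def[abs_def] by (intro smooth_mult smooth_inverse smooth_add smooth_flat)
qed

lemma smooth_step_bounds: "0 \<le> smooth_step t" "smooth_step t \<le> 1"
  using smooth_step_denom[of t] flat_nonneg[of 0 "1 - t"]
  by (auto simp: smooth_step_def divide_simps simp flip: divide_inverse)

lemma smooth_step_eq_0 [simp]: "t \<le> 0 \<Longrightarrow> smooth_step t = 0"
  by (simp add: smooth_step_def)

lemma smooth_step_eq_1 [simp]:
  assumes "1 \<le> t"
  shows "smooth_step t = 1"
proof -
  have "0 < flat 0 t" using assms by simp
  then have "flat 0 t \<noteq> 0" by (rule less_imp_neq[symmetric])
  then show ?thesis using assms by (simp add: smooth_step_def)
qed

text \<open>A finite sum of bumps on balls covering \<open>K\<close> is bounded below on
  \<open>K\<close> by its minimum \<open>c > 0\<close>. Scaling it by 2/c before applying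
  \<open>smooth_step\<close> yields the value 1 already where the sum exceeds c/2. This open set is
  recorded as \<open>W\<close>, because later arguments need a cutoff that is constant near a set,
  not merely on it.\<close>

lemma smooth_urysohn:
  fixes K U :: "'a::euclidean_space set"
  assumes K: "compact K" and U: "open U" and KU: "K \<subseteq> U"
  obtains f W where "test_fun U f" "\<And>x. 0 \<le> f x" "\<And>x. f x \<le> 1"
    "open W" "K \<subseteq> W" "\<And>x. x \<in> W \<Longrightarrow> f x = 1"
proof (cases "K = {}")
  case True
  show ?thesis
    by (rule that[of "\<lambda>x. 0" "{}"]) (use True in \<open>auto intro: test_funI[of _ "{}"] smooth_const\<close>)
next
  case False
  have "\<exists>r>0. cball x r \<subseteq> U" if "x \<in> K" for x
    using that KU U open_contains_cball by blast
  then obtain r where r: "\<And>x. x \<in> K \<Longrightarrow> 0 < r x" "\<And>x. x \<in> K \<Longrightarrow> cball x (r x) \<subseteq> U"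
    by metis
  have "K \<subseteq> (\<Union>x\<in>K. ball x (r x))" using r by force
  then obtain D where D: "D \<subseteq> K" "finite D" "K \<subseteq> (\<Union>x\<in>D. ball x (r x))"
    using compactE_image[OF K, of K "\<lambda>x. ball x (r x)"] by blast
  \<comment> \<open>Squared distances are polynomials in the coordinates, so each bump is smooth
    also at its centre.\<close>
  define B where "B y = (\<Sum>x\<in>D. flat 0 ((r x)\<^sup>2 - (y - x) \<bullet> (y - x)))" for y
  have ins: "0 < (r x)\<^sup>2 - (y - x) \<bullet> (y - x) \<longleftrightarrow> y \<in> ball x (r x)" if "x \<in> D" for x y
  proof -
    have "r x > 0" using r D that by auto
    then have "(r x)\<^sup>2 \<le> (norm (y - x))\<^sup>2 \<longleftrightarrow> r x \<le> norm (y - x)"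
      by (intro power_mono_iff) auto
    then show ?thesis
      by (simp add: dist_norm norm_minus_commute power2_norm_eq_inner[symmetric] not_le[symmetric] del: not_le)
  qed
  have smq: "smooth (\<lambda>y. (y - x) \<bullet> (y - x))" for x :: 'a
  proof -
    have "smooth (\<lambda>y. \<Sum>i\<in>Basis. (y \<bullet> i - x \<bullet> i) * (y \<bullet> i - x \<bullet> i))"
      by (intro smooth_sum smooth_mult smooth_minus smooth_const smooth_linear bounded_linear_inner_left)
    then show ?thesis by (subst euclidean_inner) (simp add: inner_diff_left)
  qed
  have smB: "smooth B"
    unfolding B_def[abs_def]
    by (intro smooth_sum smooth_compose[OF smooth_flat] smooth_minus smooth_const smq)
  have pos: "0 < B y" if y: "y \<in> K" for y
  proof -
    obtain x where "x \<in> D" "y \<in> ball x (r x)" using D(3) y by blast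
    then show ?thesis unfolding B_def using D(2) ins by (intro sum_pos2[of _ x]) auto
  qed
  have zero: "B y = 0" if "y \<notin> (\<Union>x\<in>D. cball x (r x))" for y
    unfolding B_def
  proof (intro sum.neutral ballI flat_nonpos)
    fix x assume x: "x \<in> D"
    then have "y \<notin> ball x (r x)" using that by (auto simp: ball_def cball_def)
    then show "(r x)\<^sup>2 - (y - x) \<bullet> (y - x) \<le> 0" using ins[OF x, of y] by linarith
  qed
  obtain x0 where x0: "x0 \<in> K" "\<And>y. y \<in> K \<Longrightarrow> B x0 \<le> B y"
    using continuous_attains_inf[OF K False smooth_continuous[OF smB]] by blast
  define c where "c = B x0"
  have c: "c > 0" using pos x0 by (simp add: c_def)
  define f where "f y = smooth_step (2 / c * B y)" for y
  show ?thesis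
  proof (rule that[of f "{y. c / 2 < B y}"])
    show "test_fun U f"
    proof (rule test_funI)
      show "smooth f" unfolding f_def[abs_def] by (intro smooth_compose[OF smooth_smooth_step] smooth_cmult smB)
      show "compact (\<Union>x\<in>D. cball x (r x))" using D by (intro compact_UN) auto
      show "(\<Union>x\<in>D. cball x (r x)) \<subseteq> U" using D r by blast
      show "f y = 0" if "y \<notin> (\<Union>x\<in>D. cball x (r x))" for y using zero[OF that] by (simp add: f_def)
    qed
    show "open {y. c / 2 < B y}" by (intro open_Collect_less continuous_intros smooth_continuous smB)
    show "K \<subseteq> {y. c / 2 < B y}"
    proof
      fix y assume "y \<in> K"
      then have "c \<le> B y" unfolding c_def by (rule x0)
      with c show "y \<in> {y. c / 2 < B y}" by simp
    qed
    show "f x = 1" if "x \<in> {y. c / 2 < B y}" for x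
      using that c by (auto simp: f_def field_simps)
  qed (auto simp: f_def smooth_step_bounds)
qed

section \<open>Weak gradients\<close>

lemma Lp_loc_1_set_integrable:
  assumes "Lp_loc U 1 f" "U \<in> sets lebesgue" "compact K" "K \<subseteq> U"
  shows "set_integrable lebesgue K f"
proof -
  have K: "K \<in> sets lebesgue" using assms(3) by (simp add: borel_compact)
  have m: "set_borel_measurable lebesgue U f"
    using assms(1,2) by (simp add: Lp_loc_def set_borel_measurable_def borel_measurable_restrict_space_iff)
  have mK: "(\<lambda>x. indicator K x *\<^sub>R f x) \<in> borel_measurable lebesgue"
    using set_borel_measurable_subset[OF m K assms(4)] by (simp add: set_borel_measurable_def)
  have "(\<integral>\<^sup>+ x. ennreal (norm (indicator K x *\<^sub>R f x)) \<partial>lebesgue) = (\<integral>\<^sup>+ x\<in>K. ennreal (\<bar>f x\<bar> powr 1) \<partial>lebesgue)"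
    by (intro nn_integral_cong) (auto simp: indicator_def)
  also have "\<dots> < \<infinity>" using assms by (simp add: Lp_loc_def)
  finally show ?thesis unfolding set_integrable_def using mK by (intro integrableI_bounded) auto
qed

text \<open>This guarantees that the integrals in \<open>weak_grad\<close> are genuine integrals and
  not the default value 0 of a nonintegrable function, so that two such identities may be
  subtracted.\<close>

lemma set_integrable_mult_compact_support:
  fixes h f :: "'a::euclidean_space \<Rightarrow> real"
  assumes h: "set_integrable lebesgue K h" and f: "continuous_on UNIV f" "compact K" "K \<subseteq> U"
    "\<And>x. x \<notin> K \<Longrightarrow> f x = 0"
  shows "set_integrable lebesgue U (\<lambda>x. h x * f x)"
proof -
  obtain C where C: "C > 0" "\<And>x. norm (f x) \<le> C" using compact_support_bounded[of f K] f by blast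
  have [measurable]: "f \<in> borel_measurable lebesgue"
    using f(1) by (simp add: borel_measurable_continuous_onI measurable_completion)
  have [measurable]: "(\<lambda>x. indicator K x *\<^sub>R h x) \<in> borel_measurable lebesgue"
    using h unfolding set_integrable_def by (rule borel_measurable_integrable)
  have eq: "(\<lambda>x. indicator U x *\<^sub>R (h x * f x)) = (\<lambda>x. (indicator K x *\<^sub>R h x) * f x)"
    using f(3,4) by (auto simp: indicator_def fun_eq_iff)
  have "integrable lebesgue (\<lambda>x. (indicator K x *\<^sub>R h x) * f x)"
  proof (rule Bochner_Integration.integrable_bound)
    show "integrable lebesgue (\<lambda>x. (indicator K x *\<^sub>R h x) * C)"
      using h unfolding set_integrable_def by (rule integrable_mult_left)
    show "AE x in lebesgue. norm (indicator K x *\<^sub>R h x * f x) \<le> norm (indicator K x *\<^sub>R h x * C)"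
      using C by (auto simp: abs_mult intro!: mult_left_mono)
  qed measurable
  then show ?thesis unfolding set_integrable_def eq .
qed

text \<open>The indicator of \<open>K\<close> is the pointwise limit of test functions that equal 1
  on \<open>K\<close> and are supported ever closer to it, so the vanishing of the integrals passes
  from test functions to indicators.\<close>

lemma compact_integral_eq_0:
  fixes h :: "'a::euclidean_space \<Rightarrow> real"
  assumes U: "open U" and h: "\<And>K. compact K \<Longrightarrow> K \<subseteq> U \<Longrightarrow> set_integrable lebesgue K h"
    and 0: "\<And>f. test_fun U f \<Longrightarrow> (LINT x:U|lebesgue. h x * f x) = 0"
    and K: "compact K" "K \<subseteq> U"
  shows "(LINT x:K|lebesgue. h x) = 0"
proof (cases "K = {}")
  case False
  obtain g W where g: "test_fun U g" and W: "open W" "K \<subseteq> W" "\<And>x. x \<in> W \<Longrightarrow> g x = 1"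
    using smooth_urysohn[OF K(1) U K(2)] by metis
  \<comment> \<open>\<open>h\<close> is only locally integrable. The approximating test functions
    all live in \<open>W\<close>, which lies in the compact set \<open>C\<close>, so the restriction
    of |h| to \<open>C\<close> is an integrable majorant.\<close>
  define C where "C = tsupport g"
  have C: "compact C" "C \<subseteq> U" using test_funD[OF g] by (auto simp: C_def)
  have WC: "W \<subseteq> C"
  proof
    fix x assume "x \<in> W"
    then show "x \<in> C" using W(3)[of x] notin_tsupport[of x g] by (auto simp: C_def)
  qed
  have "\<exists>f. test_fun (W \<inter> {x. infdist x K < 1 / real (Suc n)}) f \<and> (\<forall>x. 0 \<le> f x \<and> f x \<le> 1) \<and> (\<forall>x\<in>K. f x = 1)" for n
  proof -
    have o: "open (W \<inter> {x. infdist x K < 1 / real (Suc n)})"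
      by (intro open_Int W open_Collect_less continuous_intros)
    have "K \<subseteq> W \<inter> {x. infdist x K < 1 / real (Suc n)}" using W by auto
    from smooth_urysohn[OF K(1) o this] obtain f W' where "test_fun (W \<inter> {x. infdist x K < 1 / real (Suc n)}) f"
      "\<And>x. 0 \<le> f x" "\<And>x. f x \<le> 1" "K \<subseteq> W'" "\<And>x. x \<in> W' \<Longrightarrow> f x = 1"
      by metis
    then show ?thesis by (intro exI[of _ f]) blast
  qed
  then obtain f where f: "\<And>n. test_fun (W \<inter> {x. infdist x K < 1 / real (Suc n)}) (f n)"
    "\<And>n x. 0 \<le> f n x" "\<And>n x. f n x \<le> 1" "\<And>n x. x \<in> K \<Longrightarrow> f n x = 1"
    by metis
  have fz: "f n x = 0" if "x \<notin> C \<or> infdist x K \<ge> 1 / real (Suc n)" for n x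
  proof -
    have "x \<notin> tsupport (f n)"
      using that test_funD(3)[OF f(1)[of n]] WC by (auto simp del: of_nat_Suc)
    then show ?thesis by (rule notin_tsupport)
  qed
  have lim: "(\<lambda>n. f n x) \<longlonglongrightarrow> indicator K x" for x
  proof (cases "x \<in> K")
    case False
    then have "infdist x K > 0"
      using K \<open>K \<noteq> {}\<close> by (metis compact_imp_closed in_closed_iff_infdist_zero infdist_nonneg less_le)
    then have "\<forall>\<^sub>F n in sequentially. 1 / real (Suc n) < infdist x K"
      using order_tendstoD(2)[OF LIMSEQ_Suc[OF lim_1_over_n]] by blast
    then have "\<forall>\<^sub>F n in sequentially. indicator K x = f n x"
      by eventually_elim (use False fz in auto)
    then show ?thesis by (rule Lim_transform_eventually[OF tendsto_const])
  qed (simp add: f)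
  have [measurable]: "f n \<in> borel_measurable lebesgue" for n
    using borel_measurable_smooth[OF test_fun_smooth[OF f(1)]] by (simp add: measurable_completion)
  have hC: "integrable lebesgue (\<lambda>x. indicator C x * h x)"
    using h[OF C] by (simp add: set_integrable_def)
  then have hCm [measurable]: "(\<lambda>x. indicator C x * h x) \<in> borel_measurable lebesgue"
    by (rule borel_measurable_integrable)
  have KC: "K \<subseteq> C" using W WC by auto
  have "(\<lambda>n. \<integral>x. indicator C x * h x * f n x \<partial>lebesgue) \<longlonglongrightarrow> (\<integral>x. indicator C x * h x * indicator K x \<partial>lebesgue)"
  proof (rule integral_dominated_convergence)
    show "(\<lambda>x. indicator C x * h x * indicator K x) \<in> borel_measurable lebesgue"
      using borel_compact[OF K(1)] by (intro borel_measurable_times[OF hCm] borel_measurable_indicator) auto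
    show "integrable lebesgue (\<lambda>x. norm (indicator C x * h x))" using hC by (rule integrable_norm)
    show "AE x in lebesgue. (\<lambda>n. indicator C x * h x * f n x) \<longlonglongrightarrow> indicator C x * h x * indicator K x"
      by (intro AE_I2 tendsto_intros lim)
    show "AE x in lebesgue. norm (indicator C x * h x * f n x) \<le> norm (indicator C x * h x)" for n
    proof (rule AE_I2)
      fix x
      have "norm (indicator C x * h x) * f n x \<le> norm (indicator C x * h x)"
        by (rule mult_right_le_one_le) (use f(2,3) in simp_all)
      then show "norm (indicator C x * h x * f n x) \<le> norm (indicator C x * h x)"
        using f(2)[of n x] by (simp add: abs_mult)
    qed
  qed measurable
  moreover have "(\<integral>x. indicator C x * h x * f n x \<partial>lebesgue) = 0" for n
  proof -
    have "(\<integral>x. indicator C x * h x * f n x \<partial>lebesgue) = (LINT x:U|lebesgue. h x * f n x)"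
      unfolding set_lebesgue_integral_def
      using C fz by (intro Bochner_Integration.integral_cong) (auto simp: indicator_def)
    also have "\<dots> = 0" using WC C by (intro 0 test_fun_mono[OF f(1)]) auto
    finally show ?thesis .
  qed
  moreover have "(\<integral>x. indicator C x * h x * indicator K x \<partial>lebesgue) = (LINT x:K|lebesgue. h x)"
    unfolding set_lebesgue_integral_def
    using KC by (intro Bochner_Integration.integral_cong) (auto simp: indicator_def)
  ultimately show ?thesis by (simp add: LIMSEQ_const_iff)
qed (simp add: set_lebesgue_integral_def)

text \<open>By inner regularity the set where \<open>h\<close> is positive inside a compact
  \<open>C\<close> is exhausted, up to measure \<open>e\<close>, by a compact \<open>T\<close>. The
  integral of \<open>h\<close> over \<open>T\<close> vanishes while \<open>h\<close> is positive
  there, so \<open>T\<close> is null. The one-sided form is applied to \<open>h\<close> and to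
  \<open>- h\<close>.\<close>

lemma du_bois_reymond_le:
  fixes h :: "'a::euclidean_space \<Rightarrow> real"
  assumes U: "open U" and h: "\<And>K. compact K \<Longrightarrow> K \<subseteq> U \<Longrightarrow> set_integrable lebesgue K h"
    and 0: "\<And>f. test_fun U f \<Longrightarrow> (LINT x:U|lebesgue. h x * f x) = 0"
  shows "AE x in lebesgue. x \<in> U \<longrightarrow> h x \<le> 0"
proof -
  have null: "{x \<in> C. 0 < h x} \<in> null_sets lebesgue" if C: "compact C" "C \<subseteq> U" for C
  proof -
    have [measurable]: "(\<lambda>x. indicator C x * h x) \<in> borel_measurable lebesgue"
      using borel_measurable_integrable[OF h[OF C, unfolded set_integrable_def]] by simp
    have "{x \<in> C. 0 < h x} = {x \<in> space lebesgue. 0 < indicator C x * h x}"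
      by (auto simp: indicator_def split: if_splits)
    moreover have "\<dots> \<in> sets lebesgue" by measurable
    ultimately have E: "{x \<in> C. 0 < h x} \<in> sets lebesgue" by simp
    have "emeasure lebesgue {x \<in> C. 0 < h x} \<le> ennreal e" if "e > 0" for e :: real
    proof -
      obtain T where T: "closed T" "T \<subseteq> {x \<in> C. 0 < h x}" "{x \<in> C. 0 < h x} - T \<in> lmeasurable"
        "emeasure lebesgue ({x \<in> C. 0 < h x} - T) < ennreal e"
        by (rule sets_lebesgue_inner_closed[OF E \<open>e > 0\<close>])
      have "C \<inter> T = T" using T by auto
      then have cT: "compact T" using compact_Int_closed[OF C(1) T(1)] by simp
      have TU: "T \<subseteq> U" using T C by auto
      have Tm: "T \<in> sets lebesgue" using borel_compact[OF cT] by simp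
      have "(\<integral>x. indicator T x * h x \<partial>lebesgue) = 0"
        using compact_integral_eq_0[OF U h 0 cT TU] by (simp add: set_lebesgue_integral_def)
      moreover have "integrable lebesgue (\<lambda>x. indicator T x * h x)"
        using h[OF cT TU] by (simp add: set_integrable_def)
      moreover have "0 \<le> indicator T x * h x" for x
        using T(2) by (auto simp: indicator_def less_imp_le)
      ultimately have "AE x in lebesgue. indicator T x * h x = 0"
        using integral_nonneg_eq_0_iff_AE[OF _ AE_I2, of lebesgue "\<lambda>x. indicator T x * h x"] by simp
      then have "AE x in lebesgue. x \<notin> T"
        by eventually_elim (use T(2) in \<open>auto simp: indicator_def\<close>)
      then have T0: "T \<in> null_sets lebesgue" using AE_iff_null_sets[OF Tm] by simp
      have "emeasure lebesgue {x \<in> C. 0 < h x} = emeasure lebesgue ({x \<in> C. 0 < h x} - T)"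
        using emeasure_Diff_null_set[OF T0 E] by simp
      then show ?thesis using T by (simp add: less_imp_le)
    qed
    then have "emeasure lebesgue {x \<in> C. 0 < h x} = 0"
      using ennreal_le_epsilon[of 0 "emeasure lebesgue {x \<in> C. 0 < h x}"] by simp
    with E show ?thesis by (simp add: null_setsI)
  qed
  obtain C :: "nat \<Rightarrow> 'a set" where C: "\<And>n. compact (C n)" "\<And>n. C n \<subseteq> U" "\<Union> (range C) = U"
    using open_Union_compact_subsets[OF U] by metis
  have "AE x in lebesgue. \<forall>n. x \<notin> {x \<in> C n. 0 < h x}"
    unfolding AE_all_countable by (intro allI AE_not_in null C)
  then show ?thesis
  proof eventually_elim
    case (elim x)
    show ?case
    proof
      assume "x \<in> U"
      then obtain n where "x \<in> C n" using C(3) by blast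
      with elim show "h x \<le> 0" by (auto simp: not_less[symmetric])
    qed
  qed
qed

lemma du_bois_reymond:
  fixes h :: "'a::euclidean_space \<Rightarrow> real"
  assumes U: "open U" and h: "\<And>K. compact K \<Longrightarrow> K \<subseteq> U \<Longrightarrow> set_integrable lebesgue K h"
    and 0: "\<And>f. test_fun U f \<Longrightarrow> (LINT x:U|lebesgue. h x * f x) = 0"
  shows "AE x in lebesgue. x \<in> U \<longrightarrow> h x = 0"
proof -
  have "AE x in lebesgue. x \<in> U \<longrightarrow> - h x \<le> 0"
    by (rule du_bois_reymond_le[OF U]) (use h 0 in \<open>auto simp: set_integrable_def set_lebesgue_integral_def\<close>)
  moreover have "AE x in lebesgue. x \<in> U \<longrightarrow> h x \<le> 0"
    by (rule du_bois_reymond_le[OF U h 0])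
  ultimately show ?thesis by eventually_elim auto
qed

text \<open>Testing only with functions supported in \<open>U\<close> makes uniqueness local. It is
  used to identify the gradient of \<open>u\<close> with that of \<open>u * \<phi>\<close> on the
  open set where \<phi> equals 1.\<close>

lemma weak_grad_unique:
  fixes u v :: "'a::euclidean_space \<Rightarrow> real"
  assumes U: "open U" "open \<Omega>" "U \<subseteq> \<Omega>" and g: "weak_grad \<Omega> u g" and g': "weak_grad \<Omega> v g'"
    and uv: "\<And>x. x \<in> U \<Longrightarrow> u x = v x"
  shows "AE x in lebesgue. x \<in> U \<longrightarrow> g x = g' x"
proof -
  have *: "AE x in lebesgue. x \<in> U \<longrightarrow> (g x \<bullet> i - g' x \<bullet> i) = 0" if i: "i \<in> Basis" for i
  proof (rule du_bois_reymond[OF U(1)])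
    have int: "set_integrable lebesgue K (\<lambda>x. g x \<bullet> i)" "set_integrable lebesgue K (\<lambda>x. g' x \<bullet> i)"
      if "compact K" "K \<subseteq> \<Omega>" for K
      using g g' i that U(2) by (auto simp: weak_grad_def intro!: Lp_loc_1_set_integrable[of \<Omega>])
    show "set_integrable lebesgue K (\<lambda>x. g x \<bullet> i - g' x \<bullet> i)" if "compact K" "K \<subseteq> U" for K
      using int[of K] that U by (intro set_integral_diff) auto
    fix f assume f: "test_fun U f"
    then have f': "test_fun \<Omega> f" by (rule test_fun_mono[OF _ U(3)])
    have eq: "(LINT x:\<Omega>|lebesgue. u x * partial i f x) = (LINT x:\<Omega>|lebesgue. v x * partial i f x)"
      unfolding set_lebesgue_integral_def
    proof (intro Bochner_Integration.integral_cong refl)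
      fix x
      show "indicator \<Omega> x *\<^sub>R (u x * partial i f x) = indicator \<Omega> x *\<^sub>R (v x * partial i f x)"
        using uv[of x] partial_notin_tsupport[of x f i] test_funD[OF f] i by (cases "x \<in> U") auto
    qed
    have si: "set_integrable lebesgue \<Omega> (\<lambda>x. (g x \<bullet> i) * f x)" "set_integrable lebesgue \<Omega> (\<lambda>x. (g' x \<bullet> i) * f x)"
      using test_funD[OF f'] notin_tsupport[of _ f]
      by (auto intro!: set_integrable_mult_compact_support[of "tsupport f"] int smooth_continuous)
    have "(LINT x:U|lebesgue. (g x \<bullet> i - g' x \<bullet> i) * f x) = (LINT x:\<Omega>|lebesgue. (g x \<bullet> i) * f x - (g' x \<bullet> i) * f x)"
      unfolding set_lebesgue_integral_def
      using U test_funD[OF f] notin_tsupport[of _ f]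
      by (intro Bochner_Integration.integral_cong refl) (force simp: indicator_def algebra_simps)
    also have "\<dots> = 0"
      using si eq g g' f' i by (simp add: weak_grad_def)
    finally show "(LINT x:U|lebesgue. (g x \<bullet> i - g' x \<bullet> i) * f x) = 0" .
  qed
  have "AE x in lebesgue. \<forall>i\<in>Basis. x \<in> U \<longrightarrow> (g x \<bullet> i - g' x \<bullet> i) = 0"
    using * by (intro AE_finite_allI) auto
  then show ?thesis
    by eventually_elim (auto intro: euclidean_eqI)
qed

section \<open>The comparison principle almost everywhere\<close>

text \<open>For a simple function in place of \<open>g\<close> the composition is glued from
  finitely many measurable pieces; continuity in the second argument carries measurability to the
  limit.\<close>

lemma caratheodory_measurable:
  fixes A :: "'a \<Rightarrow> 'b::euclidean_space \<Rightarrow> 'c::{metric_space}"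
  assumes A: "\<And>z. (\<lambda>x. A x z) \<in> borel_measurable M"
    and cont: "\<And>x. x \<in> space M \<Longrightarrow> continuous_on UNIV (A x)"
    and g: "g \<in> borel_measurable M"
  shows "(\<lambda>x. A x (g x)) \<in> borel_measurable M"
proof -
  obtain F where F: "\<And>i. simple_function M (F i)" "\<And>x. x \<in> space M \<Longrightarrow> (\<lambda>i. F i x) \<longlonglongrightarrow> g x"
    using borel_measurable_implies_sequence_metric[OF g] by metis
  show ?thesis
  proof (rule borel_measurable_LIMSEQ_metric)
    fix i
    have "F i \<in> measurable M (count_space (F i ` space M))"
      using F(1)[of i] by (subst measurable_count_space_eq2) (auto simp: simple_function_def)
    then show "(\<lambda>x. A x (F i x)) \<in> borel_measurable M"
      using F(1)[of i] by (intro measurable_compose_countable'[OF A]) (auto simp: simple_function_def intro: countable_finite)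
  next
    fix x assume x: "x \<in> space M"
    show "(\<lambda>i. A x (F i x)) \<longlonglongrightarrow> A x (g x)"
      by (rule continuous_on_tendsto_compose[OF cont[OF x] F(2)[OF x]]) auto
  qed
qed

text \<open>The series of the \<open>f n\<close> has finite integral, hence converges almost
  everywhere. Its sum is the majorant \<open>H\<close>, and its terms tend to 0.\<close>

lemma dominated_AE_convergent:
  fixes f :: "nat \<Rightarrow> 'a \<Rightarrow> real"
  assumes [measurable]: "\<And>n. f n \<in> borel_measurable M" and nn: "\<And>n x. 0 \<le> f n x"
    and le: "\<And>n. (\<integral>\<^sup>+x. ennreal (f n x) \<partial>M) \<le> ennreal ((1/2) ^ n)"
  obtains H where "integrable M H" "AE x in M. (\<lambda>n. f n x) \<longlonglongrightarrow> 0 \<and> (\<forall>n. f n x \<le> H x)"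
proof -
  define S where "S x = (\<Sum>n. ennreal (f n x))" for x
  have [measurable]: "S \<in> borel_measurable M" unfolding S_def by measurable
  have "(\<integral>\<^sup>+x. S x \<partial>M) = (\<Sum>n. \<integral>\<^sup>+x. ennreal (f n x) \<partial>M)"
    unfolding S_def by (rule nn_integral_suminf) measurable
  also have "\<dots> \<le> (\<Sum>n. ennreal ((1/2) ^ n))" by (intro suminf_le le) auto
  also have "\<dots> = ennreal (\<Sum>n. (1/2) ^ n)" by (intro suminf_ennreal2 summable_geometric) auto
  also have "\<dots> < \<infinity>" by simp
  finally have fin: "(\<integral>\<^sup>+x. S x \<partial>M) < \<infinity>" .
  then have AE: "AE x in M. S x \<noteq> \<infinity>" by (intro nn_integral_PInf_AE) auto
  have "integrable M (\<lambda>x. enn2real (S x))"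
  proof (rule integrableI_bounded)
    have "(\<integral>\<^sup>+x. ennreal (norm (enn2real (S x))) \<partial>M) \<le> (\<integral>\<^sup>+x. S x \<partial>M)"
      by (intro nn_integral_mono) (auto simp: ennreal_enn2real_if)
    then show "(\<integral>\<^sup>+x. ennreal (norm (enn2real (S x))) \<partial>M) < \<infinity>" using fin by (rule le_less_trans)
  qed measurable
  moreover from AE have "AE x in M. (\<lambda>n. f n x) \<longlonglongrightarrow> 0 \<and> (\<forall>n. f n x \<le> enn2real (S x))"
  proof eventually_elim
    case (elim x)
    then have sm: "summable (\<lambda>n. f n x)"
      unfolding S_def using nn by (intro summable_suminf_not_top) auto
    then have "S x = ennreal (\<Sum>n. f n x)" unfolding S_def by (intro suminf_ennreal2 nn)
    then have "enn2real (S x) = (\<Sum>n. f n x)" using nn sm by (simp add: suminf_nonneg)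
    moreover have "f n x \<le> (\<Sum>n. f n x)" for n
      using sum_le_suminf[OF sm, of "{n}"] nn by simp
    ultimately show ?case using summable_LIMSEQ_zero[OF sm] by simp
  qed
  ultimately show ?thesis by (rule that)
qed

lemma powr_add_le:
  fixes a b p :: real
  assumes "0 \<le> a" "0 \<le> b" "0 \<le> p"
  shows "(a + b) powr p \<le> 2 powr p * (a powr p + b powr p)"
proof -
  have "(a + b) powr p \<le> (2 * max a b) powr p" using assms by (intro powr_mono2) auto
  also have "\<dots> = 2 powr p * max a b powr p" using assms by (simp add: powr_mult)
  also have "max a b powr p \<le> a powr p + b powr p" by (simp add: max_def)
  finally show ?thesis by simp
qed

lemma integrable_powr_add:
  fixes f g :: "'a \<Rightarrow> real"
  assumes "integrable M (\<lambda>x. f x powr p)" "integrable M (\<lambda>x. g x powr p)"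
    and [measurable]: "f \<in> borel_measurable M" "g \<in> borel_measurable M"
    and "\<And>x. 0 \<le> f x" "\<And>x. 0 \<le> g x" "0 \<le> p"
  shows "integrable M (\<lambda>x. (f x + g x) powr p)"
proof (rule Bochner_Integration.integrable_bound)
  show "integrable M (\<lambda>x. 2 powr p * (f x powr p + g x powr p))"
    using assms by auto
  show "AE x in M. norm ((f x + g x) powr p) \<le> norm (2 powr p * (f x powr p + g x powr p))"
    using powr_add_le[OF assms(5,6,7)] by (simp add: abs_of_nonneg)
qed measurable

lemma nn_set_integral_lebesgue_on:
  assumes "\<Omega> \<in> sets lebesgue"
  shows "(\<integral>\<^sup>+x\<in>\<Omega>. f x \<partial>lebesgue) = (\<integral>\<^sup>+x. f x \<partial>lebesgue_on \<Omega>)"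
  using assms by (simp add: nn_integral_restrict_space)

lemma set_integral_lebesgue_on:
  fixes f :: "'a::euclidean_space \<Rightarrow> real"
  assumes "\<Omega> \<in> sets lebesgue"
  shows "(LINT x:\<Omega>|lebesgue. f x) = (\<integral>x. f x \<partial>lebesgue_on \<Omega>)"
  using assms by (simp add: integral_restrict_space set_lebesgue_integral_def)

lemma measurable_lebesgue_on_borel:
  "f \<in> borel_measurable borel \<Longrightarrow> f \<in> borel_measurable (lebesgue_on \<Omega>)"
  by (intro measurable_restrict_space1 measurable_completion) simp

lemma weak_grad_measurable:
  assumes "weak_grad \<Omega> u g"
  shows "g \<in> borel_measurable (lebesgue_on \<Omega>)"
  using assms by (subst borel_measurable_euclidean_space) (auto simp: weak_grad_def Lp_loc_def)

text \<open>Norm convergence is upgraded to almost everywhere convergence with a p-integrable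
  majorant \<open>D\<close> of the gradients. In this form the approximation can be inserted into
  nonlinear expressions and followed by dominated convergence.\<close>

lemma W1p0_approx:
  fixes u :: "'a::euclidean_space \<Rightarrow> real"
  assumes u: "W1p0 \<Omega> p u" and p: "1 < p" and \<Omega>: "\<Omega> \<in> sets lebesgue"
  obtains g f D where "weak_grad \<Omega> u g" "\<forall>k. test_fun \<Omega> (f k)"
    "D \<in> borel_measurable (lebesgue_on \<Omega>)" "\<forall>x. 0 \<le> D x" "integrable (lebesgue_on \<Omega>) (\<lambda>x. D x powr p)"
    "\<forall>x. norm (g x) \<le> D x"
    "AE x in lebesgue_on \<Omega>. (\<lambda>k. f k x) \<longlonglongrightarrow> u x \<and> (\<lambda>k. grad (f k) x) \<longlonglongrightarrow> g x \<and>
      (\<forall>k. norm (grad (f k) x) \<le> D x)"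
proof -
  let ?M = "lebesgue_on \<Omega>"
  obtain g f where g: "weak_grad \<Omega> u g" "Lp \<Omega> p (\<lambda>x. norm (g x))" and f: "\<And>k. test_fun \<Omega> (f k)"
    and l1: "(\<lambda>k. \<integral>\<^sup>+ x. ennreal (\<bar>f k x - u x\<bar> powr p) \<partial>?M) \<longlonglongrightarrow> 0"
    and l2: "(\<lambda>k. \<integral>\<^sup>+ x. ennreal (norm (grad (f k) x - g x) powr p) \<partial>?M) \<longlonglongrightarrow> 0"
    using u unfolding W1p0_def nn_set_integral_lebesgue_on[OF \<Omega>] by blast
  have [measurable]: "u \<in> borel_measurable ?M" using u by (simp add: W1p0_def Lp_def)
  have [measurable]: "g \<in> borel_measurable ?M" by (rule weak_grad_measurable[OF g(1)])
  have [measurable]: "f k \<in> borel_measurable ?M" "grad (f k) \<in> borel_measurable ?M" for k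
    using test_fun_smooth[OF f] by (auto intro!: measurable_lebesgue_on_borel borel_measurable_smooth borel_measurable_grad)
  \<comment> \<open>Function error and gradient error are added so that a single subsequence
    controls both.\<close>
  define e where "e k x = \<bar>f k x - u x\<bar> powr p + norm (grad (f k) x - g x) powr p" for k x
  have [measurable]: "e k \<in> borel_measurable ?M" for k unfolding e_def by measurable
  have "(\<integral>\<^sup>+x. ennreal (e k x) \<partial>?M) = (\<integral>\<^sup>+ x. ennreal (\<bar>f k x - u x\<bar> powr p) \<partial>?M)
      + (\<integral>\<^sup>+ x. ennreal (norm (grad (f k) x - g x) powr p) \<partial>?M)" for k
    by (simp add: e_def ennreal_plus nn_integral_add del: ennreal_plus[symmetric])
  then have lim: "(\<lambda>k. \<integral>\<^sup>+x. ennreal (e k x) \<partial>?M) \<longlonglongrightarrow> 0"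
    using tendsto_add[OF l1 l2] by simp
  have "\<exists>k. (\<integral>\<^sup>+x. ennreal (e k x) \<partial>?M) \<le> ennreal ((1/2) ^ n)" for n
  proof -
    have "\<forall>\<^sub>F k in sequentially. (\<integral>\<^sup>+x. ennreal (e k x) \<partial>?M) < ennreal ((1/2) ^ n)"
      by (rule order_tendstoD[OF lim]) simp
    then show ?thesis by (auto dest!: eventually_happens' [OF sequentially_bot] intro: less_imp_le)
  qed
  then obtain r where r: "\<And>n. (\<integral>\<^sup>+x. ennreal (e (r n) x) \<partial>?M) \<le> ennreal ((1/2) ^ n)" by metis
  obtain H where H: "integrable ?M H" "AE x in ?M. (\<lambda>n. e (r n) x) \<longlonglongrightarrow> 0 \<and> (\<forall>n. e (r n) x \<le> H x)"
    by (rule dominated_AE_convergent[of "\<lambda>n. e (r n)" ?M, OF _ _ r]) (auto simp: e_def)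
  have [measurable]: "H \<in> borel_measurable ?M" using H(1) by auto
  \<comment> \<open>\<open>H\<close> majorizes p-th powers of errors, so its p-th root bounds the
    distance of the approximating gradients from \<open>g\<close>.\<close>
  define D where "D x = norm (g x) + \<bar>H x\<bar> powr (1/p)" for x
  show ?thesis
  proof (rule that[of g "\<lambda>n. f (r n)" D])
    show "D \<in> borel_measurable ?M" unfolding D_def by measurable
    show "integrable ?M (\<lambda>x. D x powr p)"
      unfolding D_def
    proof (rule integrable_powr_add)
      show "integrable ?M (\<lambda>x. norm (g x) powr p)"
        using g(2) unfolding Lp_def nn_set_integral_lebesgue_on[OF \<Omega>]
        by (intro integrableI_bounded) auto
      show "integrable ?M (\<lambda>x. (\<bar>H x\<bar> powr (1/p)) powr p)"
        using p H(1) by (simp add: powr_powr)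
    qed (use p in auto)
    show "AE x in ?M. (\<lambda>k. f (r k) x) \<longlonglongrightarrow> u x \<and> (\<lambda>k. grad (f (r k)) x) \<longlonglongrightarrow> g x \<and>
      (\<forall>k. norm (grad (f (r k)) x) \<le> D x)"
      using H(2)
    proof eventually_elim
      case (elim x)
      have root: "(\<lambda>n. e (r n) x powr (1/p)) \<longlonglongrightarrow> 0"
        using elim p by (intro tendsto_zero_powrI[where b="1/p"]) (auto simp: e_def)
      have le: "\<bar>f (r n) x - u x\<bar> \<le> e (r n) x powr (1/p)" "norm (grad (f (r n)) x - g x) \<le> e (r n) x powr (1/p)" for n
      proof -
        have *: "t \<le> (t powr p + s) powr (1/p)" if "0 \<le> t" "0 \<le> s" for t s
        proof -
          have "t = (t powr p) powr (1/p)" using p that by (simp add: powr_powr)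
          also have "\<dots> \<le> (t powr p + s) powr (1/p)" using p that by (intro powr_mono2) auto
          finally show ?thesis .
        qed
        show "\<bar>f (r n) x - u x\<bar> \<le> e (r n) x powr (1/p)" unfolding e_def by (rule *) auto
        show "norm (grad (f (r n)) x - g x) \<le> e (r n) x powr (1/p)" unfolding e_def
          by (subst add.commute, rule *) auto
      qed
      have "(\<lambda>n. f (r n) x - u x) \<longlonglongrightarrow> 0"
        by (rule Lim_null_comparison[OF _ root]) (use le in simp)
      moreover have "(\<lambda>n. grad (f (r n)) x - g x) \<longlonglongrightarrow> 0"
        by (rule Lim_null_comparison[OF _ root]) (use le in simp)
      moreover have "norm (grad (f (r n)) x) \<le> D x" for n
      proof -
        have "e (r n) x powr (1/p) \<le> \<bar>H x\<bar> powr (1/p)"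
          using elim p by (intro powr_mono2) (auto simp: e_def intro: order_trans[OF _ abs_ge_self])
        then show ?thesis
          using le(2)[of n] norm_triangle_sub[of "grad (f (r n)) x" "g x"] by (simp add: D_def)
      qed
      ultimately show ?case by (simp add: LIM_zero_iff)
    qed
  qed (use g f in \<open>auto simp: D_def\<close>)
qed

lemma structure_cond_measurable:
  assumes "structure_cond \<Omega> p L \<A>" "g \<in> borel_measurable (lebesgue_on \<Omega>)"
  shows "(\<lambda>x. \<A> x (g x)) \<in> borel_measurable (lebesgue_on \<Omega>)"
proof (rule caratheodory_measurable[OF _ _ assms(2), of \<A>])
  show "(\<lambda>x. \<A> x z) \<in> borel_measurable (lebesgue_on \<Omega>)" for z
    using assms(1) unfolding structure_cond_def by blast
  show "continuous_on UNIV (\<A> x)" if "x \<in> space (lebesgue_on \<Omega>)" for x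
    using assms(1) that unfolding structure_cond_def space_restrict_space by blast
qed

text \<open>Each definition hides its own weak gradient behind an existential quantifier; both are
  extracted here, with \<open>int_signed\<close> as the intermediate value between the two
  integrals.\<close>

lemma weak_solution_inequality:
  assumes "weak_subsol \<Omega> p \<A> \<nu>p \<nu>m u" "weak_supersol \<Omega> p \<A> \<nu>p \<nu>m v"
  obtains gu gv where "weak_grad \<Omega> u gu" "weak_grad \<Omega> v gv"
    "\<forall>f. test_fun \<Omega> f \<longrightarrow> (\<forall>x. 0 \<le> f x) \<longrightarrow>
      (LINT x:\<Omega>|lebesgue. \<A> x (gu x) \<bullet> grad f x) \<le> (LINT x:\<Omega>|lebesgue. \<A> x (gv x) \<bullet> grad f x)"
proof -
  obtain gu where gu: "weak_grad \<Omega> u gu" "\<And>f. test_fun \<Omega> f \<Longrightarrow> (\<And>x. 0 \<le> f x) \<Longrightarrow>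
      (LINT x:\<Omega>|lebesgue. \<A> x (gu x) \<bullet> grad f x) \<le> int_signed \<nu>p \<nu>m f"
    using assms(1) unfolding weak_subsol_def by blast
  obtain gv where gv: "weak_grad \<Omega> v gv" "\<And>f. test_fun \<Omega> f \<Longrightarrow> (\<And>x. 0 \<le> f x) \<Longrightarrow>
      int_signed \<nu>p \<nu>m f \<le> (LINT x:\<Omega>|lebesgue. \<A> x (gv x) \<bullet> grad f x)"
    using assms(2) unfolding weak_supersol_def by blast
  show ?thesis
  proof (rule that[OF gu(1) gv(1)], intro allI impI)
    fix f assume "test_fun \<Omega> f" "\<forall>x. 0 \<le> f x"
    then show "(LINT x:\<Omega>|lebesgue. \<A> x (gu x) \<bullet> grad f x) \<le> (LINT x:\<Omega>|lebesgue. \<A> x (gv x) \<bullet> grad f x)"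
      using order_trans[OF gu(2)[of f] gv(2)[of f]] by blast
  qed
qed

lemma Linf_Gamma_beta_small:
  assumes \<Gamma>: "closed \<Gamma>" and "0 < \<beta>" "0 < \<epsilon>"
    and u: "Linf_Gamma_beta \<Omega> \<Gamma> \<beta> u" and v: "Linf_Gamma_beta \<Omega> \<Gamma> \<beta> v"
  obtains V where "open V" "\<Gamma> \<subseteq> V" "AE x in lebesgue. x \<in> \<Omega> \<inter> V \<longrightarrow> u x - v x \<le> \<epsilon>"
proof (cases "\<Gamma> = {}")
  case True
  then show ?thesis using that[of "{}"] by simp
next
  case False
  obtain C1 C2 where C: "AE x in lebesgue. x \<in> \<Omega> \<longrightarrow> \<bar>u x\<bar> \<le> C1 * infdist x \<Gamma> powr \<beta>"
    "AE x in lebesgue. x \<in> \<Omega> \<longrightarrow> \<bar>v x\<bar> \<le> C2 * infdist x \<Gamma> powr \<beta>"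
    using u v False unfolding Linf_Gamma_beta_def by blast
  define C where "C = \<bar>C1\<bar> + \<bar>C2\<bar>"
  \<comment> \<open>Chosen so that \<open>C * r powr \<beta>\<close> is at most \<epsilon>; the
    summand 1 keeps the quotient meaningful when \<open>C\<close> is 0.\<close>
  define r where "r = (\<epsilon> / (C + 1)) powr (1/\<beta>)"
  have C0: "0 \<le> C" by (simp add: C_def)
  have "r > 0" using C0 \<open>\<epsilon> > 0\<close> by (simp add: r_def)
  have rb: "r powr \<beta> = \<epsilon> / (C + 1)" using C0 assms(2,3) by (simp add: r_def powr_powr)
  show ?thesis
  proof (rule that[of "{x. infdist x \<Gamma> < r}"])
    show "open {x. infdist x \<Gamma> < r}" by (intro open_Collect_less continuous_intros)
    show "\<Gamma> \<subseteq> {x. infdist x \<Gamma> < r}" using \<open>r > 0\<close> by auto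
    show "AE x in lebesgue. x \<in> \<Omega> \<inter> {x. infdist x \<Gamma> < r} \<longrightarrow> u x - v x \<le> \<epsilon>"
      using C
    proof eventually_elim
      case (elim x)
      show ?case
      proof
        assume x: "x \<in> \<Omega> \<inter> {x. infdist x \<Gamma> < r}"
        have "u x - v x \<le> C1 * infdist x \<Gamma> powr \<beta> + C2 * infdist x \<Gamma> powr \<beta>" using elim x by auto
        also have "\<dots> \<le> C * infdist x \<Gamma> powr \<beta>"
          by (simp add: C_def distrib_right[symmetric] mult_right_mono)
        also have "\<dots> \<le> C * r powr \<beta>"
          using x C0 assms by (intro mult_left_mono powr_mono2) (auto simp: infdist_nonneg)
        also have "\<dots> \<le> \<epsilon>" using C0 \<open>\<epsilon> > 0\<close> by (simp add: rb field_simps)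
        finally show "u x - v x \<le> \<epsilon>" .
      qed
    qed
  qed
qed

text \<open>The level \<epsilon> > 0 is fixed because \<open>u - v\<close> is at most \<epsilon> on
  a whole neighbourhood \<open>V\<close> of \<Gamma>. There F and its derivative vanish at the limit
  function, which leaves room for a cutoff to switch off.\<close>

lemma comparison_AE_eps:
  fixes \<Omega> \<Gamma> :: "'a::euclidean_space set"
  assumes p: "1 < p" and \<Omega>: "open \<Omega>" "bounded \<Omega>"
    and \<Gamma>: "closed \<Gamma>" "\<Gamma> \<subseteq> frontier \<Omega>"
    and L: "1 \<le> L" and \<A>: "structure_cond \<Omega> p L \<A>"
    and \<beta>: "0 < \<beta>"
    and u: "W1p_cGamma \<Omega> \<Gamma> p u" "Linf_Gamma_beta \<Omega> \<Gamma> \<beta> u"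
    and v: "W1p_cGamma \<Omega> \<Gamma> p v" "Linf_Gamma_beta \<Omega> \<Gamma> \<beta> v"
    and sub: "weak_subsol \<Omega> p \<A> \<nu>p \<nu>m u" and super: "weak_supersol \<Omega> p \<A> \<nu>p \<nu>m v"
    and \<epsilon>: "0 < \<epsilon>"
  shows "AE x in lebesgue. x \<in> \<Omega> \<longrightarrow> u x - v x \<le> \<epsilon>"
proof -
  define M where "M = lebesgue_on \<Omega>"
  have \<Omega>m: "\<Omega> \<in> sets lebesgue" using \<Omega> by auto
  have "\<Omega> \<in> lmeasurable" using \<Omega> by (simp add: lmeasurable_open)
  then interpret M: finite_measure M unfolding M_def by (rule finite_measure_lebesgue_on)
  have spM: "space M = \<Omega>" by (simp add: M_def space_restrict_space)
  have AEM: "(AE x in M. P x) \<longleftrightarrow> (AE x in lebesgue. x \<in> \<Omega> \<longrightarrow> P x)" for P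
    unfolding M_def using \<Omega>m by (simp add: AE_restrict_space_iff)

  \<comment> \<open>A neighbourhood of \<Gamma> and two nested cutoffs\<close>
  obtain V where V0: "open V" "\<Gamma> \<subseteq> V" "AE x in lebesgue. x \<in> \<Omega> \<inter> V \<longrightarrow> u x - v x \<le> \<epsilon>"
    by (rule Linf_Gamma_beta_small[OF \<Gamma>(1) \<beta> \<epsilon> u(2) v(2)])
  have "AE x in M. x \<in> V \<longrightarrow> u x - v x \<le> \<epsilon>"
    unfolding AEM using V0(3) by eventually_elim auto
  note V = V0(1,2) this
  have "compact \<Gamma>"
    using \<Gamma> bounded_subset[OF bounded_closure[OF \<Omega>(2)], of \<Gamma>] by (auto simp: compact_eq_bounded_closed frontier_def)
  then obtain \<theta>2 W2 where \<theta>2: "test_fun V \<theta>2" "\<And>x. 0 \<le> \<theta>2 x" "\<And>x. \<theta>2 x \<le> 1"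
      "open W2" "\<Gamma> \<subseteq> W2" "\<And>x. x \<in> W2 \<Longrightarrow> \<theta>2 x = 1"
    using smooth_urysohn[OF _ V(1,2)] by metis
  obtain \<theta>1 W1 where \<theta>1: "test_fun W2 \<theta>1" "\<And>x. 0 \<le> \<theta>1 x" "\<And>x. \<theta>1 x \<le> 1"
      "open W1" "\<Gamma> \<subseteq> W1" "\<And>x. x \<in> W1 \<Longrightarrow> \<theta>1 x = 1"
    using smooth_urysohn[OF \<open>compact \<Gamma>\<close> \<theta>2(4,5)] by metis
  have W2V: "W2 \<subseteq> V"
  proof
    fix x assume "x \<in> W2"
    then show "x \<in> V" using \<theta>2(6)[of x] notin_tsupport[of x \<theta>2] test_funD(3)[OF \<theta>2(1)] by auto
  qed
  \<comment> \<open>Both cutoffs vanish near \<Gamma>. The transition of \<phi> takes place inside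
    \<open>W2\<close>, where \<eta> is 0, so \<phi> is 1 wherever \<eta> is nonzero. The transition
    of \<eta> takes place inside \<open>V\<close>, where \<open>u - v\<close> is at most
    \<epsilon>.\<close>
  define \<phi> where "\<phi> = (\<lambda>x. 1 - \<theta>1 x)"
  define \<eta> where "\<eta> = (\<lambda>x. 1 - \<theta>2 x)"
  have sm: "smooth \<phi>" "smooth \<eta>"
    unfolding \<phi>_def \<eta>_def by (intro smooth_minus smooth_const test_fun_smooth[OF \<theta>1(1)] test_fun_smooth[OF \<theta>2(1)])+
  have sG: "smooth_Gamma \<Gamma> \<phi>"
    unfolding smooth_Gamma_def using sm \<theta>1(4,5,6) by (auto simp: \<phi>_def intro!: exI[of _ W1])
  have \<eta>01: "0 \<le> \<eta> x" "\<eta> x \<le> 1" and \<phi>01: "0 \<le> \<phi> x" "\<phi> x \<le> 1" for x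
    using \<theta>1 \<theta>2 by (auto simp: \<eta>_def \<phi>_def)
  have g\<eta>: "grad \<eta> x = - grad \<theta>2 x" for x
    unfolding \<eta>_def by (simp add: grad_minus[OF smooth_const test_fun_smooth[OF \<theta>2(1)]])
  obtain C\<eta> where C\<eta>: "C\<eta> > 0" "\<And>x. norm (grad \<eta> x) \<le> C\<eta>"
    using test_fun_bounded[OF \<theta>2(1)] unfolding g\<eta> norm_minus_cancel by metis
  have \<eta>W2: "\<eta> x = 0" "grad \<eta> x = 0" if "x \<in> W2" for x
  proof -
    show "\<eta> x = 0" using \<theta>2(6)[OF that] by (simp add: \<eta>_def)
    have "grad \<eta> x = grad (\<lambda>x. 0) x"
      by (rule grad_cong[OF \<theta>2(4) that]) (auto simp: \<eta>_def \<theta>2(6))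
    then show "grad \<eta> x = 0" by simp
  qed
  have \<eta>V: "\<eta> x = 1" "grad \<eta> x = 0" if "x \<notin> V" for x
  proof -
    have "x \<notin> tsupport \<theta>2" using that test_funD(3)[OF \<theta>2(1)] by auto
    then show "\<eta> x = 1" "grad \<eta> x = 0" by (simp_all add: g\<eta> notin_tsupport grad_notin_tsupport) (simp add: \<eta>_def notin_tsupport)
  qed
  have \<phi>1: "\<phi> x = 1" if "x \<notin> tsupport \<theta>1" for x
    using notin_tsupport[OF that] by (simp add: \<phi>_def)
  have ts1: "tsupport \<theta>1 \<subseteq> W2" using test_funD(3)[OF \<theta>1(1)] .

  \<comment> \<open>Smooth approximation of the cut-off functions\<close>
  have a0: "W1p0 \<Omega> p (\<lambda>x. u x * \<phi> x)" using u(1) sG unfolding W1p_cGamma_def by blast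
  obtain g1 f1 D1 where a': "weak_grad \<Omega> (\<lambda>x. u x * \<phi> x) g1" "\<forall>k. test_fun \<Omega> (f1 k)"
    "D1 \<in> borel_measurable M" "\<forall>x. 0 \<le> D1 x" "integrable M (\<lambda>x. D1 x powr p)" "\<forall>x. norm (g1 x) \<le> D1 x"
    "AE x in M. (\<lambda>k. f1 k x) \<longlonglongrightarrow> u x * \<phi> x \<and> (\<lambda>k. grad (f1 k) x) \<longlonglongrightarrow> g1 x \<and> (\<forall>k. norm (grad (f1 k) x) \<le> D1 x)"
    by (rule W1p0_approx[OF a0 p \<Omega>m, folded M_def])
  note a = a'(1) a'(2)[rule_format] a'(3) a'(4)[rule_format] a'(5) a'(6)[rule_format] a'(7)
  have b0: "W1p0 \<Omega> p (\<lambda>x. v x * \<phi> x)" using v(1) sG unfolding W1p_cGamma_def by blast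
  obtain g2 f2 D2 where b': "weak_grad \<Omega> (\<lambda>x. v x * \<phi> x) g2" "\<forall>k. test_fun \<Omega> (f2 k)"
    "D2 \<in> borel_measurable M" "\<forall>x. 0 \<le> D2 x" "integrable M (\<lambda>x. D2 x powr p)" "\<forall>x. norm (g2 x) \<le> D2 x"
    "AE x in M. (\<lambda>k. f2 k x) \<longlonglongrightarrow> v x * \<phi> x \<and> (\<lambda>k. grad (f2 k) x) \<longlonglongrightarrow> g2 x \<and> (\<forall>k. norm (grad (f2 k) x) \<le> D2 x)"
    by (rule W1p0_approx[OF b0 p \<Omega>m, folded M_def])
  note b = b'(1) b'(2)[rule_format] b'(3) b'(4)[rule_format] b'(5) b'(6)[rule_format] b'(7)
  \<comment> \<open>The summand 1 serves twice: bounded terms such as \<open>C\<eta>\<close> are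
    absorbed into multiples of \<open>D\<close>, and \<open>D \<ge> 1\<close> together with
    \<open>p > 1\<close> makes \<open>D\<close> itself integrable, being bounded by its p-th
    power.\<close>
  define D where "D = (\<lambda>x. 1 + (D1 x + D2 x))"
  note [measurable] = a(3) b(3)
  have D1: "1 \<le> D x" for x using a(4) b(4) by (simp add: D_def)
  have Dint: "integrable M (\<lambda>x. D x powr p)"
    unfolding D_def using a(4,5) b(4,5) p by (intro integrable_powr_add) auto
  have gm [measurable]: "g1 \<in> borel_measurable M" "g2 \<in> borel_measurable M"
    using weak_grad_measurable[OF a(1)] weak_grad_measurable[OF b(1)] by (simp_all add: M_def)
  have Am [measurable]: "(\<lambda>x. \<A> x (g1 x)) \<in> borel_measurable M" "(\<lambda>x. \<A> x (g2 x)) \<in> borel_measurable M"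
    using structure_cond_measurable[OF \<A>] gm by (simp_all add: M_def)

  define d where "d k = (\<lambda>x. f1 k x - f2 k x)" for k
  define w where "w x = u x * \<phi> x - v x * \<phi> x" for x
  have d: "test_fun \<Omega> (d k)" for k unfolding d_def by (rule test_fun_minus[OF a(2) b(2)])
  have gd: "grad (d k) x = grad (f1 k) x - grad (f2 k) x" for k x
    unfolding d_def by (rule grad_minus[OF test_fun_smooth[OF a(2)] test_fun_smooth[OF b(2)]])
  have lim: "AE x in M. (\<lambda>k. d k x) \<longlonglongrightarrow> w x \<and> (\<lambda>k. grad (d k) x) \<longlonglongrightarrow> g1 x - g2 x \<and>
      (\<forall>k. norm (grad (d k) x) \<le> D x)"
    using a(7) b(7)
  proof eventually_elim
    case (elim x)
    have "norm (grad (d k) x) \<le> D x" for k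
      unfolding gd D_def using elim norm_triangle_ineq4[of "grad (f1 k) x" "grad (f2 k) x"]
      by (smt (verit, ccfv_threshold))
    then show ?case using elim unfolding gd by (auto simp: d_def w_def intro!: tendsto_diff)
  qed

  \<comment> \<open>Test functions built from the flat function\<close>
  define F where "F = (\<lambda>t. flat 0 (t - \<epsilon>))"
  \<comment> \<open>The derivative of F, in explicit form. F and \<open>F'\<close> vanish up to
    \<epsilon> and are positive beyond it.\<close>
  define F' where "F' = (\<lambda>t. flat 2 (t - \<epsilon>))"
  have smF: "smooth F"
    unfolding F_def
    by (intro smooth_compose[OF smooth_flat] smooth_minus smooth_const smooth_linear bounded_linear_ident)
  have F01: "0 \<le> F t" "F t \<le> 1" "0 \<le> F' t" "F' t \<le> 2" for t
    using flat_0_le_1 flat_2_le_2 by (auto simp: F_def F'_def)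
  have F0: "F t = 0" "F' t = 0" if "t \<le> \<epsilon>" for t using that by (auto simp: F_def F'_def)
  have Fpos: "0 < F t \<longleftrightarrow> \<epsilon> < t" "0 < F' t \<longleftrightarrow> \<epsilon> < t" for t by (auto simp: F_def F'_def)
  have pF: "partial 1 F t = F' t" for t
  proof -
    have "((\<lambda>t. flat 0 (t - \<epsilon>)) has_field_derivative flat 2 (t - \<epsilon>) * 1) (at t)"
      by (rule DERIV_chain2[of "flat 0"]) (use flat_has_derivative[of 0 "t - \<epsilon>"] in \<open>auto intro!: derivative_eq_intros simp: numeral_2_eq_2\<close>)
    from partial_eqI[OF this[unfolded has_field_derivative_def]] show ?thesis by (simp add: F_def F'_def)
  qed
  have contF: "isCont F t" "isCont F' t" for t
  proof -
    have "smooth F'"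
      unfolding F'_def
      by (intro smooth_compose[OF smooth_flat] smooth_minus smooth_const smooth_linear bounded_linear_ident)
    then show "isCont F t" "isCont F' t"
      using smF by (auto intro: differentiable_imp_continuous_within smooth_differentiable)
  qed
  define h where "h k = (\<lambda>x. F (d k x))" for k
  \<comment> \<open>F vanishes at 0 because \<epsilon> is positive, so compact support is preserved.
    The functions \<open>h k\<close> without the cutoff will enter the Poincare inequality, while
    their products \<open>\<psi> k\<close> with \<eta> enter the weak inequality.\<close>
  have h: "test_fun \<Omega> (h k)" for k
    unfolding h_def by (rule test_fun_compose[OF smF F0(1) d]) (use \<epsilon> in simp)
  have gh: "grad (h k) x = F' (d k x) *\<^sub>R grad (d k) x" for k x
    unfolding h_def by (simp add: grad_compose[OF smF test_fun_smooth[OF d]] pF)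
  define \<psi> where "\<psi> k = (\<lambda>x. h k x * \<eta> x)" for k
  have \<psi>: "test_fun \<Omega> (\<psi> k)" for k unfolding \<psi>_def by (rule test_fun_mult[OF h sm(2)])
  have \<psi>0: "0 \<le> \<psi> k x" for k x using F01 \<eta>01 by (simp add: \<psi>_def h_def)
  have g\<psi>: "grad (\<psi> k) x = \<eta> x *\<^sub>R F' (d k x) *\<^sub>R grad (d k) x + F (d k x) *\<^sub>R grad \<eta> x" for k x
    unfolding \<psi>_def by (subst grad_mult[OF test_fun_smooth[OF h] sm(2)]) (simp add: gh, simp add: h_def)
  have meas [measurable]: "h k \<in> borel_measurable M" "grad (h k) \<in> borel_measurable M" "grad (\<psi> k) \<in> borel_measurable M"
      "d k \<in> borel_measurable M" "grad (d k) \<in> borel_measurable M" for k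
    unfolding M_def using h \<psi> d
    by (auto intro!: measurable_lebesgue_on_borel borel_measurable_smooth borel_measurable_grad test_fun_smooth)
  have "(\<lambda>x. u x * \<phi> x) \<in> borel_measurable M" "(\<lambda>x. v x * \<phi> x) \<in> borel_measurable M"
    using a(1) b(1) unfolding M_def weak_grad_def Lp_loc_def by blast+
  then have w [measurable]: "w \<in> borel_measurable M"
    unfolding w_def by (rule borel_measurable_diff)

  text \<open>Where the test functions \<open>\<psi> k\<close> live, the cutoff \<open>\<phi>\<close> equals 1, so that there the possibly
    non-integrable gradients of \<open>u\<close> and \<open>v\<close> coincide with \<open>g1\<close> and \<open>g2\<close>.\<close>
  obtain gu gv where gu: "weak_grad \<Omega> u gu" and gv: "weak_grad \<Omega> v gv"
    and ineq: "\<forall>f. test_fun \<Omega> f \<longrightarrow> (\<forall>x. 0 \<le> f x) \<longrightarrow>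
      (LINT x:\<Omega>|lebesgue. \<A> x (gu x) \<bullet> grad f x) \<le> (LINT x:\<Omega>|lebesgue. \<A> x (gv x) \<bullet> grad f x)"
    by (rule weak_solution_inequality[OF sub super])
  define U where "U = \<Omega> - tsupport \<theta>1"
  have U: "open U" "U \<subseteq> \<Omega>" using \<Omega> unfolding U_def tsupport_def by (auto intro: open_Diff)
  have gAE: "AE x in M. x \<in> U \<longrightarrow> gu x = g1 x \<and> gv x = g2 x"
  proof -
    have "AE x in lebesgue. x \<in> U \<longrightarrow> gu x = g1 x"
      by (rule weak_grad_unique[OF U(1) \<Omega>(1) U(2) gu a(1)]) (simp add: U_def \<phi>1)
    moreover have "AE x in lebesgue. x \<in> U \<longrightarrow> gv x = g2 x"
      by (rule weak_grad_unique[OF U(1) \<Omega>(1) U(2) gv b(1)]) (simp add: U_def \<phi>1)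
    ultimately show ?thesis unfolding AEM by eventually_elim auto
  qed
  have \<psi>U: "grad (\<psi> k) x = 0" if "x \<in> \<Omega>" "x \<notin> U" for k x
    using that ts1 \<eta>W2[of x] by (auto simp: g\<psi> U_def)

  \<comment> \<open>Majorants and passage to the limit in the weak inequality\<close>
  have gum: "gu \<in> borel_measurable M" "gv \<in> borel_measurable M"
    using weak_grad_measurable[OF gu] weak_grad_measurable[OF gv] by (simp_all add: M_def)
  have Aum [measurable]: "(\<lambda>x. \<A> x (gu x)) \<in> borel_measurable M" "(\<lambda>x. \<A> x (gv x)) \<in> borel_measurable M"
    using structure_cond_measurable[OF \<A>] gum by (simp_all add: M_def)
  have Abound: "norm (\<A> x z) \<le> L * D x powr (p - 1)" if "x \<in> \<Omega>" "norm z \<le> D x" for x z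
  proof -
    have "norm (\<A> x z) \<le> L * norm z powr (p - 1)" using \<A> that(1) by (simp add: structure_cond_def)
    also have "\<dots> \<le> L * D x powr (p - 1)" using p L that(2) by (intro mult_left_mono powr_mono2) auto
    finally show ?thesis .
  qed
  have g12: "norm (g1 x) \<le> D x" "norm (g2 x) \<le> D x" for x
    using a(4)[of x] a(6)[of x] b(4)[of x] b(6)[of x] by (auto simp: D_def)
  have \<psi>bound: "AE x in M. \<forall>k. norm (grad (\<psi> k) x) \<le> (2 + C\<eta>) * D x"
    using lim
  proof eventually_elim
    case (elim x)
    show ?case
    proof
      fix k
      have "norm (grad (\<psi> k) x) \<le> norm (\<eta> x *\<^sub>R F' (d k x) *\<^sub>R grad (d k) x) + norm (F (d k x) *\<^sub>R grad \<eta> x)"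
        unfolding g\<psi> by (rule norm_triangle_ineq)
      also have "norm (\<eta> x *\<^sub>R F' (d k x) *\<^sub>R grad (d k) x) = \<eta> x * (F' (d k x) * norm (grad (d k) x))"
        using \<eta>01 F01 by simp
      also have "\<dots> \<le> 1 * (2 * D x)"
        using \<eta>01 F01 elim D1[of x] by (intro mult_mono) auto
      also have "norm (F (d k x) *\<^sub>R grad \<eta> x) \<le> 1 * C\<eta>"
        using F01 C\<eta> by (simp only: norm_scaleR, intro mult_mono) auto
      also have "1 * (2 * D x) + 1 * C\<eta> \<le> (2 + C\<eta>) * D x"
        using D1[of x] C\<eta>(1) by (simp add: algebra_simps)
      finally show "norm (grad (\<psi> k) x) \<le> (2 + C\<eta>) * D x" by simp
    qed
  qed
  \<comment> \<open>The growth bound \<open>L * D powr (p - 1)\<close> for \<A> is multiplied by the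
    bound \<open>(2 + C\<eta>) * D\<close> for the gradient of \<open>\<psi> k\<close>; the
    exponents add up to p.\<close>
  define K where "K = L * (2 + C\<eta>)"
  have dom: "\<bar>\<A> x z \<bullet> y\<bar> \<le> K * D x powr p" if "x \<in> \<Omega>" "norm z \<le> D x" "norm y \<le> (2 + C\<eta>) * D x" for x z y
  proof -
    have "\<bar>\<A> x z \<bullet> y\<bar> \<le> norm (\<A> x z) * norm y" by (rule Cauchy_Schwarz_ineq2)
    also have "\<dots> \<le> (L * D x powr (p - 1)) * ((2 + C\<eta>) * D x)"
      using that Abound L D1[of x] C\<eta> by (intro mult_mono) auto
    also have "\<dots> = K * (D x powr (p - 1) * D x powr 1)" using D1[of x] by (simp add: K_def)
    also have "\<dots> = K * D x powr p" by (simp only: powr_add[symmetric]) simp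
    finally show ?thesis .
  qed
  have AEspace: "AE x in M. x \<in> \<Omega>" using spM AE_space[of M] by simp
  have int1: "integrable M (\<lambda>x. \<A> x (g x) \<bullet> grad (\<psi> k) x)"
    if "\<And>x. norm (g x) \<le> D x" "(\<lambda>x. \<A> x (g x)) \<in> borel_measurable M" for g k
  proof (rule Bochner_Integration.integrable_bound[where f="\<lambda>x. K * D x powr p"])
    show "AE x in M. norm (\<A> x (g x) \<bullet> grad (\<psi> k) x) \<le> norm (K * D x powr p)"
      using \<psi>bound AEspace
    proof eventually_elim
      case (elim x)
      then show ?case using dom[of x "g x" "grad (\<psi> k) x"] that(1)[of x] by simp
    qed
    show "integrable M (\<lambda>x. K * D x powr p)" using Dint by simp
  qed (use that(2) in measurable)
  \<comment> \<open>\<open>T k\<close> is the integrand of the difference of the two inequalities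
    tested with \<open>\<psi> k\<close>. Its pointwise limit \<open>T\<^sub>0\<close> has the
    gradient of the test function expanded into a monotonicity part and a cutoff part.\<close>
  define T where "T k x = (\<A> x (g1 x) - \<A> x (g2 x)) \<bullet> grad (\<psi> k) x" for k x
  define T\<^sub>0 where "T\<^sub>0 x = (\<A> x (g1 x) - \<A> x (g2 x)) \<bullet> (\<eta> x *\<^sub>R F' (w x) *\<^sub>R (g1 x - g2 x) + F (w x) *\<^sub>R grad \<eta> x)" for x
  have Tle: "(\<integral>x. T k x \<partial>M) \<le> 0" for k
  proof -
    have "(\<integral>x. \<A> x (g1 x) \<bullet> grad (\<psi> k) x \<partial>M) = (\<integral>x. \<A> x (gu x) \<bullet> grad (\<psi> k) x \<partial>M)"
    proof (rule integral_cong_AE)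
      show "AE x in M. \<A> x (g1 x) \<bullet> grad (\<psi> k) x = \<A> x (gu x) \<bullet> grad (\<psi> k) x"
        using gAE AEspace by eventually_elim (metis \<psi>U inner_zero_right)
    qed measurable
    also have "\<dots> \<le> (\<integral>x. \<A> x (gv x) \<bullet> grad (\<psi> k) x \<partial>M)"
      using ineq \<psi>[of k] \<psi>0[of k] unfolding set_integral_lebesgue_on[OF \<Omega>m] M_def by blast
    also have "\<dots> = (\<integral>x. \<A> x (g2 x) \<bullet> grad (\<psi> k) x \<partial>M)"
    proof (rule integral_cong_AE)
      show "AE x in M. \<A> x (gv x) \<bullet> grad (\<psi> k) x = \<A> x (g2 x) \<bullet> grad (\<psi> k) x"
        using gAE AEspace by eventually_elim (metis \<psi>U inner_zero_right)
    qed measurable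
    finally show ?thesis
      unfolding T_def inner_diff_left
      by (subst Bochner_Integration.integral_diff) (auto intro: int1 g12 Am)
  qed
  have Tlim: "(\<lambda>k. \<integral>x. T k x \<partial>M) \<longlonglongrightarrow> (\<integral>x. T\<^sub>0 x \<partial>M)"
    and T0int: "integrable M T\<^sub>0"
  proof -
    have grad\<eta>m [measurable]: "\<eta> \<in> borel_measurable M" "grad \<eta> \<in> borel_measurable M"
      unfolding M_def using sm by (auto intro!: measurable_lebesgue_on_borel borel_measurable_smooth borel_measurable_grad)
    have [measurable]: "F \<in> borel_measurable borel" "F' \<in> borel_measurable borel"
      using contF by (auto intro!: borel_measurable_continuous_onI continuous_at_imp_continuous_on)
    have m0: "T\<^sub>0 \<in> borel_measurable M" unfolding T\<^sub>0_def by measurable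
    have mk: "T k \<in> borel_measurable M" for k unfolding T_def by measurable
    have i: "integrable M (\<lambda>x. 2 * (K * D x powr p))" using Dint by simp
    have l: "AE x in M. (\<lambda>k. T k x) \<longlonglongrightarrow> T\<^sub>0 x"
      using lim
    proof eventually_elim
      case (elim x)
      then show ?case
        unfolding T_def T\<^sub>0_def g\<psi>
        by (intro tendsto_intros isCont_tendsto_compose[OF contF(1)] isCont_tendsto_compose[OF contF(2)]) auto
    qed
    have b: "AE x in M. norm (T k x) \<le> 2 * (K * D x powr p)" for k
      using \<psi>bound AEspace
    proof eventually_elim
      case (elim x)
      then have "\<bar>\<A> x (g1 x) \<bullet> grad (\<psi> k) x\<bar> \<le> K * D x powr p" "\<bar>\<A> x (g2 x) \<bullet> grad (\<psi> k) x\<bar> \<le> K * D x powr p"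
        using dom g12 by auto
      then show ?case unfolding T_def inner_diff_left by simp
    qed
    show "(\<lambda>k. \<integral>x. T k x \<partial>M) \<longlonglongrightarrow> (\<integral>x. T\<^sub>0 x \<partial>M)" "integrable M T\<^sub>0"
      by (rule integral_dominated_convergence[OF m0 mk i l b], rule integrable_dominated_convergence[OF m0 mk i l b])
  qed
  have w\<epsilon>: "AE x in M. x \<in> V \<longrightarrow> w x \<le> \<epsilon>"
    using V(3)
  proof eventually_elim
    case (elim x)
    show ?case
    proof
      assume "x \<in> V"
      then have "u x - v x \<le> \<epsilon>" using elim by simp
      then have "(u x - v x) * \<phi> x \<le> \<epsilon> * \<phi> x" using \<phi>01(1) by (rule mult_right_mono)
      also have "\<dots> \<le> \<epsilon> * 1" using \<phi>01(2) \<epsilon> by (intro mult_left_mono) auto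
      finally show "w x \<le> \<epsilon>" by (simp add: w_def left_diff_distrib)
    qed
  qed
  \<comment> \<open>On \<open>V\<close> both parts vanish because \<open>w \<le> \<epsilon>\<close>.
    Off \<open>V\<close> the cutoff is constantly 1, and only the monotonicity expression weighted
    by \<open>F' (w x)\<close> remains.\<close>
  have T0: "AE x in M. 0 \<le> T\<^sub>0 x \<and> (T\<^sub>0 x = 0 \<longrightarrow> F' (w x) *\<^sub>R (g1 x - g2 x) = 0)"
    using w\<epsilon> AEspace
  proof eventually_elim
    case (elim x)
    show ?case
    proof (cases "x \<in> V")
      case True
      then show ?thesis using elim F0[of "w x"] by (simp add: T\<^sub>0_def)
    next
      case False
      have mono: "g1 x \<noteq> g2 x \<Longrightarrow> 0 < (\<A> x (g1 x) - \<A> x (g2 x)) \<bullet> (g1 x - g2 x)"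
        using \<A> elim by (simp add: structure_cond_def)
      have "T\<^sub>0 x = F' (w x) * ((\<A> x (g1 x) - \<A> x (g2 x)) \<bullet> (g1 x - g2 x))"
        by (simp add: T\<^sub>0_def \<eta>V[OF False])
      with mono F01(3)[of "w x"] show ?thesis by (cases "g1 x = g2 x") auto
    qed
  qed
  have "(\<integral>x. T\<^sub>0 x \<partial>M) \<le> 0" using LIMSEQ_le_const2[OF Tlim] Tle by blast
  moreover have "0 \<le> (\<integral>x. T\<^sub>0 x \<partial>M)" using T0 by (intro integral_nonneg_AE) auto
  ultimately have "AE x in M. T\<^sub>0 x = 0"
    using integral_nonneg_eq_0_iff_AE[OF T0int] T0 by auto
  with T0 have G0: "AE x in M. F' (w x) *\<^sub>R (g1 x - g2 x) = 0" by eventually_elim simp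

  \<comment> \<open>From a vanishing gradient to a vanishing function\<close>
  obtain R where R: "0 \<le> R" "\<Omega> \<subseteq> cball 0 R"
    using bounded_subset_ballD[OF \<Omega>(2), of 0] ball_subset_cball by (metis less_imp_le subset_trans)
  have hle: "(\<integral>x. h k x \<partial>M) \<le> R * (\<integral>x. norm (grad (h k) x) \<partial>M)" for k
  proof -
    have sw: "(\<integral>x. f x \<partial>M) = (\<integral>x. f x \<partial>lborel)" if "f \<in> borel_measurable borel" "\<And>x. x \<notin> \<Omega> \<Longrightarrow> f x = 0" for f :: "'a \<Rightarrow> real"
    proof -
      have "(\<lambda>x. indicator \<Omega> x *\<^sub>R f x) = f" using that(2) by (auto simp: fun_eq_iff indicator_def)
      then have "(\<integral>x. f x \<partial>M) = (\<integral>x. f x \<partial>lebesgue)"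
        unfolding M_def using \<Omega>m by (simp add: integral_restrict_space)
      also have "\<dots> = (\<integral>x. f x \<partial>lborel)" using that(1) by (intro integral_completion) simp
      finally show ?thesis .
    qed
    have z: "x \<notin> tsupport (h k)" if "x \<notin> \<Omega>" for x using that test_funD(3)[OF h] by blast
    have "(\<integral>x. h k x \<partial>M) = (\<integral>x. h k x \<partial>lborel)"
      by (rule sw[OF borel_measurable_smooth[OF test_fun_smooth[OF h]] notin_tsupport[OF z]])
    moreover have "(\<integral>x. norm (grad (h k) x) \<partial>M) = (\<integral>x. norm (grad (h k) x) \<partial>lborel)"
    proof (rule sw)
      show "(\<lambda>x. norm (grad (h k) x)) \<in> borel_measurable borel"
        using borel_measurable_grad[OF test_fun_smooth[OF h]] by measurable
    qed (simp add: grad_notin_tsupport[OF z])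
    moreover have "0 \<le> h k x" for x by (simp add: h_def F01)
    ultimately show ?thesis using integral_le_integral_grad[OF h _ R(2,1), of k] by simp
  qed
  have Dint1: "integrable M D"
  proof (rule Bochner_Integration.integrable_bound[OF Dint])
    show "AE x in M. norm (D x) \<le> norm (D x powr p)"
    proof (rule AE_I2)
      fix x show "norm (D x) \<le> norm (D x powr p)"
        using powr_mono[of 1 p "D x"] p D1[of x] by simp
    qed
  qed (simp add: D_def)
  \<comment> \<open>The gradients of \<open>h k\<close> converge to
    \<open>F' (w x) *\<^sub>R (g1 x - g2 x)\<close>, which has just been shown to vanish. The
    Poincare inequality is therefore applied to the approximants, and only its two sides are passed
    to the limit.\<close>
  have l1: "(\<lambda>k. \<integral>x. norm (grad (h k) x) \<partial>M) \<longlonglongrightarrow> (\<integral>x. 0 \<partial>M)"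
  proof (rule integral_dominated_convergence[where w="\<lambda>x. 2 * D x"])
    show "integrable M (\<lambda>x. 2 * D x)" using Dint1 by simp
    show "AE x in M. (\<lambda>k. norm (grad (h k) x)) \<longlonglongrightarrow> 0"
      using lim G0
    proof eventually_elim
      case (elim x)
      then have "(\<lambda>k. F' (d k x) *\<^sub>R grad (d k) x) \<longlonglongrightarrow> F' (w x) *\<^sub>R (g1 x - g2 x)"
        by (intro tendsto_intros isCont_tendsto_compose[OF contF(2)]) auto
      then show ?case unfolding gh elim(2) by (rule tendsto_norm_zero)
    qed
    show "AE x in M. norm (norm (grad (h k) x)) \<le> 2 * D x" for k
      using lim
    proof eventually_elim
      case (elim x)
      then have "F' (d k x) * norm (grad (d k) x) \<le> 2 * D x" using F01 by (intro mult_mono) auto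
      then show ?case using F01 by (simp add: gh)
    qed
  qed measurable
  have [measurable]: "F \<in> borel_measurable borel"
    using contF by (auto intro!: borel_measurable_continuous_onI continuous_at_imp_continuous_on)
  have l2: "(\<lambda>k. \<integral>x. h k x \<partial>M) \<longlonglongrightarrow> (\<integral>x. F (w x) \<partial>M)"
  proof (rule integral_dominated_convergence[where w="\<lambda>x. 1"])
    show "AE x in M. (\<lambda>k. h k x) \<longlonglongrightarrow> F (w x)"
      using lim by eventually_elim (auto simp: h_def intro: isCont_tendsto_compose[OF contF(1)])
    show "AE x in M. norm (h k x) \<le> 1" for k using F01 by (simp add: h_def)
  qed measurable
  have "(\<integral>x. F (w x) \<partial>M) \<le> R * (\<integral>x. 0 \<partial>M)"
    by (rule LIMSEQ_le[OF l2 tendsto_mult_left[OF l1]]) (use hle in auto)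
  then have "(\<integral>x. F (w x) \<partial>M) \<le> 0" by simp
  moreover have "0 \<le> (\<integral>x. F (w x) \<partial>M)" using F01 by simp
  moreover have "integrable M (\<lambda>x. F (w x))"
    by (rule M.integrable_const_bound[where B=1]) (use F01 in auto)
  ultimately have "AE x in M. F (w x) = 0"
    using integral_nonneg_eq_0_iff_AE[of M "\<lambda>x. F (w x)"] F01(1) by auto
  with V(3) have "AE x in M. u x - v x \<le> \<epsilon>"
  proof eventually_elim
    case (elim x)
    show ?case
    proof (cases "x \<in> V")
      case False
      then have "\<phi> x = 1" using \<phi>1 ts1 W2V by blast
      moreover have "w x \<le> \<epsilon>" using elim(2) Fpos(1)[of "w x"] by auto
      ultimately show ?thesis by (simp add: w_def)
    qed (use elim in auto)
  qed
  then show ?thesis unfolding AEM .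
qed

lemma comparison_AE:
  fixes \<Omega> \<Gamma> :: "'a::euclidean_space set"
  assumes "1 < p" "open \<Omega>" "bounded \<Omega>" "closed \<Gamma>" "\<Gamma> \<subseteq> frontier \<Omega>"
    "1 \<le> L" "structure_cond \<Omega> p L \<A>" "0 < \<beta>"
    "W1p_cGamma \<Omega> \<Gamma> p u" "Linf_Gamma_beta \<Omega> \<Gamma> \<beta> u"
    "W1p_cGamma \<Omega> \<Gamma> p v" "Linf_Gamma_beta \<Omega> \<Gamma> \<beta> v"
    "weak_subsol \<Omega> p \<A> \<nu>p \<nu>m u" "weak_supersol \<Omega> p \<A> \<nu>p \<nu>m v"
  shows "AE x in lebesgue. x \<in> \<Omega> \<longrightarrow> u x \<le> v x"
proof -
  have "AE x in lebesgue. \<forall>n. x \<in> \<Omega> \<longrightarrow> u x - v x \<le> 1 / real (Suc n)"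
    unfolding AE_all_countable
    by (intro allI comparison_AE_eps[OF assms(1-7) assms(8-14)]) simp
  then show ?thesis
  proof eventually_elim
    case (elim x)
    show ?case
    proof
      assume "x \<in> \<Omega>"
      then have "u x - v x \<le> 1 / real (Suc n)" for n using elim by blast
      then have "u x - v x \<le> 0"
        by (intro LIMSEQ_le_const[OF LIMSEQ_Suc[OF lim_1_over_n[where 'a=real]]]) auto
      then show "u x \<le> v x" by simp
    qed
  qed
qed

section \<open>Box averages\<close>

lemma integrable_on_cbox_translate:
  fixes f :: "'a::euclidean_space \<Rightarrow> 'b::banach"
  assumes "continuous_on UNIV f"
  shows "(\<lambda>y. f (x + y)) integrable_on cbox a b"
  by (intro integrable_continuous continuous_on_compose2[OF assms] continuous_intros) auto

text \<open>Differentiation under the integral sign. The derivative functional is encoded as a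
  bounded linear function, so that it can itself be integrated over the box.\<close>

lemma has_derivative_integral_translate:
  assumes f: "smooth f"
  shows "((\<lambda>x. integral (cbox a b) (\<lambda>y. f (x + y))) has_derivative
    (\<lambda>h. integral (cbox a b) (\<lambda>y. grad f (x + y)) \<bullet> h)) (at x)"
proof -
  have "((\<lambda>x. integral (cbox a b) (\<lambda>y. f (x + y))) has_derivative
      blinfun_apply (integral (cbox a b) (\<lambda>y. blinfun_inner_right (grad f (x + y))))) (at x within UNIV)"
  proof (rule leibniz_rule)
    show "((\<lambda>x. f (x + t)) has_derivative blinfun_apply (blinfun_inner_right (grad f (x + t)))) (at x within UNIV)" for x t
    proof -
      have "((\<lambda>x. f (x + t)) has_derivative (\<lambda>h. grad f (x + t) \<bullet> h)) (at x)"
        by (rule has_derivative_compose[where f="\<lambda>x. x + t" and g=f, OF _ smooth_has_derivative[OF f]])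
          (auto intro!: derivative_eq_intros)
      then show ?thesis by simp
    qed
    show "(\<lambda>y. f (x + y)) integrable_on cbox a b" for x
      by (rule integrable_on_cbox_translate[OF smooth_continuous[OF f]])
    have "continuous_on (UNIV \<times> cbox a b) (\<lambda>z. blinfun_inner_right (grad f (fst z + snd z)))"
      by (intro bounded_linear.continuous_on[OF bounded_linear_blinfun_inner_right]
          continuous_on_compose2[OF smooth_continuous_grad[OF f, of UNIV]] continuous_intros) auto
    then show "continuous_on (UNIV \<times> cbox a b) (\<lambda>(x, t). blinfun_inner_right (grad f (x + t)))"
      by (simp add: case_prod_beta)
  qed auto
  moreover have "integral (cbox a b) (\<lambda>y. blinfun_inner_right (grad f (x + y)))
      = blinfun_inner_right (integral (cbox a b) (\<lambda>y. grad f (x + y)))"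
    using integral_linear[OF integrable_on_cbox_translate[OF smooth_continuous_grad[OF f]] bounded_linear_blinfun_inner_right, of a b x]
    by (simp add: o_def)
  ultimately show ?thesis by simp
qed

text \<open>For a fixed box, the integrals of all smooth integrands form a set closed under partial
  derivatives, because a partial derivative passes to the integrand.\<close>

lemma smooth_integral_translate:
  assumes "smooth f"
  shows "smooth (\<lambda>x. integral (cbox a b) (\<lambda>y. f (x + y)))"
proof (rule smooth_algI[of "{\<lambda>x. integral (cbox a b) (\<lambda>y. f (x + y)) | f. smooth f}"])
  fix g i x assume "g \<in> {\<lambda>x. integral (cbox a b) (\<lambda>y. f (x + y)) | f. smooth f}"
  then obtain f where f: "smooth f" and g: "g = (\<lambda>x. integral (cbox a b) (\<lambda>y. f (x + y)))" by auto
  show "g differentiable (at x)"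
    using has_derivative_integral_translate[OF f] unfolding g differentiable_def by blast
  assume i: "i \<in> (Basis::'a set)"
  have "partial i g x = integral (cbox a b) (\<lambda>y. partial i f (x + y))" for x
  proof -
    have "partial i g x = integral (cbox a b) (\<lambda>y. grad f (x + y)) \<bullet> i"
      unfolding g by (rule partial_eqI[OF has_derivative_integral_translate[OF f]])
    also have "\<dots> = integral (cbox a b) (\<lambda>y. grad f (x + y) \<bullet> i)"
      by (rule integral_component_eq[OF integrable_on_cbox_translate[OF smooth_continuous_grad[OF f]], symmetric])
    finally show ?thesis by (simp add: grad_inner_Basis[OF i])
  qed
  then have "partial i g = (\<lambda>x. integral (cbox a b) (\<lambda>y. partial i f (x + y)))" by (rule ext)
  then show "partial i g \<in> smooth_alg {\<lambda>x. integral (cbox a b) (\<lambda>y. f (x + y)) | f. smooth f}"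
    using smooth_partial[OF f i] by (intro smooth_alg.gen) blast
next
  show "(\<lambda>x. integral (cbox a b) (\<lambda>y. f (x + y))) \<in> smooth_alg {\<lambda>x. integral (cbox a b) (\<lambda>y. f (x + y)) | f. smooth f}"
    using assms by (intro smooth_alg.gen) blast
qed

text \<open>Integrate the inequality between \<open>t \<mapsto> t\<^sup>p\<close> and its tangent at the mean value of \<open>f\<close>.\<close>

lemma average_powr_le:
  fixes f :: "'b::euclidean_space \<Rightarrow> real"
  assumes p: "1 \<le> p" and f: "continuous_on (cbox a b) f" "\<And>y. y \<in> cbox a b \<Longrightarrow> 0 \<le> f y"
    and c: "0 < measure lborel (cbox a b)"
  shows "(integral (cbox a b) f / measure lborel (cbox a b)) powr p
    \<le> integral (cbox a b) (\<lambda>y. f y powr p) / measure lborel (cbox a b)"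
proof -
  define c where "c = measure lborel (cbox a b)"
  define m where "m = integral (cbox a b) f / c"
  have c0: "c > 0" using c by (simp add: c_def)
  have fi: "f integrable_on cbox a b" by (rule integrable_continuous[OF f(1)])
  have m0: "0 \<le> m" using f(2) c0 fi by (simp add: m_def Henstock_Kurzweil_Integration.integral_nonneg)
  have fpc: "continuous_on (cbox a b) (\<lambda>y. f y powr p)"
    using f p by (intro continuous_on_powr' continuous_intros) auto
  \<comment> \<open>Convexity is applied on the open half-line. For \<open>m = 0\<close> the left
    side is 0, and for \<open>t = 0\<close> it equals (1 - p) times the p-th power of
    \<open>m\<close>, which is not positive.\<close>
  have tangent: "m powr p + p * m powr (p - 1) * (t - m) \<le> t powr p" if "0 \<le> t" for t
  proof (cases "m = 0")
    case False
    then have m: "m > 0" using m0 by simp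
    show ?thesis
    proof (cases "t = 0")
      case True
      have "m powr (p - 1) * m = m powr p" using m powr_add[of m "p - 1" 1] by simp
      then have "m powr p + p * m powr (p - 1) * (t - m) = (1 - p) * m powr p"
        using True by (simp add: algebra_simps)
      also have "\<dots> \<le> 0" using p by (intro mult_nonpos_nonneg) auto
      finally show ?thesis using True by simp
    next
      case False
      have "p * m powr (p - 1) * (t - m) \<le> t powr p - m powr p"
      proof (rule convex_on_imp_above_tangent[OF powr_convex[OF p]])
        show "((\<lambda>x. x powr p) has_real_derivative p * m powr (p - 1)) (at m within {0<..})"
          using m by (rule has_field_derivative_at_within[OF has_real_derivative_powr])
      qed (use m that False in \<open>auto simp: interior_open\<close>)
      then show ?thesis by simp
    qed
  qed simp
  have "integral (cbox a b) (\<lambda>y. m powr p + p * m powr (p - 1) * (f y - m)) \<le> integral (cbox a b) (\<lambda>y. f y powr p)"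
  proof (rule integral_le)
    show "(\<lambda>y. m powr p + p * m powr (p - 1) * (f y - m)) integrable_on cbox a b"
      by (intro integrable_continuous continuous_intros f)
    show "(\<lambda>y. f y powr p) integrable_on cbox a b" by (rule integrable_continuous[OF fpc])
  qed (use tangent f in auto)
  also have "integral (cbox a b) (\<lambda>y. m powr p + p * m powr (p - 1) * (f y - m)) = c * m powr p"
  proof -
    have "((\<lambda>y. m powr p + p * m powr (p - 1) * (f y - m)) has_integral
        c *\<^sub>R (m powr p) + p * m powr (p - 1) * (integral (cbox a b) f - c *\<^sub>R m)) (cbox a b)"
      unfolding c_def
      by (intro has_integral_add has_integral_mult_right has_integral_diff has_integral_const integrable_integral fi)
    moreover have "integral (cbox a b) f = c * m" using c0 by (simp add: m_def)
    ultimately show ?thesis by (simp add: integral_unique)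
  qed
  finally show ?thesis using c0 unfolding m_def[symmetric] c_def[symmetric] by (simp add: field_simps)
qed

text \<open>Jensen's inequality in \<open>y\<close> for each \<open>x\<close>, followed by Tonelli:
  the uniform bound \<open>E\<close> on the slices survives averaging over \<open>y\<close>. This is
  the common core of the energy estimate and of both difference estimates below.\<close>

lemma nn_integral_average_powr_le:
  fixes h :: "'a::euclidean_space \<Rightarrow> 'b::euclidean_space \<Rightarrow> real"
  assumes p: "1 \<le> p" and h: "continuous_on UNIV (\<lambda>z. h (fst z) (snd z))" "\<And>x y. 0 \<le> h x y"
    and c: "0 < measure lborel (cbox a b)"
    and E: "\<And>y. y \<in> cbox a b \<Longrightarrow> (\<integral>\<^sup>+x. ennreal (h x y powr p) \<partial>lborel) \<le> E"
  shows "(\<integral>\<^sup>+x. ennreal ((integral (cbox a b) (h x) / measure lborel (cbox a b)) powr p) \<partial>lborel) \<le> E"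
proof -
  define c where "c = measure lborel (cbox a b)"
  have c0: "c > 0" using c by (simp add: c_def)
  have hx: "continuous_on S (h x)" for x S
    by (rule continuous_on_subset[OF continuous_on_compose2[OF h(1), of UNIV "\<lambda>y. (x, y)", simplified]])
      (auto intro!: continuous_intros)
  have hpx: "continuous_on S (\<lambda>y. h x y powr p)" for x S
    using h(2) p by (intro continuous_on_powr' hx continuous_intros) auto
  have "continuous_on UNIV (\<lambda>z. h (fst z) (snd z) powr p)"
    using h p by (intro continuous_on_powr' continuous_intros) auto
  then have [measurable]: "(\<lambda>z. h (fst z) (snd z) powr p) \<in> borel_measurable (borel \<Otimes>\<^sub>M borel)"
    unfolding borel_prod by (rule borel_measurable_continuous_onI)
  have m: "(\<lambda>(x, y). ennreal (h x y powr p) * indicator (cbox a b) y) \<in> borel_measurable (lborel \<Otimes>\<^sub>M lborel)"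
    unfolding case_prod_beta by measurable
  have "(\<integral>\<^sup>+x. ennreal ((integral (cbox a b) (h x) / c) powr p) \<partial>lborel)
    \<le> (\<integral>\<^sup>+x. ennreal (1 / c) * (\<integral>\<^sup>+y. ennreal (h x y powr p) * indicator (cbox a b) y \<partial>lborel) \<partial>lborel)"
  proof (rule nn_integral_mono)
    fix x
    have "(\<integral>\<^sup>+y. ennreal (h x y powr p) * indicator (cbox a b) y \<partial>lborel) = ennreal (integral (cbox a b) (\<lambda>y. h x y powr p))"
      by (intro nn_integral_has_integral_lebesgue' integrable_integral integrable_continuous hpx) simp
    moreover have "(integral (cbox a b) (h x) / c) powr p \<le> 1 / c * integral (cbox a b) (\<lambda>y. h x y powr p)"
      using average_powr_le[OF p hx h(2) c, of x] by (simp add: c_def)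
    ultimately show "ennreal ((integral (cbox a b) (h x) / c) powr p)
        \<le> ennreal (1 / c) * (\<integral>\<^sup>+y. ennreal (h x y powr p) * indicator (cbox a b) y \<partial>lborel)"
      using c0 by (simp add: ennreal_mult'[symmetric] ennreal_leI)
  qed
  also have "\<dots> = ennreal (1 / c) * (\<integral>\<^sup>+x. (\<integral>\<^sup>+y. ennreal (h x y powr p) * indicator (cbox a b) y \<partial>lborel) \<partial>lborel)"
    by (rule nn_integral_cmult) (use lborel.borel_measurable_nn_integral[OF m] in simp)
  also have "(\<integral>\<^sup>+x. (\<integral>\<^sup>+y. ennreal (h x y powr p) * indicator (cbox a b) y \<partial>lborel) \<partial>lborel)
      = (\<integral>\<^sup>+y. (\<integral>\<^sup>+x. ennreal (h x y powr p) * indicator (cbox a b) y \<partial>lborel) \<partial>lborel)"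
    by (rule lborel_pair.Fubini'[OF m, symmetric])
  also have "\<dots> \<le> (\<integral>\<^sup>+y. E * indicator (cbox a b) y \<partial>lborel)"
    by (intro nn_integral_mono) (auto simp: indicator_def intro: E)
  also have "\<dots> = E * ennreal c"
  proof -
    have "emeasure lborel (cbox a b) = ennreal c"
      unfolding c_def using emeasure_lborel_cbox_finite[of a b] by (intro emeasure_eq_ennreal_measure) auto
    then show ?thesis by (simp add: nn_integral_cmult_indicator)
  qed
  finally have "(\<integral>\<^sup>+x. ennreal ((integral (cbox a b) (h x) / c) powr p) \<partial>lborel) \<le> ennreal (1 / c) * (E * ennreal c)"
    by (simp add: mult_left_mono)
  also have "\<dots> = E * (ennreal (1 / c) * ennreal c)" by (simp add: mult_ac)
  also have "ennreal (1 / c) * ennreal c = 1" using c0 by (simp add: ennreal_mult'[symmetric])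
  finally show ?thesis by (simp add: c_def)
qed

lemma nn_integral_lborel_translate:
  fixes f :: "'a::euclidean_space \<Rightarrow> ennreal"
  assumes "f \<in> borel_measurable borel"
  shows "(\<integral>\<^sup>+x. f (x + y) \<partial>lborel) = (\<integral>\<^sup>+x. f x \<partial>lborel)"
proof -
  have "(\<integral>\<^sup>+x. f x \<partial>lborel) = (\<integral>\<^sup>+x. f x \<partial>(distr lborel borel ((+) y)))"
    by (simp add: lborel_distr_plus)
  also have "\<dots> = (\<integral>\<^sup>+x. f (x + y) \<partial>lborel)"
    using assms by (subst nn_integral_distr) (auto simp: add.commute)
  finally show ?thesis ..
qed

text \<open>Taken over \<open>lborel\<close>, where Tonelli and translation invariance are applied.
  For smooth functions it agrees with the integral over \<open>lebesgue\<close> in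
  \<open>cap_compact\<close>, since the gradient is Borel measurable.\<close>

definition energy :: "real \<Rightarrow> ('a::euclidean_space \<Rightarrow> real) \<Rightarrow> ennreal" where
  "energy p f = (\<integral>\<^sup>+x. ennreal (norm (grad f x) powr p) \<partial>lborel)"

lemma nn_integral_norm_grad_translate:
  assumes "smooth f"
  shows "(\<integral>\<^sup>+x. ennreal (norm (grad f (x + y)) powr p) \<partial>lborel) = energy p f"
  unfolding energy_def
  by (rule nn_integral_lborel_translate[of "\<lambda>x. ennreal (norm (grad f x) powr p)"])
    (use borel_measurable_grad[OF assms] in measurable)

text \<open>By the fundamental theorem of calculus along the segment from \<open>x\<close> to
  \<open>x + y\<close>, the increment is bounded by \<open>r\<close> times the average of the
  gradient norm over the parameter interval; each slice of that average is a translate with the same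
  energy.\<close>

lemma nn_integral_difference_le:
  assumes p: "1 \<le> p" and f: "smooth f" and y: "norm y \<le> r"
  shows "(\<integral>\<^sup>+x. ennreal (\<bar>f (x + y) - f x\<bar> powr p) \<partial>lborel) \<le> ennreal (r powr p) * energy p f"
proof -
  define h where "h x t = norm (grad f (x + t *\<^sub>R y)) * r" for x and t :: real
  have r: "0 \<le> r" using y norm_ge_zero order_trans by blast
  have hc: "continuous_on UNIV (\<lambda>z. h (fst z) (snd z))"
    unfolding h_def
    by (intro continuous_intros continuous_on_compose2[OF smooth_continuous_grad[OF f, of UNIV]]) auto
  have ht: "continuous_on S (h x)" for x S
    unfolding h_def
    by (intro continuous_intros continuous_on_compose2[OF smooth_continuous_grad[OF f, of UNIV]]) auto
  have le: "\<bar>f (x + y) - f x\<bar> \<le> integral (cbox 0 1) (h x) / measure lborel (cbox 0 (1::real))" for x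
  proof -
    have "((\<lambda>t. grad f (x + t *\<^sub>R y) \<bullet> y) has_integral (f (x + 1 *\<^sub>R y) - f (x + 0 *\<^sub>R y))) {0..1}"
    proof (rule fundamental_theorem_of_calculus)
      fix t :: real
      have "((\<lambda>t. f (x + t *\<^sub>R y)) has_derivative (\<lambda>s. grad f (x + t *\<^sub>R y) \<bullet> (s *\<^sub>R y))) (at t within {0..1})"
        by (rule has_derivative_compose[where f="\<lambda>t. x + t *\<^sub>R y" and g=f, OF _ smooth_has_derivative[OF f]])
          (auto intro!: derivative_eq_intros)
      then show "((\<lambda>t. f (x + t *\<^sub>R y)) has_vector_derivative grad f (x + t *\<^sub>R y) \<bullet> y) (at t within {0..1})"
        by (simp add: has_vector_derivative_def)
    qed simp
    then have i: "((\<lambda>t. grad f (x + t *\<^sub>R y) \<bullet> y) has_integral (f (x + y) - f x)) (cbox 0 1)" by simp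
    have "norm (integral (cbox 0 1) (\<lambda>t. grad f (x + t *\<^sub>R y) \<bullet> y)) \<le> integral (cbox 0 1) (h x)"
    proof (rule Henstock_Kurzweil_Integration.integral_norm_bound_integral)
      show "h x integrable_on cbox 0 1" by (rule integrable_continuous[OF ht])
      fix t
      have "\<bar>grad f (x + t *\<^sub>R y) \<bullet> y\<bar> \<le> norm (grad f (x + t *\<^sub>R y)) * norm y" by (rule Cauchy_Schwarz_ineq2)
      also have "\<dots> \<le> h x t" unfolding h_def using y by (intro mult_left_mono) auto
      finally show "norm (grad f (x + t *\<^sub>R y) \<bullet> y) \<le> h x t" by simp
    qed (use i in \<open>auto simp: has_integral_integrable\<close>)
    then show ?thesis using integral_unique[OF i] by simp
  qed
  have "(\<integral>\<^sup>+x. ennreal (\<bar>f (x + y) - f x\<bar> powr p) \<partial>lborel)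
      \<le> (\<integral>\<^sup>+x. ennreal ((integral (cbox 0 1) (h x) / measure lborel (cbox 0 (1::real))) powr p) \<partial>lborel)"
    using p by (intro nn_integral_mono ennreal_leI powr_mono2 le) auto
  also have "\<dots> \<le> ennreal (r powr p) * energy p f"
  proof (rule nn_integral_average_powr_le[OF p hc])
    show "0 \<le> h x t" for x t using r by (simp add: h_def)
    fix t :: real
    have [measurable]: "grad f \<in> borel_measurable borel" by (rule borel_measurable_grad[OF f])
    have "(\<integral>\<^sup>+x. ennreal (h x t powr p) \<partial>lborel) = (\<integral>\<^sup>+x. ennreal (r powr p) * ennreal (norm (grad f (x + t *\<^sub>R y)) powr p) \<partial>lborel)"
      using r by (intro nn_integral_cong) (simp add: h_def powr_mult ennreal_mult'[symmetric] mult.commute)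
    also have "\<dots> = ennreal (r powr p) * energy p f"
      by (subst nn_integral_cmult) (measurable, simp add: nn_integral_norm_grad_translate[OF f])
    finally show "(\<integral>\<^sup>+x. ennreal (h x t powr p) \<partial>lborel) \<le> ennreal (r powr p) * energy p f" by simp
  qed simp
  finally show ?thesis .
qed

definition box_average :: "'a::euclidean_space \<Rightarrow> 'a \<Rightarrow> ('a \<Rightarrow> real) \<Rightarrow> 'a \<Rightarrow> real" where
  "box_average a b f x = 1 / measure lborel (cbox a b) * integral (cbox a b) (\<lambda>y. f (x + y))"

lemma smooth_box_average: "smooth f \<Longrightarrow> smooth (box_average a b f)"
  unfolding box_average_def[abs_def] by (intro smooth_cmult smooth_integral_translate)

lemma grad_box_average:
  assumes "smooth f"
  shows "grad (box_average a b f) x = (1 / measure lborel (cbox a b)) *\<^sub>R integral (cbox a b) (\<lambda>y. grad f (x + y))"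
  unfolding box_average_def[abs_def]
  using grad_eqI[OF has_derivative_integral_translate[OF assms]]
  by (subst grad_cmult[OF smooth_integral_translate[OF assms]]) simp

text \<open>The gradient commutes with averaging, and an average of translates of the gradient
  cannot have larger p-norm than the gradient itself.\<close>

lemma energy_box_average_le:
  assumes p: "1 \<le> p" and f: "smooth f" and c: "0 < measure lborel (cbox a b)"
  shows "energy p (box_average a b f) \<le> energy p f"
proof -
  have le: "norm (grad (box_average a b f) x) \<le> integral (cbox a b) (\<lambda>y. norm (grad f (x + y))) / measure lborel (cbox a b)" for x
  proof -
    have "norm (integral (cbox a b) (\<lambda>y. grad f (x + y))) \<le> integral (cbox a b) (\<lambda>y. norm (grad f (x + y)))"
      by (rule Henstock_Kurzweil_Integration.integral_norm_bound_integral)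
        (auto intro!: integrable_on_cbox_translate continuous_intros smooth_continuous_grad f
           integrable_on_cbox_translate[of "\<lambda>z. norm (grad f z)"])
    then show ?thesis using c by (simp add: grad_box_average[OF f] divide_right_mono)
  qed
  have "energy p (box_average a b f)
      \<le> (\<integral>\<^sup>+x. ennreal ((integral (cbox a b) (\<lambda>y. norm (grad f (x + y))) / measure lborel (cbox a b)) powr p) \<partial>lborel)"
    unfolding energy_def using p by (intro nn_integral_mono ennreal_leI powr_mono2 le) auto
  also have "\<dots> \<le> energy p f"
  proof (rule nn_integral_average_powr_le[OF p _ _ c])
    show "continuous_on UNIV (\<lambda>z. norm (grad f (fst z + snd z)))"
      by (intro continuous_intros continuous_on_compose2[OF smooth_continuous_grad[OF f, of UNIV]]) auto
  qed (simp_all add: nn_integral_norm_grad_translate[OF f])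
  finally show ?thesis .
qed

text \<open>The deviation of the average from \<open>f\<close> is the average of the increments
  \<open>f (x + y) - f x\<close> over the box, each of which obeys the translation estimate with the
  same \<open>r\<close>.\<close>

lemma box_average_diff_le:
  assumes p: "1 \<le> p" and f: "smooth f" and c: "0 < measure lborel (cbox a b)"
    and r: "\<And>y. y \<in> cbox a b \<Longrightarrow> norm y \<le> r"
  shows "(\<integral>\<^sup>+x. ennreal (\<bar>box_average a b f x - f x\<bar> powr p) \<partial>lborel) \<le> ennreal (r powr p) * energy p f"
proof -
  have cf: "continuous_on UNIV f" by (rule smooth_continuous[OF f])
  have le: "\<bar>box_average a b f x - f x\<bar> \<le> integral (cbox a b) (\<lambda>y. \<bar>f (x + y) - f x\<bar>) / measure lborel (cbox a b)" for x
  proof -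
    have i: "(\<lambda>y. f (x + y)) integrable_on cbox a b" by (rule integrable_on_cbox_translate[OF cf])
    have "((\<lambda>y. f (x + y) - f x) has_integral (integral (cbox a b) (\<lambda>y. f (x + y)) - measure lborel (cbox a b) *\<^sub>R f x)) (cbox a b)"
      by (intro has_integral_diff has_integral_const integrable_integral i)
    then have eq: "box_average a b f x - f x = integral (cbox a b) (\<lambda>y. f (x + y) - f x) / measure lborel (cbox a b)"
      using c by (simp add: integral_unique box_average_def field_simps)
    have "norm (integral (cbox a b) (\<lambda>y. f (x + y) - f x)) \<le> integral (cbox a b) (\<lambda>y. \<bar>f (x + y) - f x\<bar>)"
      by (rule Henstock_Kurzweil_Integration.integral_norm_bound_integral)
        (auto intro!: integrable_continuous continuous_intros continuous_on_compose2[OF cf])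
    then show ?thesis unfolding eq using c by (simp add: divide_right_mono)
  qed
  have "(\<integral>\<^sup>+x. ennreal (\<bar>box_average a b f x - f x\<bar> powr p) \<partial>lborel)
      \<le> (\<integral>\<^sup>+x. ennreal ((integral (cbox a b) (\<lambda>y. \<bar>f (x + y) - f x\<bar>) / measure lborel (cbox a b)) powr p) \<partial>lborel)"
    using p by (intro nn_integral_mono ennreal_leI powr_mono2 le) auto
  also have "\<dots> \<le> ennreal (r powr p) * energy p f"
  proof (rule nn_integral_average_powr_le[OF p _ _ c])
    show "continuous_on UNIV (\<lambda>z. \<bar>f (fst z + snd z) - f (fst z)\<bar>)"
      by (intro continuous_intros continuous_on_compose2[OF cf]) auto
    show "(\<integral>\<^sup>+x. ennreal (\<bar>f (x + y) - f x\<bar> powr p) \<partial>lborel) \<le> ennreal (r powr p) * energy p f"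
      if "y \<in> cbox a b" for y
      by (rule nn_integral_difference_le[OF p f r[OF that]])
  qed simp
  finally show ?thesis .
qed

section \<open>From almost everywhere to quasieverywhere\<close>

lemma powr_add3_le:
  fixes a b c p :: real
  assumes "0 \<le> a" "0 \<le> b" "0 \<le> c" "0 \<le> p"
  shows "(a + b + c) powr p \<le> 4 powr p * (a powr p + b powr p + c powr p)"
proof -
  have "(a + b + c) powr p \<le> (4 * max a (max b c)) powr p" using assms by (intro powr_mono2) auto
  also have "\<dots> = 4 powr p * max a (max b c) powr p" using assms by (simp add: powr_mult)
  also have "max a (max b c) powr p \<le> a powr p + b powr p + c powr p" by (simp add: max_def)
  finally show ?thesis by simp
qed

lemma cap_compact_le_energy:
  assumes "test_fun \<Omega> w" "\<And>x. x \<in> K \<Longrightarrow> 1 \<le> w x"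
  shows "cap_compact p K \<Omega> \<le> energy p w"
proof -
  have "cap_compact p K \<Omega> \<le> (\<integral>\<^sup>+x. ennreal (norm (grad w x) powr p) \<partial>lebesgue)"
    unfolding cap_compact_def using assms by (intro INF_lower) auto
  then show ?thesis by (simp add: nn_integral_completion energy_def)
qed

text \<open>The admissible function is made nonnegative by composing it with the flat function.\<close>

lemma nonneg_capacity_test_fun:
  assumes p: "0 < p" and G: "cap p G \<Omega> < ennreal \<epsilon>" and K: "compact K" "K \<subseteq> G"
  obtains w where "test_fun \<Omega> w" "\<forall>x. 0 \<le> w x" "\<forall>x\<in>K. 1 \<le> w x"
    "energy p w \<le> ennreal ((2 * exp 1) powr p) * ennreal \<epsilon>"
proof -
  obtain U where U: "G \<subseteq> U" "(SUP K \<in> {K. compact K \<and> K \<subseteq> U}. cap_compact p K \<Omega>) < ennreal \<epsilon>"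
    using G unfolding cap_def by (auto simp: INF_less_iff)
  have "cap_compact p K \<Omega> \<le> (SUP K \<in> {K. compact K \<and> K \<subseteq> U}. cap_compact p K \<Omega>)"
    using K U by (intro SUP_upper) auto
  then have "cap_compact p K \<Omega> < ennreal \<epsilon>" using U(2) by (rule le_less_trans)
  then obtain w where w: "test_fun \<Omega> w" "\<And>x. x \<in> K \<Longrightarrow> 1 \<le> w x"
    "(\<integral>\<^sup>+x. ennreal (norm (grad w x) powr p) \<partial>lebesgue) < ennreal \<epsilon>"
    unfolding cap_compact_def by (auto simp: INF_less_iff)
  then have we: "energy p w \<le> ennreal \<epsilon>" by (simp add: nn_integral_completion energy_def less_imp_le)
  have smw: "smooth w" by (rule test_fun_smooth[OF w(1)])
  \<comment> \<open>The factor \<open>exp 1\<close> normalizes F to the value 1 at 1, so that by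
    monotonicity F is at least 1 wherever \<open>w\<close> is.\<close>
  define F where "F = (\<lambda>t. exp 1 * flat 0 t)"
  have smF: "smooth F" unfolding F_def by (intro smooth_cmult smooth_flat)
  have pF: "partial 1 F t = exp 1 * flat 2 t" for t
    unfolding F_def
    by (subst partial_mult[OF smooth_differentiable[OF smooth_const] smooth_differentiable[OF smooth_flat]])
      (simp add: partial_flat partial_eqI[OF has_derivative_const] numeral_2_eq_2)
  have gF: "norm (grad (\<lambda>x. F (w x)) x) \<le> (2 * exp 1) * norm (grad w x)" for x
  proof -
    have "norm (grad (\<lambda>x. F (w x)) x) = (exp 1 * flat 2 (w x)) * norm (grad w x)"
      by (simp add: grad_compose[OF smF smw] pF)
    also have "\<dots> \<le> (2 * exp 1) * norm (grad w x)"
      using flat_2_le_2[of "w x"] by (intro mult_right_mono) auto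
    finally show ?thesis .
  qed
  have [measurable]: "grad w \<in> borel_measurable borel" by (rule borel_measurable_grad[OF smw])
  show ?thesis
  proof (rule that)
    show "test_fun \<Omega> (\<lambda>x. F (w x))" by (rule test_fun_compose[OF smF _ w(1)]) (simp add: F_def)
    show "\<forall>x. 0 \<le> F (w x)" by (simp add: F_def)
    show "\<forall>x\<in>K. 1 \<le> F (w x)"
    proof
      fix x assume "x \<in> K"
      have "1 = exp 1 * flat 0 1" by (simp add: flat_def exp_minus)
      also have "\<dots> \<le> F (w x)" unfolding F_def using w(2)[OF \<open>x \<in> K\<close>] by (intro mult_left_mono flat_0_mono) auto
      finally show "1 \<le> F (w x)" .
    qed
    have "energy p (\<lambda>x. F (w x)) \<le> (\<integral>\<^sup>+x. ennreal ((2 * exp 1) powr p) * ennreal (norm (grad w x) powr p) \<partial>lborel)"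
      unfolding energy_def
    proof (rule nn_integral_mono)
      fix x
      have "norm (grad (\<lambda>x. F (w x)) x) powr p \<le> ((2 * exp 1) * norm (grad w x)) powr p"
        using p by (intro powr_mono2 gF) auto
      then show "ennreal (norm (grad (\<lambda>x. F (w x)) x) powr p) \<le> ennreal ((2 * exp 1) powr p) * ennreal (norm (grad w x) powr p)"
        by (simp add: powr_mult ennreal_mult'[symmetric] ennreal_leI)
    qed
    also have "\<dots> = ennreal ((2 * exp 1) powr p) * energy p w"
      unfolding energy_def by (rule nn_integral_cmult) measurable
    also have "\<dots> \<le> ennreal ((2 * exp 1) powr p) * ennreal \<epsilon>" using we by (rule mult_left_mono) simp
    finally show "energy p (\<lambda>x. F (w x)) \<le> ennreal ((2 * exp 1) powr p) * ennreal \<epsilon>" .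
  qed
qed

lemma energy_add_le:
  assumes p: "0 \<le> p" and f: "smooth f" and g: "smooth g"
  shows "energy p (\<lambda>x. f x + g x) \<le> ennreal (2 powr p) * (energy p f + energy p g)"
proof -
  have [measurable]: "grad f \<in> borel_measurable borel" "grad g \<in> borel_measurable borel"
    using f g by (auto intro: borel_measurable_grad)
  have "energy p (\<lambda>x. f x + g x)
    \<le> (\<integral>\<^sup>+x. ennreal (2 powr p) * (ennreal (norm (grad f x) powr p) + ennreal (norm (grad g x) powr p)) \<partial>lborel)"
    unfolding energy_def
  proof (rule nn_integral_mono)
    fix x
    have "norm (grad (\<lambda>x. f x + g x) x) powr p \<le> (norm (grad f x) + norm (grad g x)) powr p"
      unfolding grad_add[OF f g] using p by (intro powr_mono2 norm_triangle_ineq) auto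
    also have "\<dots> \<le> 2 powr p * (norm (grad f x) powr p + norm (grad g x) powr p)"
      using p by (intro powr_add_le) auto
    finally show "ennreal (norm (grad (\<lambda>x. f x + g x) x) powr p)
        \<le> ennreal (2 powr p) * (ennreal (norm (grad f x) powr p) + ennreal (norm (grad g x) powr p))"
      by (simp add: ennreal_plus[symmetric] ennreal_mult'[symmetric] ennreal_leI del: ennreal_plus)
  qed
  also have "\<dots> = ennreal (2 powr p) * (energy p f + energy p g)"
    unfolding energy_def by (subst nn_integral_cmult, measurable) (subst nn_integral_add, auto)
  finally show ?thesis .
qed

text \<open>Replacing \<open>w\<close> near \<open>K\<close> by its box average costs only a constant factor in the energy, provided
  that the size of the box is small compared with the slope of the cutoff \<open>\<theta>\<close>.\<close>

lemma energy_localized_average_le: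
  assumes p: "1 \<le> p" and w: "smooth w" and \<theta>: "smooth \<theta>" "\<And>x. 0 \<le> \<theta> x" "\<And>x. \<theta> x \<le> 1"
    and C: "\<And>x. norm (grad \<theta> x) \<le> C" and c: "0 < measure lborel (cbox a b)"
    and r: "\<And>y. y \<in> cbox a b \<Longrightarrow> norm y \<le> r" "C * r \<le> 1"
  shows "energy p (\<lambda>x. 2 * (w x + (box_average a b w x - w x) * \<theta> x)) \<le> ennreal (3 * 8 powr p) * energy p w"
proof -
  define A where "A = box_average a b w"
  have smA: "smooth A" unfolding A_def by (rule smooth_box_average[OF w])
  have smD: "smooth (\<lambda>x. A x - w x)" by (rule smooth_minus[OF smA w])
  have smM: "smooth (\<lambda>x. (A x - w x) * \<theta> x)" by (rule smooth_mult[OF smD \<theta>(1)])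
  have "a \<in> cbox a b" using c by (metis content_empty less_irrefl box_ne_empty(1) mem_box(2) order_refl)
  then have r0: "0 \<le> r" using r(1) norm_ge_zero order_trans by blast
  have C0: "0 \<le> C" using C norm_ge_zero order_trans by blast
  have [measurable]: "grad w \<in> borel_measurable borel" "grad A \<in> borel_measurable borel"
    "w \<in> borel_measurable borel" "A \<in> borel_measurable borel"
    using w smA by (auto intro: borel_measurable_grad borel_measurable_smooth)
  \<comment> \<open>Apart from the factor 2, the function interpolates between \<open>w\<close> and
    its average \<open>A\<close> with weight \<theta>. Its gradient is the same interpolation of the
    two gradients plus an error carried by the gradient of \<theta>.\<close>
  have g: "grad (\<lambda>x. 2 * (w x + (A x - w x) * \<theta> x)) x
      = 2 *\<^sub>R ((1 - \<theta> x) *\<^sub>R grad w x + \<theta> x *\<^sub>R grad A x + (A x - w x) *\<^sub>R grad \<theta> x)" for x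
    by (simp only: grad_cmult[OF smooth_add[OF w smM]] grad_add[OF w smM] grad_mult[OF smD \<theta>(1)] grad_minus[OF smA w])
      (simp add: algebra_simps)
  have gle: "norm (grad (\<lambda>x. 2 * (w x + (A x - w x) * \<theta> x)) x)
      \<le> 2 * (norm (grad w x) + norm (grad A x) + C * \<bar>A x - w x\<bar>)" for x
  proof -
    have "norm ((1 - \<theta> x) *\<^sub>R grad w x) \<le> 1 * norm (grad w x)"
      unfolding norm_scaleR using \<theta>(2,3)[of x] by (intro mult_right_mono) auto
    moreover have "norm (\<theta> x *\<^sub>R grad A x) \<le> 1 * norm (grad A x)"
      unfolding norm_scaleR using \<theta>(2,3)[of x] by (intro mult_right_mono) auto
    moreover have "norm ((A x - w x) *\<^sub>R grad \<theta> x) \<le> \<bar>A x - w x\<bar> * C"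
      unfolding norm_scaleR using C by (intro mult_left_mono) auto
    ultimately have "norm ((1 - \<theta> x) *\<^sub>R grad w x + \<theta> x *\<^sub>R grad A x + (A x - w x) *\<^sub>R grad \<theta> x)
        \<le> norm (grad w x) + norm (grad A x) + C * \<bar>A x - w x\<bar>"
      by (intro norm_triangle_le add_mono) (auto simp: mult.commute)
    then show ?thesis unfolding g norm_scaleR by simp
  qed
  \<comment> \<open>The constant 8 is the outer factor 2 times the 4 that arises from splitting the
    p-th power of a sum of three terms.\<close>
  have "energy p (\<lambda>x. 2 * (w x + (A x - w x) * \<theta> x))
    \<le> (\<integral>\<^sup>+x. ennreal (8 powr p) * (ennreal (norm (grad w x) powr p) + ennreal (norm (grad A x) powr p)
        + ennreal (C powr p) * ennreal (\<bar>A x - w x\<bar> powr p)) \<partial>lborel)"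
    unfolding energy_def
  proof (rule nn_integral_mono)
    fix x
    have "norm (grad (\<lambda>x. 2 * (w x + (A x - w x) * \<theta> x)) x) powr p
        \<le> (2 * (norm (grad w x) + norm (grad A x) + C * \<bar>A x - w x\<bar>)) powr p"
      using p gle by (intro powr_mono2) auto
    also have "\<dots> = 2 powr p * (norm (grad w x) + norm (grad A x) + C * \<bar>A x - w x\<bar>) powr p"
      by (rule powr_mult)
    also have "\<dots> \<le> 2 powr p * (4 powr p * (norm (grad w x) powr p + norm (grad A x) powr p + (C * \<bar>A x - w x\<bar>) powr p))"
      using p C0 by (intro mult_left_mono powr_add3_le) auto
    also have "\<dots> = 8 powr p * (norm (grad w x) powr p + norm (grad A x) powr p + C powr p * \<bar>A x - w x\<bar> powr p)"
      using powr_mult[of 2 4 p] C0 by (simp add: powr_mult)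
    finally have "norm (grad (\<lambda>x. 2 * (w x + (A x - w x) * \<theta> x)) x) powr p
        \<le> 8 powr p * (norm (grad w x) powr p + norm (grad A x) powr p + C powr p * \<bar>A x - w x\<bar> powr p)" .
    then have "ennreal (norm (grad (\<lambda>x. 2 * (w x + (A x - w x) * \<theta> x)) x) powr p)
        \<le> ennreal (8 powr p * (norm (grad w x) powr p + norm (grad A x) powr p + C powr p * \<bar>A x - w x\<bar> powr p))"
      by (rule ennreal_leI)
    also have "\<dots> = ennreal (8 powr p) * (ennreal (norm (grad w x) powr p) + ennreal (norm (grad A x) powr p)
        + ennreal (C powr p) * ennreal (\<bar>A x - w x\<bar> powr p))"
      by (simp add: ennreal_plus ennreal_mult')
    finally show "ennreal (norm (grad (\<lambda>x. 2 * (w x + (A x - w x) * \<theta> x)) x) powr p)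
        \<le> ennreal (8 powr p) * (ennreal (norm (grad w x) powr p) + ennreal (norm (grad A x) powr p)
        + ennreal (C powr p) * ennreal (\<bar>A x - w x\<bar> powr p))" .
  qed
  also have "\<dots> = ennreal (8 powr p) * (energy p w + energy p A
      + ennreal (C powr p) * (\<integral>\<^sup>+x. ennreal (\<bar>A x - w x\<bar> powr p) \<partial>lborel))"
    unfolding energy_def by (simp add: nn_integral_cmult nn_integral_add)
  also have "\<dots> \<le> ennreal (8 powr p) * (energy p w + energy p w + energy p w)"
  proof (intro mult_left_mono add_mono order_refl)
    show "energy p A \<le> energy p w" unfolding A_def by (rule energy_box_average_le[OF p w c])
    \<comment> \<open>The deviation of \<open>A\<close> from \<open>w\<close> gains a factor
      \<open>r\<close>, which compensates the slope \<open>C\<close> of the cutoff because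
      \<open>C * r \<le> 1\<close>. Each of the three terms thus costs one copy of the energy of
      \<open>w\<close>.\<close>
    have "ennreal (C powr p) * (\<integral>\<^sup>+x. ennreal (\<bar>A x - w x\<bar> powr p) \<partial>lborel)
        \<le> ennreal (C powr p) * (ennreal (r powr p) * energy p w)"
      unfolding A_def by (intro mult_left_mono box_average_diff_le p w c r) auto
    also have "\<dots> = ennreal ((C * r) powr p) * energy p w"
      using C0 r0 by (simp add: powr_mult ennreal_mult' mult.assoc)
    also have "\<dots> \<le> ennreal 1 * energy p w"
      using C0 r0 r(2) p by (intro mult_right_mono ennreal_leI powr_le1) auto
    finally show "ennreal (C powr p) * (\<integral>\<^sup>+x. ennreal (\<bar>A x - w x\<bar> powr p) \<partial>lborel) \<le> energy p w" by simp
  qed simp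
  also have "\<dots> = ennreal (3 * 8 powr p) * energy p w"
  proof -
    have "energy p w + energy p w + energy p w = ennreal 3 * energy p w"
    proof -
      have "ennreal 3 = 1 + 1 + 1" by simp
      then show ?thesis by (simp only: distrib_right mult_1)
    qed
    then show ?thesis by (simp add: ennreal_mult' mult_ac)
  qed
  finally show ?thesis unfolding A_def .
qed

lemma compact_inner_approx:
  fixes G :: "'a::euclidean_space set"
  assumes "open G" "bounded G" "0 < e"
  obtains K where "compact K" "K \<subseteq> G" "measure lebesgue (G - K) < e"
proof -
  have "G \<in> sets lebesgue" using assms(1) by simp
  then obtain T where T: "closed T" "T \<subseteq> G" "G - T \<in> lmeasurable" "emeasure lebesgue (G - T) < ennreal e"
    by (rule sets_lebesgue_inner_closed[OF _ assms(3)])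
  have "compact T" using T(1,2) assms(2) bounded_subset by (auto simp: compact_eq_bounded_closed)
  moreover have "measure lebesgue (G - T) < e"
    using T(3,4) assms(3) by (simp add: emeasure_eq_measure2 ennreal_less_iff)
  ultimately show ?thesis using that T(2) by blast
qed

text \<open>The box around \<open>x\<close> stays in \<open>U\<close>, and \<open>U - K\<close> is
  too small to fill more than half of it. So \<open>w\<close> is at least 1 on at least half of the
  box and nonnegative on the rest.\<close>

lemma box_average_ge_half:
  fixes w :: "'a::euclidean_space \<Rightarrow> real"
  assumes w: "continuous_on UNIV w" "\<And>z. 0 \<le> w z" "\<And>z. z \<in> K \<Longrightarrow> 1 \<le> w z"
    and K: "compact K" and U: "\<And>y. y \<in> cbox a b \<Longrightarrow> x + y \<in> U"
    and m: "U - K \<in> lmeasurable" "measure lebesgue (U - K) \<le> measure lborel (cbox a b) / 2"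
    and c: "0 < measure lborel (cbox a b)"
  shows "1 / 2 \<le> box_average a b w x"
proof -
  define Q where "Q = cbox a b"
  define S where "S = Q \<inter> (\<lambda>z. z - x) ` K"
  have cS: "compact S" unfolding S_def Q_def
    by (intro compact_Int compact_cbox compact_continuous_image K continuous_intros)
  have Sm: "S \<in> lmeasurable" using cS by (rule lmeasurable_compact)
  have wx: "continuous_on UNIV (\<lambda>y. w (x + y))"
    by (intro continuous_on_compose2[OF w(1)] continuous_intros) auto
  have wS: "(\<lambda>y. w (x + y)) integrable_on S"
  proof (rule set_borel_integral_eq_integral(1))
    show "set_integrable lborel S (\<lambda>y. w (x + y))"
      unfolding set_integrable_def by (rule borel_integrable_compact[OF cS continuous_on_subset[OF wx]]) simp
  qed
  have "Q \<subseteq> S \<union> (+) (- x) ` (U - K)"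
  proof
    fix y assume y: "y \<in> Q"
    show "y \<in> S \<union> (+) (- x) ` (U - K)"
    proof (cases "x + y \<in> K")
      case True
      then show ?thesis using y by (auto simp: S_def intro!: image_eqI[of _ _ "x + y"])
    next
      case False
      then have "x + y \<in> U - K" using U y by (simp add: Q_def)
      then have "- x + (x + y) \<in> (+) (- x) ` (U - K)" by (rule imageI)
      then show ?thesis by simp
    qed
  qed
  moreover have tm: "(+) (- x) ` (U - K) \<in> lmeasurable" using m(1) by (rule measurable_translation)
  ultimately have "measure lebesgue Q \<le> measure lebesgue (S \<union> (+) (- x) ` (U - K))"
    by (intro measure_mono_fmeasurable fmeasurable.Un Sm) (auto simp: Q_def)
  also have "\<dots> \<le> measure lebesgue S + measure lebesgue ((+) (- x) ` (U - K))"
    by (rule measure_Un_le) (use Sm tm in auto)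
  also have "measure lebesgue ((+) (- x) ` (U - K)) = measure lebesgue (U - K)" by (rule measure_translation)
  finally have "measure lborel Q / 2 \<le> measure lebesgue S" using m(2) by (simp add: Q_def)
  also have "\<dots> = integral S (\<lambda>y. 1)" by (rule lmeasure_integral[OF Sm])
  also have "\<dots> \<le> integral S (\<lambda>y. w (x + y))"
    by (rule integral_le) (use Sm wS w(3) in \<open>auto simp: S_def lmeasurable_iff_integrable_on\<close>)
  also have "\<dots> \<le> integral Q (\<lambda>y. w (x + y))"
    by (rule integral_subset_le[OF _ wS])
      (use w(2) in \<open>auto simp: S_def Q_def intro!: integrable_continuous continuous_on_subset[OF wx]\<close>)
  finally show ?thesis using c by (simp add: box_average_def Q_def field_simps)
qed

text \<open>The box is fixed by \<open>K\<close> and its cutoff; only then are compact parts of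
  \<open>G1\<close> and \<open>G2\<close> chosen, with remainders small relative to that box. The
  resulting constant does not depend on \<open>K\<close>. Adding test functions for the two parts
  plays the role of subadditivity of the capacity.\<close>

lemma cap_compact_le_of_null_difference:
  fixes \<Omega> :: "'a::euclidean_space set"
  assumes p: "1 \<le> p" and \<Omega>: "open \<Omega>" "bounded \<Omega>" and U: "open U" "U \<subseteq> \<Omega>"
    and G1: "open G1" "cap p G1 \<Omega> < ennreal \<epsilon>" "G1 \<subseteq> U"
    and G2: "open G2" "cap p G2 \<Omega> < ennreal \<epsilon>" "G2 \<subseteq> U"
    and null: "U - (G1 \<union> G2) \<in> null_sets lebesgue"
    and K: "compact K" "K \<subseteq> U"
  shows "cap_compact p K \<Omega> \<le> ennreal (6 * (32 * exp 1) powr p) * ennreal \<epsilon>"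
proof -
  have bU: "bounded U" using \<Omega>(2) U(2) by (rule bounded_subset)
  obtain \<theta> W where \<theta>: "test_fun \<Omega> \<theta>" "\<And>x. 0 \<le> \<theta> x" "\<And>x. \<theta> x \<le> 1" "K \<subseteq> W" "\<And>x. x \<in> W \<Longrightarrow> \<theta> x = 1"
    using smooth_urysohn[OF K(1) \<Omega>(1)] K U by (metis subset_trans)
  obtain C where C: "C > 0" "\<And>x. norm (grad \<theta> x) \<le> C" using test_fun_bounded[OF \<theta>(1)] by metis
  obtain r1 where r1: "r1 > 0" "(\<Union>x\<in>K. cball x r1) \<subseteq> U"
    using compact_subset_open_imp_cball_epsilon_subset[OF K(1) U(1) K(2)] by metis
  \<comment> \<open>The bound \<open>r1\<close> keeps boxes around points of \<open>K\<close> inside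
    \<open>U\<close>; the bound 1/C makes the cutoff error absorbable.\<close>
  define r where "r = min r1 (1 / C)"
  have r: "r > 0" "r \<le> r1" "C * r \<le> 1" using r1 C by (auto simp: r_def min_def field_simps)
  \<comment> \<open>Half-edges of length \<open>r / DIM('a)\<close> give sum norm, hence Euclidean
    norm, at most \<open>r\<close> on the box.\<close>
  define b :: 'a where "b = (r / DIM('a)) *\<^sub>R One"
  have bi: "b \<bullet> i = r / DIM('a)" if "i \<in> Basis" for i using that by (simp add: b_def)
  have c: "0 < measure lborel (cbox (- b) b)"
    using r by (intro content_pos_lt) (auto simp: bi)
  have yr: "norm y \<le> r" if "y \<in> cbox (- b) b" for y
  proof -
    have "norm y \<le> (\<Sum>i\<in>Basis. \<bar>y \<bullet> i\<bar>)" by (rule norm_le_l1)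
    also have "\<dots> \<le> (\<Sum>i\<in>(Basis::'a set). r / DIM('a))"
      using that by (intro sum_mono) (auto simp: mem_box bi abs_le_iff minus_le_iff)
    also have "\<dots> = r" by simp
    finally show ?thesis .
  qed
  \<comment> \<open>A quarter of the box volume is allowed to be lost in each of the two open sets,
    half of it altogether.\<close>
  define c4 where "c4 = measure lborel (cbox (- b) b) / 4"
  have c4: "c4 > 0" using c by (simp add: c4_def)
  obtain K1 where K1: "compact K1" "K1 \<subseteq> G1" "measure lebesgue (G1 - K1) < c4"
    using compact_inner_approx[OF G1(1) bounded_subset[OF bU G1(3)] c4] by metis
  obtain K2 where K2: "compact K2" "K2 \<subseteq> G2" "measure lebesgue (G2 - K2) < c4"
    using compact_inner_approx[OF G2(1) bounded_subset[OF bU G2(3)] c4] by metis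
  have p0: "0 < p" "0 \<le> p" using p by auto
  obtain w1 where w1: "test_fun \<Omega> w1" "\<forall>x. 0 \<le> w1 x" "\<forall>x\<in>K1. 1 \<le> w1 x"
    "energy p w1 \<le> ennreal ((2 * exp 1) powr p) * ennreal \<epsilon>"
    by (rule nonneg_capacity_test_fun[OF p0(1) G1(2) K1(1,2)])
  obtain w2 where w2: "test_fun \<Omega> w2" "\<forall>x. 0 \<le> w2 x" "\<forall>x\<in>K2. 1 \<le> w2 x"
    "energy p w2 \<le> ennreal ((2 * exp 1) powr p) * ennreal \<epsilon>"
    by (rule nonneg_capacity_test_fun[OF p0(1) G2(2) K2(1,2)])
  define w where "w = (\<lambda>x. w1 x + w2 x)"
  have w: "test_fun \<Omega> w" unfolding w_def by (rule test_fun_add[OF w1(1) w2(1)])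
  have smw: "smooth w" by (rule test_fun_smooth[OF w])
  have w0: "0 \<le> w x" for x using w1(2) w2(2) by (simp add: w_def)
  have w1K: "1 \<le> w x" if "x \<in> K1 \<union> K2" for x
    using that w1(2,3) w2(2,3) unfolding w_def by (metis UnE add_increasing add_increasing2)
  have Um: "G1 - K1 \<in> lmeasurable" "G2 - K2 \<in> lmeasurable" "U - (K1 \<union> K2) \<in> lmeasurable"
    using G1 G2 U K1 K2 bU bounded_subset
    by (auto intro!: bounded_set_imp_lmeasurable sets.Diff sets.Un intro: bounded_subset[OF bU] dest: compact_imp_closed)
  have mU: "measure lebesgue (U - (K1 \<union> K2)) \<le> measure lborel (cbox (- b) b) / 2"
  proof -
    have nm: "U - (G1 \<union> G2) \<in> lmeasurable" "measure lebesgue (U - (G1 \<union> G2)) = 0"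
      using null by (auto simp: null_sets_def measure_def intro: fmeasurableI_null_sets null)
    have "measure lebesgue (U - (K1 \<union> K2)) \<le> measure lebesgue ((U - (G1 \<union> G2)) \<union> ((G1 - K1) \<union> (G2 - K2)))"
      using Um nm by (intro measure_mono_fmeasurable fmeasurable.Un) (auto dest: fmeasurableD)
    also have "\<dots> \<le> measure lebesgue (U - (G1 \<union> G2)) + measure lebesgue ((G1 - K1) \<union> (G2 - K2))"
      using Um nm by (intro measure_Un_le) (auto dest: fmeasurableD)
    also have "measure lebesgue ((G1 - K1) \<union> (G2 - K2)) \<le> measure lebesgue (G1 - K1) + measure lebesgue (G2 - K2)"
      using Um by (intro measure_Un_le) (auto dest: fmeasurableD)
    finally show ?thesis using nm K1(3) K2(3) by (simp add: c4_def)
  qed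
  \<comment> \<open>On \<open>K\<close> this is twice the box average, hence at least 1. Elsewhere
    it combines the test functions \<open>w\<close> and \<theta>, so its support stays compact in
    \<Omega>.\<close>
  define f where "f = (\<lambda>x. 2 * (w x + (box_average (- b) b w x - w x) * \<theta> x))"
  have "test_fun \<Omega> (\<lambda>x. \<theta> x * (box_average (- b) b w x - w x))"
    by (rule test_fun_mult[OF \<theta>(1) smooth_minus[OF smooth_box_average[OF smw] smw]])
  then have "test_fun \<Omega> f"
    unfolding f_def by (intro test_fun_cmult test_fun_add[OF w]) (simp add: mult.commute)
  moreover have "1 \<le> f x" if x: "x \<in> K" for x
  proof -
    have "1 / 2 \<le> box_average (- b) b w x"
    proof (rule box_average_ge_half[OF smooth_continuous[OF smw] w0 w1K _ _ Um(3) mU c])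
      show "compact (K1 \<union> K2)" using K1 K2 by (intro compact_Un)
      show "x + y \<in> U" if "y \<in> cbox (- b) b" for y
      proof -
        have "x + y \<in> cball x r1" using yr[OF that] r by (simp add: dist_norm)
        then show ?thesis using r1(2) x by blast
      qed
    qed
    moreover have "\<theta> x = 1" using \<theta>(4,5) x by blast
    ultimately show ?thesis by (simp add: f_def)
  qed
  ultimately have "cap_compact p K \<Omega> \<le> energy p f" by (rule cap_compact_le_energy)
  also have "\<dots> \<le> ennreal (3 * 8 powr p) * energy p w"
    unfolding f_def
    by (rule energy_localized_average_le[OF p smw test_fun_smooth[OF \<theta>(1)] \<theta>(2,3) C(2) c yr r(3)])
  also have "\<dots> \<le> ennreal (3 * 8 powr p) * (ennreal (2 powr p) * (energy p w1 + energy p w2))"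
    unfolding w_def by (intro mult_left_mono energy_add_le p0 test_fun_smooth[OF w1(1)] test_fun_smooth[OF w2(1)]) simp
  also have "\<dots> \<le> ennreal (3 * 8 powr p) * (ennreal (2 powr p) *
      (ennreal ((2 * exp 1) powr p) * ennreal \<epsilon> + ennreal ((2 * exp 1) powr p) * ennreal \<epsilon>))"
    by (intro mult_left_mono add_mono w1 w2) auto
  also have "\<dots> = ennreal (3 * 8 powr p) * (ennreal (2 powr p) * (ennreal 2 * (ennreal ((2 * exp 1) powr p) * ennreal \<epsilon>)))"
    by (simp only: ennreal_numeral mult_2)
  also have "\<dots> = ennreal (3 * 8 powr p * (2 powr p * (2 * (2 * exp 1) powr p))) * ennreal \<epsilon>"
    by (simp add: ennreal_mult' mult_ac)
  \<comment> \<open>The factors stem from localized averaging, from adding \<open>w1\<close> and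
    \<open>w2\<close>, and from the two energies.\<close>
  also have "3 * 8 powr p * (2 powr p * (2 * (2 * exp 1) powr p)) = 6 * (32 * exp 1) powr p"
    by (simp add: powr_mult[symmetric] mult_ac)
  finally show ?thesis .
qed

text \<open>A general open \<open>D\<close> covers both conclusions of the theorem: the half-plane
  below the diagonal gives the inequality, and the complement of the diagonal gives equality with a
  single exceptional set.\<close>

lemma quasicont_AE_imp_qe:
  fixes \<Omega> :: "'a::euclidean_space set" and D :: "(real \<times> real) set"
  assumes p: "1 \<le> p" and \<Omega>: "open \<Omega>" "bounded \<Omega>" and u: "quasicont p \<Omega> u" and v: "quasicont p \<Omega> v"
    and D: "open D" and AE: "AE x in lebesgue. x \<in> \<Omega> \<longrightarrow> (u x, v x) \<notin> D"
  shows "qe p \<Omega> (\<lambda>x. (u x, v x) \<notin> D)"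
proof -
  define E where "E = {x \<in> \<Omega>. (u x, v x) \<in> D}"
  have bound: "cap p E \<Omega> \<le> ennreal (6 * (32 * exp 1) powr p) * ennreal \<epsilon>" if "\<epsilon> > 0" for \<epsilon>
  proof -
    obtain G1 where G1: "open G1" "G1 \<subseteq> \<Omega>" "cap p G1 \<Omega> < ennreal \<epsilon>" "continuous_on (\<Omega> - G1) u"
      using u \<open>\<epsilon> > 0\<close> unfolding quasicont_def by blast
    obtain G2 where G2: "open G2" "G2 \<subseteq> \<Omega>" "cap p G2 \<Omega> < ennreal \<epsilon>" "continuous_on (\<Omega> - G2) v"
      using v \<open>\<epsilon> > 0\<close> unfolding quasicont_def by blast
    define U where "U = E \<union> (G1 \<union> G2)"
    have "continuous_on (\<Omega> - (G1 \<union> G2)) (\<lambda>x. (u x, v x))"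
      by (intro continuous_on_Pair continuous_on_subset[OF G1(4)] continuous_on_subset[OF G2(4)]) auto
    then obtain T where T: "open T" "T \<inter> (\<Omega> - (G1 \<union> G2)) = (\<lambda>x. (u x, v x)) -` D \<inter> (\<Omega> - (G1 \<union> G2))"
      using D unfolding continuous_on_open_invariant by blast
    \<comment> \<open>\<open>E\<close> itself need not be open. It is relatively open off
      \<open>G1\<close> and \<open>G2\<close>, and adjoining these sets makes it an open competitor
      in the definition of \<open>cap\<close>.\<close>
    have "U = (T \<inter> \<Omega>) \<union> (G1 \<union> G2)"
      using T(2) G1(2) G2(2) unfolding U_def E_def by auto
    then have U: "open U" using T(1) \<Omega>(1) G1(1) G2(1) by auto
    have U\<Omega>: "U \<subseteq> \<Omega>" using G1 G2 by (auto simp: U_def E_def)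
    have null: "U - (G1 \<union> G2) \<in> null_sets lebesgue"
    proof -
      have "AE x in lebesgue. x \<notin> U - (G1 \<union> G2)"
        using AE by eventually_elim (auto simp: U_def E_def)
      moreover have "U - (G1 \<union> G2) \<in> sets lebesgue" using U G1(1) G2(1) by auto
      ultimately show ?thesis using AE_iff_null_sets by blast
    qed
    have "cap p E \<Omega> \<le> (SUP K \<in> {K. compact K \<and> K \<subseteq> U}. cap_compact p K \<Omega>)"
      unfolding cap_def using U U\<Omega> by (intro INF_lower) (auto simp: U_def)
    also have "\<dots> \<le> ennreal (6 * (32 * exp 1) powr p) * ennreal \<epsilon>"
    proof (rule SUP_least)
      fix K assume "K \<in> {K. compact K \<and> K \<subseteq> U}"
      then show "cap_compact p K \<Omega> \<le> ennreal (6 * (32 * exp 1) powr p) * ennreal \<epsilon>"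
        by (intro cap_compact_le_of_null_difference[OF p \<Omega> U U\<Omega> G1(1,3) _ G2(1,3) _ null])
          (auto simp: U_def)
    qed
    finally show ?thesis .
  qed
  have "cap p E \<Omega> \<le> 0 + ennreal e" if "e > 0" for e
  proof -
    define N :: real where "N = 6 * (32 * exp 1) powr p"
    have N: "N > 0" by (simp add: N_def)
    have "cap p E \<Omega> \<le> ennreal N * ennreal (e / N)"
      unfolding N_def by (rule bound) (use that in simp)
    also have "\<dots> = ennreal e" using N that by (simp add: ennreal_mult'[symmetric])
    finally show ?thesis by simp
  qed
  then have "cap p E \<Omega> \<le> 0" by (rule ennreal_le_epsilon)
  then show ?thesis unfolding qe_def by (intro exI[of _ E]) (auto simp: E_def)
qed

section \<open>The comparison principle quasieverywhere\<close>

theorem theorem4p2: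
  fixes \<Omega> \<Gamma> :: "'a::euclidean_space set"
    and \<A> :: "'a \<Rightarrow> 'a \<Rightarrow> 'a"
    and \<nu>p \<nu>m :: "'a measure"
    and p L \<beta> :: real
    and u v :: "'a \<Rightarrow> real"
  assumes "DIM('a) \<ge> 2"
    and "1 < p" and "p \<le> real DIM('a)"
    and "open \<Omega>" and "bounded \<Omega>"
    and "closed \<Gamma>" and "\<Gamma> \<subseteq> frontier \<Omega>"
    and "1 \<le> L" and "structure_cond \<Omega> p L \<A>"
    and "radon_on \<Omega> \<nu>p" and "radon_on \<Omega> \<nu>m"
    and "0 < \<beta>" and "\<beta> \<le> 1"
    and "W1p_cGamma \<Omega> \<Gamma> p u" and "Linf_Gamma_beta \<Omega> \<Gamma> \<beta> u"
    and "W1p_cGamma \<Omega> \<Gamma> p v" and "Linf_Gamma_beta \<Omega> \<Gamma> \<beta> v"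
    and "weak_subsol \<Omega> p \<A> \<nu>p \<nu>m u"
    and "weak_supersol \<Omega> p \<A> \<nu>p \<nu>m v"
    and "quasicont p \<Omega> u" and "quasicont p \<Omega> v"
  shows "qe p \<Omega> (\<lambda>x. u x \<le> v x) \<and>
         (weak_sol \<Omega> p \<A> \<nu>p \<nu>m u \<and> weak_sol \<Omega> p \<A> \<nu>p \<nu>m v \<longrightarrow> qe p \<Omega> (\<lambda>x. u x = v x))"
proof (intro conjI impI)
  note data = assms(2,4-7) assms(8,9,12)
  have le: "AE x in lebesgue. x \<in> \<Omega> \<longrightarrow> (u x, v x) \<notin> {z. snd z < fst z}"
    using comparison_AE[OF data assms(14-19)] by (simp add: not_less)
  have "open {z :: real \<times> real. snd z < fst z}" by (intro open_Collect_less continuous_intros)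
  from quasicont_AE_imp_qe[OF less_imp_le[OF assms(2)] assms(4,5,20,21) this le]
  show "qe p \<Omega> (\<lambda>x. u x \<le> v x)" by (simp add: not_less)
next
  note data = assms(2,4-7) assms(8,9,12)
  assume sol: "weak_sol \<Omega> p \<A> \<nu>p \<nu>m u \<and> weak_sol \<Omega> p \<A> \<nu>p \<nu>m v"
  have "AE x in lebesgue. x \<in> \<Omega> \<longrightarrow> u x \<le> v x"
    by (rule comparison_AE[OF data assms(14-19)])
  moreover have "AE x in lebesgue. x \<in> \<Omega> \<longrightarrow> v x \<le> u x"
    by (rule comparison_AE[OF data assms(16,17,14,15)]) (use sol in \<open>auto simp: weak_sol_def\<close>)
  ultimately have eq: "AE x in lebesgue. x \<in> \<Omega> \<longrightarrow> (u x, v x) \<notin> {z. fst z \<noteq> snd z}"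
    by eventually_elim auto
  have "open {z :: real \<times> real. fst z \<noteq> snd z}" by (intro open_Collect_neq continuous_intros)
  from quasicont_AE_imp_qe[OF less_imp_le[OF assms(2)] assms(4,5,20,21) this eq]
  show "qe p \<Omega> (\<lambda>x. u x = v x)" by simp
qed

end
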